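(* Let $\mathcal{T}>0$ and let $\Omega\subset\mathbb{R}^2$ be a domain with boundary $\partial\Omega$ and outward unit normal $\boldsymbol{n}=(n^1,n^2)^\top$. Let $\boldsymbol{u}=(\rho,\rho u,\rho v,E)^\top$ be an admissible solution on $\Omega\times(0,\mathcal{T}]$ of the compressible Navier-Stokes equations $$\frac{\partial \boldsymbol{u}}{\partial t}+\frac{\partial \boldsymbol{f}^I}{\partial x}+\frac{\partial \boldsymbol{g}^I}{\partial y}=\frac{\partial \boldsymbol{f}^V}{\partial x}+\frac{\partial \boldsymbol{g}^V}{\partial y}$$ subject to the boundary conditions $$n^1(\boldsymbol{f}^I-\boldsymbol{f}^V)+n^2(\boldsymbol{g}^I-\boldsymbol{g}^V)=[n^1\boldsymbol{f}_b+n^2\boldsymbol{g}_b](x,y,t)\quad\text{on }\partial\Omega,$$ where the fluxes, the boundary data flux vector $[n^1\boldsymbol{f}_b+n^2\boldsymbol{g}_b]$ in each of the four flow regimes (supersonic inflow, subsonic inflow, subsonic outflow, supersonic outflow), and the assumptions on the initial and boundary data are those given in the context. Then, with $\boldsymbol{v}=(u,v)^\top$ and $T$ the temperature, the solution satisfies the a priori estimates $$\{\rho,\ \rho|\boldsymbol{v}|^2,\ p,\ \rho\log(\rho),\ \rho\log(T)\}\subset L^\infty(0,\mathcal{T};L^1(\Omega)).$$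
   Context: **Variables.** $\rho$ is density, $\boldsymbol{v}=(u,v)^\top$ velocity, $E$ total energy. The pressure is $p=(\gamma-1)\left(E-\tfrac12\rho(u^2+v^2)\right)$, where $\gamma=c_p/c_v>1$ is the ratio of the constant positive specific heats $c_p,c_v$. The gas constant is $R=c_p-c_v$, the temperature is $T=p/(\rho R)$, and the sound speed is $c=\sqrt{\gamma RT}$. The dynamic viscosity is $\mu>0$ and the heat conductivity is $\kappa>0$. **Fluxes.** $$\boldsymbol{f}^I=(\rho u,\ \rho u^2+p,\ \rho uv,\ u(E+p))^\top,\qquad \boldsymbol{g}^I=(\rho v,\ \rho uv,\ \rho v^2+p,\ v(E+p))^\top,$$ $$\boldsymbol{f}^V=(0,\ \tau_{xx},\ \tau_{xy},\ u\tau_{xx}+v\tau_{xy}+\kappa T_x)^\top,\qquad \boldsymbol{g}^V=(0,\ \tau_{xy},\ \tau_{yy},\ u\tau_{xy}+v\tau_{yy}+\kappa T_y)^\top,$$ with $\tau_{xx}=\tfrac43\mu u_x-\tfrac23\mu v_y$, $\tau_{xy}=\mu(u_y+v_x)$, $\tau_{yy}=\tfrac43\mu v_y-\tfrac23\mu u_x$. **Admissibility and initial data.** A solution is admissible if $p,\rho,T>0$. The initial data are uniformly bounded in $H^1(\Omega)$, have $p,\rho,T$ bounded away from zero, and are compatible with the boundary data. **Boundary data.** Data functions (subscript $b$) on $\partial\Omega\times[0,\mathcal{T}]$ are given: $\rho_b$, $p_b$, $\boldsymbol{v}_b=(u_b,v_b)$ (full velocity vector) and $v_{b\tau}$ (tangential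 velocity, relative to the counter-clockwise unit tangent $\boldsymbol{\tau}=(-n^2,n^1)^\top$). They are bounded in $H^1(\partial\Omega\times(0,\mathcal{T}])$, continuous in time and in space along the boundary, and $\rho_b,p_b,T_b\ge\epsilon>0$, where $T_b=p_b/(\rho_bR)$ and $c_b=\sqrt{\gamma p_b/\rho_b}$. At supersonic inflow points (defined below) the data satisfy $\boldsymbol{v}_b\cdot\boldsymbol{n}<0$ and $|\boldsymbol{v}_b\cdot\boldsymbol{n}|>c_b$. **Flow regimes.** At each time, with $v_n=\boldsymbol{v}\cdot\boldsymbol{n}$, a boundary point is: - a supersonic inflow point if $v_n<0$, $|v_n|>c_b$; - a subsonic inflow point if $v_n<0$, $|v_n|\le c_b$; - a subsonic outflow point if $v_n>0$, $|v_n|\le c$; - a supersonic outflow point if $v_n>0$, $|v_n|>c$. All boundary points are inflow or outflow boundary points. At points where $v_n=0$ the subsonic inflow and subsonic outflow formulas below coincide (both give $(0,n^1p_b,n^2p_b,0)^\top$), and this common value is used. **Boundary data flux vector $[n^1\boldsymbol{f}_b+n^2\boldsymbol{g}_b]$.** *Supersonic inflow:* $$\left(\rho_b\,\boldsymbol{v}_b\cdot\boldsymbol{n},\ \rho_bu_b\,\boldsymbol{v}_b\cdot\boldsymbol{n}+n^1p_b,\ \rho_bv_b\,\boldsymbol{v}_b\cdot\boldsymbol{n}+n^2p_b,\ \boldsymbol{v}_b\cdot\boldsymbol{n}\,(E_b+p_b)\right)^\top,\quad E_b=\tfrac12\rho_b(u_b^2+v_b^2)+\tfrac{p_b}{\gamma-1}.$$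 *Subsonic inflow:* $$\left(\rho_bv_n,\ \rho_bv_nu^*+n^1p_b,\ \rho_bv_nv^*+n^2p_b,\ v_n(E^*+p_b)\right)^\top,\quad E^*=\tfrac12\rho_b(v_n^2+v_{b\tau}^2)+\tfrac{p_b}{\gamma-1},$$ with $u^*=v_nn^1-v_{b\tau}n^2$ and $v^*=v_nn^2+v_{b\tau}n^1$. *Subsonic outflow:* $$\left(\rho v_n,\ \rho uv_n+n^1p_b,\ \rho vv_n+n^2p_b,\ v_n(E+p)\right)^\top.$$ *Supersonic outflow:* $n^1\boldsymbol{f}^I+n^2\boldsymbol{g}^I$ (equivalently, $n^1\boldsymbol{f}^V+n^2\boldsymbol{g}^V=0$). An a priori estimate means that the norms are bounded by constants determined by $\mathcal{T}$, the domain, the physical parameters, and the initial and boundary data, not by the solution. *)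

theory Defs
  imports "HOL-Analysis.Analysis"
begin

section \<open>Thermodynamics and fluxes\<close>

record gas =
  cp :: real
  cv :: real
  visc :: real    \<comment> \<open>dynamic viscosity \<open>\<mu>\<close>\<close>
  cond :: real    \<comment> \<open>heat conductivity \<open>\<kappa>\<close>\<close>

definition gam :: "gas \<Rightarrow> real" where "gam G = cp G / cv G"

definition gas_const :: "gas \<Rightarrow> real" where "gas_const G = cp G - cv G"

definition gas_ok :: "gas \<Rightarrow> bool" where
  "gas_ok G \<longleftrightarrow> 0 < cp G \<and> 0 < cv G \<and> 1 < gam G \<and> 0 < visc G \<and> 0 < cond G"

text \<open>A state is the vector of conserved variables \<open>(\<rho>, \<rho>u, \<rho>v, E)\<close>.\<close>

type_synonym point = "real \<times> real"
type_synonym state = "real \<times> real \<times> real \<times> real"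

fun dens :: "state \<Rightarrow> real" where "dens (r, m1, m2, e) = r"
fun velx :: "state \<Rightarrow> real" where "velx (r, m1, m2, e) = m1 / r"
fun vely :: "state \<Rightarrow> real" where "vely (r, m1, m2, e) = m2 / r"
fun energy :: "state \<Rightarrow> real" where "energy (r, m1, m2, e) = e"

definition pressure :: "gas \<Rightarrow> state \<Rightarrow> real" where
  "pressure G q = (gam G - 1) * (energy q - 1/2 * dens q * ((velx q)\<^sup>2 + (vely q)\<^sup>2))"

definition temperature :: "gas \<Rightarrow> state \<Rightarrow> real" where
  "temperature G q = pressure G q / (dens q * gas_const G)"

definition sound_speed :: "gas \<Rightarrow> state \<Rightarrow> real" where
  "sound_speed G q = sqrt (gam G * gas_const G * temperature G q)"

definition normal_vel :: "state \<Rightarrow> point \<Rightarrow> real" where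
  "normal_vel q n = velx q * fst n + vely q * snd n"

definition inv_flux_x :: "gas \<Rightarrow> state \<Rightarrow> state" where
  "inv_flux_x G q = (let \<rho> = dens q; u = velx q; v = vely q; E = energy q; p = pressure G q in
     (\<rho> * u, \<rho> * u\<^sup>2 + p, \<rho> * u * v, u * (E + p)))"

definition inv_flux_y :: "gas \<Rightarrow> state \<Rightarrow> state" where
  "inv_flux_y G q = (let \<rho> = dens q; u = velx q; v = vely q; E = energy q; p = pressure G q in
     (\<rho> * v, \<rho> * u * v, \<rho> * v\<^sup>2 + p, v * (E + p)))"

text \<open>Directional derivative of \<open>f\<close> in the open set \<open>\<Omega>\<close>, continuously extended to the boundary.
  At a boundary point the value is meaningful only if the limit exists.\<close>

definition pderiv_ext :: "point set \<Rightarrow> point \<Rightarrow> (point \<Rightarrow> 'b::real_normed_vector) \<Rightarrow> point \<Rightarrow> 'b" where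
  "pderiv_ext \<Omega> i f x =
     (if x \<in> \<Omega> then frechet_derivative f (at x) i
      else Lim (at x within \<Omega>) (\<lambda>y. frechet_derivative f (at y) i))"

abbreviation dx :: "point set \<Rightarrow> (point \<Rightarrow> 'b::real_normed_vector) \<Rightarrow> point \<Rightarrow> 'b" where
  "dx \<Omega> \<equiv> pderiv_ext \<Omega> (1, 0)"

abbreviation dy :: "point set \<Rightarrow> (point \<Rightarrow> 'b::real_normed_vector) \<Rightarrow> point \<Rightarrow> 'b" where
  "dy \<Omega> \<equiv> pderiv_ext \<Omega> (0, 1)"

definition tau_xx :: "gas \<Rightarrow> point set \<Rightarrow> (point \<Rightarrow> state) \<Rightarrow> point \<Rightarrow> real" where
  "tau_xx G \<Omega> s x = 4/3 * visc G * dx \<Omega> (\<lambda>y. velx (s y)) x - 2/3 * visc G * dy \<Omega> (\<lambda>y. vely (s y)) x"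

definition tau_xy :: "gas \<Rightarrow> point set \<Rightarrow> (point \<Rightarrow> state) \<Rightarrow> point \<Rightarrow> real" where
  "tau_xy G \<Omega> s x = visc G * (dy \<Omega> (\<lambda>y. velx (s y)) x + dx \<Omega> (\<lambda>y. vely (s y)) x)"

definition tau_yy :: "gas \<Rightarrow> point set \<Rightarrow> (point \<Rightarrow> state) \<Rightarrow> point \<Rightarrow> real" where
  "tau_yy G \<Omega> s x = 4/3 * visc G * dy \<Omega> (\<lambda>y. vely (s y)) x - 2/3 * visc G * dx \<Omega> (\<lambda>y. velx (s y)) x"

definition visc_flux_x :: "gas \<Rightarrow> point set \<Rightarrow> (point \<Rightarrow> state) \<Rightarrow> point \<Rightarrow> state" where
  "visc_flux_x G \<Omega> s x =
     (0, tau_xx G \<Omega> s x, tau_xy G \<Omega> s x,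
      velx (s x) * tau_xx G \<Omega> s x + vely (s x) * tau_xy G \<Omega> s x
        + cond G * dx \<Omega> (\<lambda>y. temperature G (s y)) x)"

definition visc_flux_y :: "gas \<Rightarrow> point set \<Rightarrow> (point \<Rightarrow> state) \<Rightarrow> point \<Rightarrow> state" where
  "visc_flux_y G \<Omega> s x =
     (0, tau_xy G \<Omega> s x, tau_yy G \<Omega> s x,
      velx (s x) * tau_xy G \<Omega> s x + vely (s x) * tau_yy G \<Omega> s x
        + cond G * dy \<Omega> (\<lambda>y. temperature G (s y)) x)"


section \<open>Planar domains\<close>

definition rot90 :: "point \<Rightarrow> point" where "rot90 e = (- snd e, fst e)"

text \<open>Bounded domains lying locally below the graph, in the direction of some unit vector \<open>e\<close>, of a
  Lipschitz and piecewise continuously differentiable function; corners are allowed, cusps and slits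
  are not.\<close>

definition planar_domain :: "point set \<Rightarrow> bool" where
  "planar_domain \<Omega> \<longleftrightarrow>
     open \<Omega> \<and> connected \<Omega> \<and> \<Omega> \<noteq> {} \<and> bounded \<Omega> \<and>
     (\<forall>x\<in>frontier \<Omega>. \<exists>e r L. \<exists>h :: real \<Rightarrow> real.
        norm e = 1 \<and> 0 < r \<and> L-lipschitz_on UNIV h \<and> h piecewise_C1_differentiable_on UNIV \<and>
        \<Omega> \<inter> ball x r = {y \<in> ball x r. y \<bullet> e < h (y \<bullet> rot90 e)})"

text \<open>To first order at the boundary point \<open>x\<close>, \<open>\<Omega>\<close> is the half plane
  \<open>{y. (y - x) \<bullet> n < 0}\<close>. Such an \<open>n\<close> is unique, and it exists at all but
  finitely many boundary points of a \<open>planar_domain\<close>.\<close>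

definition outward_normal :: "point set \<Rightarrow> point \<Rightarrow> point \<Rightarrow> bool" where
  "outward_normal \<Omega> x n \<longleftrightarrow> x \<in> frontier \<Omega> \<and> norm n = 1 \<and>
     (\<forall>\<epsilon>>0. \<exists>\<delta>>0. \<forall>y\<in>ball x \<delta>.
        (y \<in> \<Omega> \<longrightarrow> (y - x) \<bullet> n \<le> \<epsilon> * norm (y - x)) \<and>
        (y \<notin> \<Omega> \<longrightarrow> - \<epsilon> * norm (y - x) \<le> (y - x) \<bullet> n))"

text \<open>The counter-clockwise unit tangent \<open>(-n\<^sup>2, n\<^sup>1)\<close>.\<close>

definition tangent :: "point set \<Rightarrow> point \<Rightarrow> point" where
  "tangent \<Omega> x = rot90 (THE n. outward_normal \<Omega> x n)"


section \<open>Sobolev norms\<close>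

primrec Ck :: "nat \<Rightarrow> ('a::euclidean_space \<Rightarrow> real) \<Rightarrow> bool" where
  "Ck 0 f \<longleftrightarrow> continuous_on UNIV f"
| "Ck (Suc k) f \<longleftrightarrow> f differentiable_on UNIV \<and> (\<forall>b\<in>Basis. Ck k (\<lambda>x. frechet_derivative f (at x) b))"

definition test_functions :: "'a::euclidean_space set \<Rightarrow> ('a \<Rightarrow> real) set" where
  "test_functions S = {\<phi>. (\<forall>k. Ck k \<phi>) \<and> compact (closure {x. \<phi> x \<noteq> 0}) \<and> closure {x. \<phi> x \<noteq> 0} \<subseteq> S}"

definition square_integrable :: "'a measure \<Rightarrow> ('a \<Rightarrow> real) \<Rightarrow> bool" where
  "square_integrable N f \<longleftrightarrow> f \<in> borel_measurable N \<and> integrable N (\<lambda>x. (f x)\<^sup>2)"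

definition weak_derivative ::
  "'a measure \<Rightarrow> ('a \<Rightarrow> real) set \<Rightarrow> (('a \<Rightarrow> real) \<Rightarrow> 'a \<Rightarrow> real) \<Rightarrow> ('a \<Rightarrow> real) \<Rightarrow> ('a \<Rightarrow> real) \<Rightarrow> bool" where
  "weak_derivative N \<Phi> D f g \<longleftrightarrow>
     (\<forall>\<phi>\<in>\<Phi>. (LINT x|N. f x * D \<phi> x) = - (LINT x|N. g x * \<phi> x))"

text \<open>\<open>f\<close> belongs to \<open>H\<^sup>1\<close> with norm at most \<open>M\<close>, where the first-order derivatives are the two
  (weak) ones given on test functions by \<open>D1\<close> and \<open>D2\<close>.\<close>

definition H1_norm_le ::
  "'a measure \<Rightarrow> ('a \<Rightarrow> real) set \<Rightarrow> (('a \<Rightarrow> real) \<Rightarrow> 'a \<Rightarrow> real) \<Rightarrow> (('a \<Rightarrow> real) \<Rightarrow> 'a \<Rightarrow> real)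
     \<Rightarrow> ('a \<Rightarrow> real) \<Rightarrow> real \<Rightarrow> bool" where
  "H1_norm_le N \<Phi> D1 D2 f M \<longleftrightarrow>
     (\<exists>g1 g2. square_integrable N f \<and> square_integrable N g1 \<and> square_integrable N g2 \<and>
        weak_derivative N \<Phi> D1 f g1 \<and> weak_derivative N \<Phi> D2 f g2 \<and>
        sqrt (LINT x|N. (f x)\<^sup>2 + (g1 x)\<^sup>2 + (g2 x)\<^sup>2) \<le> M)"

definition H1_domain_le :: "point set \<Rightarrow> (point \<Rightarrow> real) \<Rightarrow> real \<Rightarrow> bool" where
  "H1_domain_le \<Omega> = H1_norm_le (lebesgue_on \<Omega>) (test_functions \<Omega>)
     (\<lambda>\<phi> x. frechet_derivative \<phi> (at x) (1, 0)) (\<lambda>\<phi> x. frechet_derivative \<phi> (at x) (0, 1))"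

text \<open>Arc length on the boundary is one-dimensional Hausdorff measure (a metric outer measure, hence
  countably additive on Borel sets by Caratheodory's theorem).\<close>

definition hausdorff1_outer :: "'a::metric_space set \<Rightarrow> ennreal" where
  "hausdorff1_outer A =
     (SUP \<delta>\<in>{0::real<..}. INF U\<in>{U :: nat \<Rightarrow> 'a set. A \<subseteq> (\<Union>i. U i) \<and> (\<forall>i. bounded (U i) \<and> diameter (U i) \<le> \<delta>)}.
        \<Sum>i. ennreal (diameter (U i)))"

definition arc_length :: "point set \<Rightarrow> point measure" where
  "arc_length S = restrict_space (measure_of UNIV (sets borel) hausdorff1_outer) S"

text \<open>The space \<open>H\<^sup>1(\<partial>\<Omega> \<times> (0, tmax])\<close>, with the tangential and the time derivative.
  As \<open>\<partial>\<Omega>\<close> consists of closed curves, the test functions only have to vanish near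
  \<open>t = 0\<close> and \<open>t = tmax\<close>.\<close>

definition H1_boundary_le :: "point set \<Rightarrow> real \<Rightarrow> (real \<Rightarrow> point \<Rightarrow> real) \<Rightarrow> real \<Rightarrow> bool" where
  "H1_boundary_le \<Omega> tmax g =
     H1_norm_le (lebesgue_on {0<..tmax} \<Otimes>\<^sub>M arc_length (frontier \<Omega>)) (test_functions ({0<..<tmax} \<times> UNIV))
       (\<lambda>\<phi> (t, x). frechet_derivative \<phi> (at (t, x)) (0, tangent \<Omega> x))
       (\<lambda>\<phi> (t, x). frechet_derivative \<phi> (at (t, x)) (1, 0))
       (\<lambda>(t, x). g t x)"


section \<open>Boundary data and boundary flux\<close>

record bvals =
  rho_b :: real
  p_b :: real
  u_b :: real
  v_b :: real
  vtau_b :: real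

definition temp_b :: "gas \<Rightarrow> bvals \<Rightarrow> real" where
  "temp_b G b = p_b b / (rho_b b * gas_const G)"

definition sound_b :: "gas \<Rightarrow> bvals \<Rightarrow> real" where
  "sound_b G b = sqrt (gam G * p_b b / rho_b b)"

definition normal_vel_b :: "bvals \<Rightarrow> point \<Rightarrow> real" where
  "normal_vel_b b n = u_b b * fst n + v_b b * snd n"

definition supersonic_inflow :: "gas \<Rightarrow> state \<Rightarrow> bvals \<Rightarrow> point \<Rightarrow> bool" where
  "supersonic_inflow G q b n \<longleftrightarrow> normal_vel q n < 0 \<and> \<bar>normal_vel q n\<bar> > sound_b G b"

definition subsonic_inflow :: "gas \<Rightarrow> state \<Rightarrow> bvals \<Rightarrow> point \<Rightarrow> bool" where
  "subsonic_inflow G q b n \<longleftrightarrow> normal_vel q n < 0 \<and> \<bar>normal_vel q n\<bar> \<le> sound_b G b"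

definition subsonic_outflow :: "gas \<Rightarrow> state \<Rightarrow> point \<Rightarrow> bool" where
  "subsonic_outflow G q n \<longleftrightarrow> normal_vel q n > 0 \<and> \<bar>normal_vel q n\<bar> \<le> sound_speed G q"

definition supersonic_outflow :: "gas \<Rightarrow> state \<Rightarrow> point \<Rightarrow> bool" where
  "supersonic_outflow G q n \<longleftrightarrow> normal_vel q n > 0 \<and> \<bar>normal_vel q n\<bar> > sound_speed G q"

definition flux_supersonic_inflow :: "gas \<Rightarrow> bvals \<Rightarrow> point \<Rightarrow> state" where
  "flux_supersonic_inflow G b n =
     (let vbn = normal_vel_b b n;
          Eb = 1/2 * rho_b b * ((u_b b)\<^sup>2 + (v_b b)\<^sup>2) + p_b b / (gam G - 1) in
      (rho_b b * vbn, rho_b b * u_b b * vbn + fst n * p_b b, rho_b b * v_b b * vbn + snd n * p_b b,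
       vbn * (Eb + p_b b)))"

definition flux_subsonic_inflow :: "gas \<Rightarrow> state \<Rightarrow> bvals \<Rightarrow> point \<Rightarrow> state" where
  "flux_subsonic_inflow G q b n =
     (let vn = normal_vel q n;
          us = vn * fst n - vtau_b b * snd n;
          vs = vn * snd n + vtau_b b * fst n;
          Es = 1/2 * rho_b b * (vn\<^sup>2 + (vtau_b b)\<^sup>2) + p_b b / (gam G - 1) in
      (rho_b b * vn, rho_b b * vn * us + fst n * p_b b, rho_b b * vn * vs + snd n * p_b b,
       vn * (Es + p_b b)))"

definition flux_subsonic_outflow :: "gas \<Rightarrow> state \<Rightarrow> bvals \<Rightarrow> point \<Rightarrow> state" where
  "flux_subsonic_outflow G q b n =
     (let vn = normal_vel q n in
      (dens q * vn, dens q * velx q * vn + fst n * p_b b, dens q * vely q * vn + snd n * p_b b,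
       vn * (energy q + pressure G q)))"

definition boundary_flux :: "gas \<Rightarrow> state \<Rightarrow> bvals \<Rightarrow> point \<Rightarrow> state" where
  "boundary_flux G q b n =
     (if supersonic_inflow G q b n then flux_supersonic_inflow G b n
      else if subsonic_inflow G q b n then flux_subsonic_inflow G q b n
      else if subsonic_outflow G q n then flux_subsonic_outflow G q b n
      else if supersonic_outflow G q n then fst n *\<^sub>R inv_flux_x G q + snd n *\<^sub>R inv_flux_y G q
      else (0, fst n * p_b b, snd n * p_b b, 0))"

definition boundary_condition ::
  "gas \<Rightarrow> point set \<Rightarrow> (point \<Rightarrow> state) \<Rightarrow> (point \<Rightarrow> bvals) \<Rightarrow> point \<Rightarrow> point \<Rightarrow> bool" where
  "boundary_condition G \<Omega> s b x n \<longleftrightarrow>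
     fst n *\<^sub>R (inv_flux_x G (s x) - visc_flux_x G \<Omega> s x) + snd n *\<^sub>R (inv_flux_y G (s x) - visc_flux_y G \<Omega> s x)
       = boundary_flux G (s x) (b x) n"

text \<open>All bounds on the data are collected in \<open>M\<close> and \<open>\<epsilon>\<close>. The supremum bound is no
  restriction for fixed data, which are continuous on a compact set; it records that the constants in
  the estimates may depend on the suprema.\<close>

definition boundary_data_ok ::
  "gas \<Rightarrow> point set \<Rightarrow> real \<Rightarrow> real \<Rightarrow> real \<Rightarrow> (real \<Rightarrow> point \<Rightarrow> bvals) \<Rightarrow> bool" where
  "boundary_data_ok G \<Omega> tmax M \<epsilon> b \<longleftrightarrow>
     (\<forall>c\<in>{rho_b, p_b, u_b, v_b, vtau_b}.
        continuous_on ({0..tmax} \<times> frontier \<Omega>) (\<lambda>(t, x). c (b t x)) \<and>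
        (\<forall>t\<in>{0..tmax}. \<forall>x\<in>frontier \<Omega>. \<bar>c (b t x)\<bar> \<le> M) \<and>
        H1_boundary_le \<Omega> tmax (\<lambda>t x. c (b t x)) M) \<and>
     (\<forall>t\<in>{0..tmax}. \<forall>x\<in>frontier \<Omega>. rho_b (b t x) \<ge> \<epsilon> \<and> p_b (b t x) \<ge> \<epsilon> \<and> temp_b G (b t x) \<ge> \<epsilon>)"

definition has_boundary_gradient :: "point set \<Rightarrow> (point \<Rightarrow> 'b::real_normed_vector) \<Rightarrow> point \<Rightarrow> bool" where
  "has_boundary_gradient \<Omega> f x \<longleftrightarrow>
     (\<exists>r>0. \<forall>y\<in>\<Omega> \<inter> ball x r. f differentiable (at y)) \<and>
     (\<forall>i\<in>Basis. \<exists>l. ((\<lambda>y. frechet_derivative f (at y) i) \<longlongrightarrow> l) (at x within \<Omega>))"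

text \<open>Compatibility: the boundary condition holds initially, wherever the viscous fluxes of the
  initial data (only in \<open>H\<^sup>1\<close>) have boundary values.\<close>

definition initial_data_ok ::
  "gas \<Rightarrow> point set \<Rightarrow> real \<Rightarrow> real \<Rightarrow> (real \<Rightarrow> point \<Rightarrow> bvals) \<Rightarrow> (point \<Rightarrow> state) \<Rightarrow> bool" where
  "initial_data_ok G \<Omega> M \<epsilon> b s0 \<longleftrightarrow>
     (\<forall>i\<in>Basis. H1_domain_le \<Omega> (\<lambda>x. s0 x \<bullet> i) M) \<and>
     (\<forall>x\<in>closure \<Omega>. dens (s0 x) \<ge> \<epsilon> \<and> pressure G (s0 x) \<ge> \<epsilon> \<and> temperature G (s0 x) \<ge> \<epsilon>) \<and>
     (\<forall>x n. outward_normal \<Omega> x n \<and> has_boundary_gradient \<Omega> s0 x \<longrightarrow> boundary_condition G \<Omega> s0 (b 0) x n)"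


section \<open>Admissible solutions\<close>

text \<open>Classical regularity: the state is continuous on \<open>[0, tmax] \<times> closure \<Omega>\<close>, its spatial
  gradient extends continuously to \<open>(0, tmax] \<times> closure \<Omega>\<close>, and the time derivative and the
  second spatial derivatives are continuous in \<open>(0, tmax] \<times> \<Omega>\<close>.\<close>

definition classical_regularity :: "point set \<Rightarrow> real \<Rightarrow> (real \<Rightarrow> point \<Rightarrow> state) \<Rightarrow> bool" where
  "classical_regularity \<Omega> tmax w \<longleftrightarrow>
     continuous_on ({0..tmax} \<times> closure \<Omega>) (\<lambda>(t, x). w t x) \<and>
     (\<forall>t\<in>{0<..tmax}. \<forall>x\<in>\<Omega>.
        w t differentiable (at x) \<and>
        (\<forall>i\<in>Basis. pderiv_ext \<Omega> i (w t) differentiable (at x)) \<and>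
        (\<lambda>s. w s x) differentiable (at t within {0..tmax})) \<and>
     (\<forall>i\<in>Basis. continuous_on ({0<..tmax} \<times> closure \<Omega>) (\<lambda>(t, x). pderiv_ext \<Omega> i (w t) x)) \<and>
     (\<forall>i\<in>Basis. \<forall>j\<in>Basis.
        continuous_on ({0<..tmax} \<times> \<Omega>) (\<lambda>(t, x). pderiv_ext \<Omega> j (pderiv_ext \<Omega> i (w t)) x)) \<and>
     continuous_on ({0<..tmax} \<times> \<Omega>) (\<lambda>(t, x). vector_derivative (\<lambda>s. w s x) (at t within {0..tmax}))"

definition admissible :: "gas \<Rightarrow> point set \<Rightarrow> real \<Rightarrow> (real \<Rightarrow> point \<Rightarrow> state) \<Rightarrow> bool" where
  "admissible G \<Omega> tmax w \<longleftrightarrow>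
     (\<forall>t\<in>{0..tmax}. \<forall>x\<in>closure \<Omega>. pressure G (w t x) > 0 \<and> dens (w t x) > 0 \<and> temperature G (w t x) > 0)"

definition navier_stokes :: "gas \<Rightarrow> point set \<Rightarrow> real \<Rightarrow> (real \<Rightarrow> point \<Rightarrow> state) \<Rightarrow> bool" where
  "navier_stokes G \<Omega> tmax w \<longleftrightarrow>
     (\<forall>t\<in>{0<..tmax}. \<forall>x\<in>\<Omega>.
        vector_derivative (\<lambda>s. w s x) (at t within {0..tmax})
          + dx \<Omega> (\<lambda>y. inv_flux_x G (w t y)) x + dy \<Omega> (\<lambda>y. inv_flux_y G (w t y)) x
        = dx \<Omega> (visc_flux_x G \<Omega> (w t)) x + dy \<Omega> (visc_flux_y G \<Omega> (w t)) x)"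

text \<open>The last condition is the assumption on the data at supersonic inflow points, which depends on
  the solution because the flow regime does.\<close>

definition admissible_solution ::
  "gas \<Rightarrow> point set \<Rightarrow> real \<Rightarrow> (point \<Rightarrow> state) \<Rightarrow> (real \<Rightarrow> point \<Rightarrow> bvals) \<Rightarrow> (real \<Rightarrow> point \<Rightarrow> state) \<Rightarrow> bool" where
  "admissible_solution G \<Omega> tmax s0 b w \<longleftrightarrow>
     classical_regularity \<Omega> tmax w \<and> admissible G \<Omega> tmax w \<and> navier_stokes G \<Omega> tmax w \<and>
     (\<forall>x\<in>closure \<Omega>. w 0 x = s0 x) \<and>
     (\<forall>t\<in>{0<..tmax}. \<forall>x n. outward_normal \<Omega> x n \<longrightarrow> boundary_condition G \<Omega> (w t) (b t) x n) \<and>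
     (\<forall>t\<in>{0..tmax}. \<forall>x n. outward_normal \<Omega> x n \<and> supersonic_inflow G (w t x) (b t x) n \<longrightarrow>
        normal_vel_b (b t x) n < 0 \<and> \<bar>normal_vel_b (b t x) n\<bar> > sound_b G (b t x))"


section \<open>The norm of \<open>L\<^sup>\<infinity>(0, tmax; L\<^sup>1(\<Omega>))\<close>\<close>

definition Linf_L1_norm_le :: "point set \<Rightarrow> real \<Rightarrow> (real \<Rightarrow> point \<Rightarrow> real) \<Rightarrow> real \<Rightarrow> bool" where
  "Linf_L1_norm_le \<Omega> tmax f C \<longleftrightarrow>
     (\<lambda>(t, x). f t x) \<in> borel_measurable (lebesgue_on ({0<..<tmax} \<times> \<Omega>)) \<and>
     (AE t in lebesgue_on {0<..<tmax}.
        integrable (lebesgue_on \<Omega>) (f t) \<and> (LINT x|lebesgue_on \<Omega>. \<bar>f t x\<bar>) \<le> C)"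

end

theory Submission
  imports Defs
begin

text \<open>
  All five estimates come from one functional, the integral over \<open>\<Omega>\<close> of
  \<open>\<eta> = K (\<rho> + E) - \<rho> s\<close>. Here \<open>s = c\<^sub>v ln T - R ln \<rho>\<close> is the specific entropy up to a
  constant, and \<open>K = 2 + 2 R\<close>. Since \<open>- \<rho> s = R \<rho> ln \<rho> - c\<^sub>v \<rho> ln T\<close>, where
  \<open>\<rho> ln \<rho> \<ge> - 1\<close> and \<open>c\<^sub>v \<rho> ln T \<le> c\<^sub>v \<rho> T \<le> E\<close>, an affine function of \<open>\<eta>\<close> bounds the absolute
  values of the five quantities (\<open>lyapunov_controls\<close>), so only an upper bound on \<open>\<integral>\<eta>\<close> is needed.
  At the initial time the \<open>L\<^sup>2\<close> norms of \<open>\<rho>\<close> and \<open>E\<close> and the lower bound on \<open>T\<close> give one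
  (\<open>initial_lyapunov_bound\<close>).

  Inside the domain the conservation laws imply \<open>\<eta>\<^sub>t + div Q \<le> 0\<close>, where \<open>Q\<close> is \<open>K\<close> times the sum of the net
  mass and energy fluxes, minus \<open>\<rho> s v\<close>, plus \<open>\<kappa> \<nabla>T / T\<close>. The defect is
  \<open>\<Phi> / T + \<kappa> |\<nabla>T|\<^sup>2 / T\<^sup>2\<close> with the viscous dissipation \<open>\<Phi>\<close>
  (\<open>entropy_balance_identity\<close>, \<open>interior_balance\<close>).

  On the boundary \<open>Q \<bullet> n \<ge> - C\<close> with a constant \<open>C\<close> given by the data (\<open>boundary_entropy_bound\<close>). The
  boundary condition expresses \<open>\<rho> v\<^sub>n\<close> and the normal heat flux through the data and the state. At outflow,
  mass and energy leave at the rate \<open>v\<^sub>n (\<rho> + E + p)\<close>, and \<open>K\<close> times this absorbs the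
  entropy flux. At inflow the mass flux is bounded, but the temperature is not controlled; there the
  normal heat flux contributes a positive multiple of \<open>p\<^sub>b / T\<close>, which outweighs \<open>ln T\<close> as \<open>T\<close> tends to 0.
  In the supersonic case this multiple is positive because the prescribed normal velocity is itself
  supersonic.

  It remains to integrate the local balance (\<open>evolution_inequality\<close>). The derivatives of \<open>\<eta>\<close> and \<open>Q\<close> may be
  unbounded near the boundary and near \<open>t = 0\<close>, and the boundary is only piecewise smooth. So the balance is
  tested with functions supported inside the domain: a partition of unity times a cutoff of the
  depth \<open>h(y \<bullet> rot90 e) - y \<bullet> e\<close> below the graph. As the cutoff tends to 1, its gradient concentrates
  along the graph and points inwards, so only the lower bound on \<open>Q \<bullet> n\<close> enters. The mass of the
  concentrating gradient is bounded, uniformly in the cutoff, by testing the constant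
  field \<open>e\<close> (\<open>layer_mass\<close>).
\<close>

section \<open>Continuously differentiable functions and cutoffs\<close>

text \<open>The gradient \<open>g\<close> is a parameter, so that the calculus below computes it and its components
  can be differentiated again.\<close>

definition C1_on :: "point set \<Rightarrow> (point \<Rightarrow> real) \<Rightarrow> (point \<Rightarrow> point) \<Rightarrow> bool" where
  "C1_on W f g \<longleftrightarrow> continuous_on W g \<and> (\<forall>z\<in>W. GDERIV f z :> g z)"

lemma C1_on_continuous: "C1_on W f g \<Longrightarrow> continuous_on W f"
  unfolding C1_on_def gderiv_def
  by (meson continuous_at_imp_continuous_on has_derivative_continuous)

definition ramp :: "real \<Rightarrow> real" where "ramp t = (max 0 t)\<^sup>2"

lemma DERIV_ramp: "(ramp has_real_derivative 2 * max 0 t) (at t)"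
proof (cases "t = 0")
  case True
  have "((\<lambda>h. (ramp (0 + h) - ramp 0) / h) \<longlongrightarrow> 0) (at 0)"
  proof (rule Lim_null_comparison)
    show "((\<lambda>h::real. \<bar>h\<bar>) \<longlongrightarrow> 0) (at 0)" by (auto intro!: tendsto_eq_intros)
    show "\<forall>\<^sub>F h in at 0. norm ((ramp (0 + h) - ramp 0) / h) \<le> \<bar>h\<bar>"
      by (rule always_eventually) (auto simp: ramp_def max_def power2_eq_square)
  qed
  then show ?thesis using True by (simp add: DERIV_def)
next
  case False
  show ?thesis
  proof (cases "t > 0")
    case True
    have "((\<lambda>t. t\<^sup>2) has_real_derivative 2 * t) (at t)" by (auto intro!: derivative_eq_intros)
    then have "(ramp has_real_derivative 2 * t) (at t)"
      by (rule has_field_derivative_transform_within_open[where S="{0<..}"]) (use True in \<open>auto simp: ramp_def\<close>)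
    then show ?thesis using True by simp
  next
    case False
    with \<open>t \<noteq> 0\<close> have "t < 0" by simp
    have "((\<lambda>t. 0) has_real_derivative 0) (at t)" by simp
    then have "(ramp has_real_derivative 0) (at t)"
      by (rule has_field_derivative_transform_within_open[where S="{..<0}"]) (use \<open>t < 0\<close> in \<open>auto simp: ramp_def\<close>)
    then show ?thesis using \<open>t < 0\<close> by simp
  qed
qed

lemma ramp_nonneg [simp]: "0 \<le> ramp t" by (simp add: ramp_def)
lemma ramp_pos: "0 < t \<Longrightarrow> 0 < ramp t" by (simp add: ramp_def)
lemma ramp_eq_0: "t \<le> 0 \<Longrightarrow> ramp t = 0" by (simp add: ramp_def)

lemma ramp_DERIV_chain: "(g has_real_derivative m) (at x within s) \<Longrightarrow>
    ((\<lambda>x. ramp (g x)) has_real_derivative 2 * max 0 (g x) * m) (at x within s)"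
  using DERIV_chain2[OF DERIV_ramp] by blast

text \<open>The squared positive parts make the quotient continuously differentiable; it increases from 0
  at \<open>\<delta>\<close> to 1 at \<open>2 \<delta>\<close>.\<close>

definition cutoff :: "real \<Rightarrow> real \<Rightarrow> real" where
  "cutoff \<delta> t = ramp (t - \<delta>) / (ramp (t - \<delta>) + ramp (2 * \<delta> - t))"

definition cutoff' :: "real \<Rightarrow> real \<Rightarrow> real" where
  "cutoff' \<delta> t = (2 * max 0 (t - \<delta>) * ramp (2 * \<delta> - t) + ramp (t - \<delta>) * (2 * max 0 (2 * \<delta> - t)))
     / (ramp (t - \<delta>) + ramp (2 * \<delta> - t))\<^sup>2"

lemma cutoff_denom_pos: "0 < \<delta> \<Longrightarrow> 0 < ramp (t - \<delta>) + ramp (2 * \<delta> - t)"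
  using ramp_pos[of "t - \<delta>"] ramp_pos[of "2 * \<delta> - t"] ramp_nonneg[of "t - \<delta>"] ramp_nonneg[of "2 * \<delta> - t"]
  by linarith

lemma DERIV_cutoff:
  assumes "0 < \<delta>" shows "(cutoff \<delta> has_real_derivative cutoff' \<delta> t) (at t)"
proof -
  have 1: "((\<lambda>t. ramp (t - \<delta>)) has_real_derivative 2 * max 0 (t - \<delta>) * 1) (at t)"
    by (rule ramp_DERIV_chain) (auto intro!: derivative_eq_intros)
  have 2: "((\<lambda>t. ramp (2 * \<delta> - t)) has_real_derivative 2 * max 0 (2 * \<delta> - t) * (-1)) (at t)"
    by (rule ramp_DERIV_chain) (auto intro!: derivative_eq_intros)
  have 0: "ramp (t - \<delta>) + ramp (2 * \<delta> - t) \<noteq> 0" using cutoff_denom_pos[OF assms, of t] by simp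
  show ?thesis
    unfolding cutoff_def[abs_def] cutoff'_def
    by (rule DERIV_cong[OF DERIV_divide[OF 1 DERIV_add[OF 1 2] 0]])
       (simp add: power2_eq_square algebra_simps)
qed

lemma ramp_continuous: "continuous_on UNIV ramp"
  by (meson DERIV_ramp DERIV_isCont continuous_at_imp_continuous_on)

lemma cutoff'_continuous:
  assumes "0 < \<delta>" shows "continuous_on UNIV (cutoff' \<delta>)"
proof -
  have 0: "ramp (t - \<delta>) + ramp (2 * \<delta> - t) \<noteq> 0" for t using cutoff_denom_pos[OF assms, of t] by simp
  show ?thesis
    unfolding cutoff'_def[abs_def]
    by (intro continuous_intros continuous_on_compose2[OF ramp_continuous]) (use 0 in auto)
qed

lemma cutoff_continuous: "0 < \<delta> \<Longrightarrow> continuous_on UNIV (cutoff \<delta>)"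
  by (meson DERIV_cutoff DERIV_isCont continuous_at_imp_continuous_on)

lemma cutoff_bounds: "0 \<le> cutoff \<delta> t" "cutoff \<delta> t \<le> 1"
proof -
  have "a / (a + b) \<le> 1" if "0 \<le> a" "0 \<le> b" for a b :: real
    using that by (cases "a + b = 0") (auto simp: divide_le_eq_1)
  then show "0 \<le> cutoff \<delta> t" "cutoff \<delta> t \<le> 1" by (auto simp: cutoff_def)
qed

lemma cutoff_0: "t \<le> \<delta> \<Longrightarrow> cutoff \<delta> t = 0" "t \<le> \<delta> \<Longrightarrow> cutoff' \<delta> t = 0"
  by (auto simp: cutoff_def cutoff'_def ramp_eq_0)

lemma cutoff_1: "0 < \<delta> \<Longrightarrow> 2 * \<delta> \<le> t \<Longrightarrow> cutoff \<delta> t = 1" "2 * \<delta> \<le> t \<Longrightarrow> cutoff' \<delta> t = 0"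
  using ramp_pos[of "t - \<delta>"]
  by (auto simp: cutoff_def cutoff'_def ramp_eq_0)

lemma cutoff'_nonneg: "0 \<le> cutoff' \<delta> t"
  unfolding cutoff'_def by (auto intro!: divide_nonneg_nonneg add_nonneg_nonneg mult_nonneg_nonneg)

section \<open>Integrals of gradients with compact support\<close>

lemma finite_line_preimage:
  fixes a c :: real assumes "finite S" "a \<noteq> 0" shows "finite {x. a * x + c \<in> S}"
proof -
  have "inj (\<lambda>x. a * x + c)" using assms by (auto simp: inj_def)
  then show ?thesis using finite_vimageI[OF assms(1)] by (simp add: vimage_def)
qed

lemma integral_derivative_zero_1d:
  fixes f D :: "real \<Rightarrow> real"
  assumes "continuous_on UNIV f" "finite S" "\<And>x. x \<notin> S \<Longrightarrow> (f has_real_derivative D x) (at x)"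
    and "\<And>x. \<bar>x\<bar> \<ge> B \<Longrightarrow> f x = 0" and int: "integrable lborel D"
  shows "(\<integral>x. D x \<partial>lborel) = 0"
proof -
  define B' where "B' = max B 1"
  define C where "C = B' + 1"
  have D0: "D x = 0" if "x \<notin> S" "\<bar>x\<bar> > B'" for x
  proof -
    have "((\<lambda>_. 0) has_real_derivative 0) (at x)" by simp
    moreover have "open {x::real. \<bar>x\<bar> > B'}"
      by (intro open_Collect_less continuous_intros)
    ultimately have "(f has_real_derivative 0) (at x)"
      by (rule has_field_derivative_transform_within_open) (use that assms(4) in \<open>auto simp: B'_def\<close>)
    with assms(3)[OF that(1)] show ?thesis using DERIV_unique by blast
  qed
  have "(D has_integral f C - f (-C)) {-C..C}"
    by (rule fundamental_theorem_of_calculus_strong[OF \<open>finite S\<close>])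
       (use assms in \<open>auto simp: C_def B'_def has_real_derivative_iff_has_vector_derivative[symmetric]
          intro: continuous_on_subset has_field_derivative_at_within\<close>)
  moreover have "f C = 0" "f (-C) = 0" using assms(4) by (auto simp: C_def B'_def)
  ultimately have "(D has_integral 0) {-C..C}" by simp
  then have "((\<lambda>x. if x \<in> {-C..C} then D x else 0) has_integral 0) UNIV"
    by (simp only: has_integral_restrict_UNIV)
  then have "(D has_integral 0) UNIV"
    by (rule has_integral_spike_finite[OF \<open>finite S\<close>, rotated]) (use D0 in \<open>auto simp: C_def\<close>)
  moreover have "(D has_integral (\<integral>x. D x \<partial>lborel)) UNIV"
    using has_integral_integral_lborel[OF int] .
  ultimately show ?thesis using has_integral_unique by blast
qed

text \<open>Horizontal lines meet the exceptional lines \<open>z \<bullet> d \<in> S\<close> in finitely many points, unless the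
  exceptional lines are horizontal themselves; then only finitely many horizontal lines are bad.\<close>

lemma AE_finite_section:
  fixes d :: point assumes "d \<noteq> 0" "finite S"
  shows "AE y in lborel. finite {x. (x, y) \<bullet> d \<in> S}"
proof (cases "fst d = 0")
  case False
  have "finite {x. fst d * x + snd d * y \<in> S}" for y by (rule finite_line_preimage[OF assms(2) False])
  then show ?thesis by (simp add: inner_prod_def mult.commute)
next
  case True
  then have "snd d \<noteq> 0" using assms(1) by (auto simp: prod_eq_iff)
  then have "finite {y. snd d * y + 0 \<in> S}" by (rule finite_line_preimage[OF assms(2)])
  then have "AE y in lborel. y \<notin> {y. snd d * y + 0 \<in> S}"
    by (intro AE_not_in finite_imp_null_set_lborel)
  then show ?thesis by eventually_elim (use True in \<open>simp add: inner_prod_def mult.commute\<close>)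
qed

lemma GDERIV_section_fst:
  "GDERIV f (x, y) :> (a, b) \<Longrightarrow> ((\<lambda>x. f (x, y)) has_real_derivative a) (at x)" for f :: "point \<Rightarrow> real"
proof -
  assume "GDERIV f (x, y) :> (a, b)"
  then have "(f has_derivative (\<lambda>h. h \<bullet> (a, b))) (at (x, y))" by (simp add: gderiv_def)
  moreover have "((\<lambda>x. (x, y)) has_derivative (\<lambda>h. (h, 0))) (at x)"
    by (auto intro!: derivative_eq_intros)
  ultimately have "((\<lambda>x. f (x, y)) has_derivative (\<lambda>h. (h, 0) \<bullet> (a, b))) (at x)"
    by (rule has_derivative_compose[rotated])
  then show ?thesis by (simp add: has_field_derivative_def mult_commute_abs inner_prod_def)
qed

lemma GDERIV_swap:
  "GDERIV f (prod.swap z) :> prod.swap g \<Longrightarrow> GDERIV (\<lambda>z. f (prod.swap z)) z :> g" for f :: "point \<Rightarrow> real"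
proof -
  assume "GDERIV f (prod.swap z) :> prod.swap g"
  then have "(f has_derivative (\<lambda>h. h \<bullet> prod.swap g)) (at (prod.swap z))" by (simp add: gderiv_def)
  moreover have "(prod.swap has_derivative prod.swap) (at z)"
    unfolding prod.swap_def by (auto intro!: derivative_eq_intros)
  ultimately have "((\<lambda>x. f (prod.swap x)) has_derivative (\<lambda>h. prod.swap h \<bullet> prod.swap g)) (at z)"
    by (rule has_derivative_compose[rotated])
  then show ?thesis by (simp add: gderiv_def inner_prod_def add.commute prod.swap_def)
qed

text \<open>Fubini's theorem reduces this to lines, where the fundamental theorem of calculus tolerates finitely many
  points without derivative. The exceptional lines come from the corners of the boundary.\<close>

lemma integral_partial_zero:
  fixes f :: "point \<Rightarrow> real" and g :: "point \<Rightarrow> point"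
  assumes cont: "continuous_on UNIV f" and d: "d \<noteq> 0" "finite S"
    and der: "\<And>z. z \<bullet> d \<notin> S \<Longrightarrow> GDERIV f z :> g z"
    and out: "\<And>z. B \<le> norm z \<Longrightarrow> f z = 0"
  shows "integrable lborel (\<lambda>z. fst (g z)) \<Longrightarrow> (\<integral>z. fst (g z) \<partial>lborel) = 0"
    and "integrable lborel (\<lambda>z. snd (g z)) \<Longrightarrow> (\<integral>z. snd (g z) \<partial>lborel) = 0"
proof -
  have *: "(\<integral>z. fst (g z) \<partial>lborel) = 0"
    if cont: "continuous_on UNIV f" and d: "d \<noteq> 0"
    and der: "\<And>z. z \<bullet> d \<notin> S \<Longrightarrow> GDERIV f z :> g z"
    and out: "\<And>z. B \<le> norm z \<Longrightarrow> f z = 0"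
    and int: "integrable lborel (\<lambda>z. fst (g z))"
    for f :: "point \<Rightarrow> real" and g d
  proof -
    have int': "integrable (lborel \<Otimes>\<^sub>M lborel) (\<lambda>(x, y). fst (g (x, y)))"
      using int by (simp add: lborel_prod case_prod_beta')
    have "(\<integral>z. fst (g z) \<partial>lborel) = (\<integral>y. (\<integral>x. fst (g (x, y)) \<partial>lborel) \<partial>lborel)"
      using lborel_pair.integral_snd[OF int'] by (simp add: lborel_prod case_prod_beta')
    also have "\<dots> = 0"
    proof (rule integral_eq_zero_AE)
      have "AE y in lborel. integrable lborel (\<lambda>x. fst (g (x, y)))"
        using lborel_pair.AE_integrable_snd[OF int'] by simp
      with AE_finite_section[OF d \<open>finite S\<close>]
      show "AE y in lborel. (\<integral>x. fst (g (x, y)) \<partial>lborel) = 0"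
      proof eventually_elim
        case (elim y)
        show ?case
        proof (rule integral_derivative_zero_1d)
          show "continuous_on UNIV (\<lambda>x. f (x, y))"
            by (intro continuous_on_compose2[OF cont] continuous_intros) auto
          show "finite {x. (x, y) \<bullet> d \<in> S}" by fact
          show "((\<lambda>x. f (x, y)) has_real_derivative fst (g (x, y))) (at x)"
            if "x \<notin> {x. (x, y) \<bullet> d \<in> S}" for x
            by (rule GDERIV_section_fst[where b="snd (g (x, y))"]) (use der that in simp)
          show "f (x, y) = 0" if "B \<le> \<bar>x\<bar>" for x
            using norm_fst_le[of x y] out that by simp
          show "integrable lborel (\<lambda>x. fst (g (x, y)))" by fact
        qed
      qed
    qed
    finally show ?thesis .
  qed
  show "integrable lborel (\<lambda>z. fst (g z)) \<Longrightarrow> (\<integral>z. fst (g z) \<partial>lborel) = 0"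
    by (rule *[OF cont d(1) der out])
  assume int: "integrable lborel (\<lambda>z. snd (g z))"
  then have int': "integrable (lborel \<Otimes>\<^sub>M lborel) (\<lambda>(x, y). snd (g (x, y)))"
    by (simp add: lborel_prod case_prod_beta')
  have "(\<integral>z. snd (g z) \<partial>lborel) = (\<integral>(x,y). snd (g (y, x)) \<partial>(lborel \<Otimes>\<^sub>M lborel))"
    using lborel_pair.integral_product_swap[of "\<lambda>z. snd (g z)"] int'
    by (simp add: lborel_prod case_prod_beta' borel_measurable_integrable)
  also have "\<dots> = (\<integral>z. fst (prod.swap (g (prod.swap z))) \<partial>lborel)"
    by (simp add: lborel_prod case_prod_beta' prod.swap_def)
  also have "\<dots> = 0"
  proof (rule *[where f="\<lambda>z. f (prod.swap z)" and d="prod.swap d"])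
    show "continuous_on UNIV (\<lambda>z. f (prod.swap z))"
      unfolding prod.swap_def by (intro continuous_on_compose2[OF cont] continuous_intros) auto
    show "prod.swap d \<noteq> 0" using d by (auto simp: prod_eq_iff)
    show "GDERIV (\<lambda>z. f (prod.swap z)) z :> prod.swap (g (prod.swap z))" if "z \<bullet> prod.swap d \<notin> S" for z
      by (rule GDERIV_swap) (use that der in \<open>simp add: inner_prod_def add.commute\<close>)
    show "f (prod.swap z) = 0" if "B \<le> norm z" for z
      by (rule out) (use that in \<open>simp add: norm_prod_def add.commute\<close>)
    show "integrable lborel (\<lambda>z. fst (prod.swap (g (prod.swap z))))"
      using lborel_pair.integrable_product_swap[OF int'] by (simp add: lborel_prod case_prod_beta' prod.swap_def)
  qed
  finally show "(\<integral>z. snd (g z) \<partial>lborel) = 0" .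
qed

section \<open>Integration by parts below a graph\<close>

text \<open>The factor \<open>k\<close> is merely bounded and measurable because the slope of the boundary graph jumps at
  corners.\<close>

lemma integrable_supported:
  fixes c k :: "point \<Rightarrow> real"
  assumes "open U" "compact K" "K \<subseteq> U" "continuous_on U c" "\<And>z. z \<in> U - K \<Longrightarrow> c z = 0"
    and [measurable]: "k \<in> borel_measurable borel" and "\<And>z. \<bar>k z\<bar> \<le> B"
  shows "integrable lborel (\<lambda>z. indicator U z * (k z * c z))"
proof -
  have "(\<lambda>z. indicator U z *\<^sub>R c z) \<in> borel_measurable borel"
    using assms by (intro borel_measurable_continuous_on_indicator) auto
  then have [measurable]: "(\<lambda>z. indicator U z * c z) \<in> borel_measurable borel" by simp
  have "bounded (c ` K)"
    using assms by (meson compact_continuous_image compact_imp_bounded continuous_on_subset)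
  then obtain B' where B': "\<And>z. z \<in> K \<Longrightarrow> \<bar>c z\<bar> \<le> B'" unfolding bounded_iff by auto
  have "integrable lborel (\<lambda>z. k z * (indicator U z *\<^sub>R c z))"
  proof (rule integrableI_bounded_set[where A=K and B="B * B'"])
    show "emeasure lborel K < \<infinity>" using \<open>compact K\<close> using emeasure_compact_finite[of K] by (simp add: less_top)
    show "K \<in> sets lborel" using \<open>compact K\<close> by (simp add: borel_compact)
    show "(\<lambda>z. k z * (indicator U z *\<^sub>R c z)) \<in> borel_measurable lborel" by simp
    have "\<bar>k z * (indicator U z *\<^sub>R c z)\<bar> \<le> B * B'" if "z \<in> K" for z
      using assms(7)[of z] B'[OF that] by (auto simp: abs_mult indicator_def intro!: mult_mono)
    then show "AE z in lborel. z \<in> K \<longrightarrow> norm (k z * (indicator U z *\<^sub>R c z)) \<le> B * B'" by simp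
    show "AE z in lborel. z \<notin> K \<longrightarrow> k z * (indicator U z *\<^sub>R c z) = 0"
      using assms(5) by (auto simp: indicator_def)
  qed
  then show ?thesis by (simp add: mult.left_commute)
qed

lemma GDERIV_transform_open:
  assumes "GDERIV f z :> g" "open U" "z \<in> U" "\<And>y. y \<in> U \<Longrightarrow> f y = f' y"
  shows "GDERIV f' z :> g"
  using assms unfolding gderiv_def by (meson has_derivative_transform_within_open)

lemma GDERIV_inner: "GDERIV (\<lambda>z. z \<bullet> d) z :> d"
  unfolding gderiv_def by (auto intro!: derivative_eq_intros)

lemma norm_rot90 [simp]: "norm (rot90 e) = norm e"
  by (simp add: rot90_def norm_prod_def add.commute)

lemma inner_rot90 [simp]: "e \<bullet> rot90 e = 0" "rot90 e \<bullet> e = 0"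
  by (simp_all add: rot90_def inner_prod_def)

text \<open>A disc in which \<open>\<Omega>\<close> is the region below a Lipschitz graph. The derivative of \<open>h\<close> is fixed as a globally
  defined measurable function, with arbitrary bounded values on the finite set \<open>S\<close> of corners.\<close>

locale graph_chart =
  fixes \<Omega> :: "point set" and x0 e :: point and r L :: real and h h' :: "real \<Rightarrow> real" and S :: "real set"
  assumes open_\<Omega>: "open \<Omega>" and norm_e: "norm e = 1" and r_pos: "0 < r"
    and lip: "L-lipschitz_on UNIV h" and fin_S: "finite S"
    and der_h: "\<And>s. s \<notin> S \<Longrightarrow> (h has_real_derivative h' s) (at s)"
    and meas_h': "h' \<in> borel_measurable borel" and bound_h': "\<And>s. \<bar>h' s\<bar> \<le> L"
    and region: "\<Omega> \<inter> ball x0 r = {y \<in> ball x0 r. y \<bullet> e < h (y \<bullet> rot90 e)}"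
begin

abbreviation "U \<equiv> \<Omega> \<inter> ball x0 r"

text \<open>The depth is positive inside \<open>\<Omega>\<close> and zero on the graph; its gradient \<open>slope\<close> is a negative multiple of
  the outward normal.\<close>

definition depth :: "point \<Rightarrow> real" where "depth z = h (z \<bullet> rot90 e) - z \<bullet> e"

definition slope :: "point \<Rightarrow> point" where "slope z = h' (z \<bullet> rot90 e) *\<^sub>R rot90 e - e"

lemma open_U: "open U" using open_\<Omega> by auto

lemma L_nonneg: "0 \<le> L" using lip lipschitz_on_nonneg by blast

lemma continuous_h: "continuous_on A h"
  using lip by (meson lipschitz_on_continuous_on lipschitz_on_subset subset_UNIV)

lemma continuous_depth: "continuous_on A depth"
  unfolding depth_def by (intro continuous_intros continuous_on_compose2[OF continuous_h[of UNIV]]) auto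

lemma depth_pos_iff: "z \<in> ball x0 r \<Longrightarrow> z \<in> \<Omega> \<longleftrightarrow> 0 < depth z"
  using eqset_imp_iff[OF region, of z] by (simp add: depth_def)

lemma GDERIV_depth: "z \<bullet> rot90 e \<notin> S \<Longrightarrow> GDERIV depth z :> slope z"
  unfolding depth_def[abs_def] slope_def
  by (rule GDERIV_diff[OF GDERIV_DERIV_compose[OF GDERIV_inner der_h] GDERIV_inner])

lemma AE_regular: "AE z in lborel. z \<bullet> rot90 e \<notin> S"
proof -
  have "rot90 e \<noteq> 0" using norm_e norm_rot90[of e] by force
  have "{z. z \<bullet> rot90 e \<in> S} = (\<Union>s\<in>S. {z. rot90 e \<bullet> z = s})" by (auto simp: inner_commute)
  moreover have "negligible (\<Union>s\<in>S. {z. rot90 e \<bullet> z = s})"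
    using fin_S negligible_hyperplane \<open>rot90 e \<noteq> 0\<close> by (intro negligible_Union) auto
  ultimately have "{z. z \<bullet> rot90 e \<in> S} \<in> null_sets lebesgue"
    by (simp add: negligible_iff_null_sets)
  moreover have "{z. z \<bullet> rot90 e \<in> S} \<in> sets borel"
    by (intro borel_closed closed_vimage[where f="\<lambda>z. z \<bullet> rot90 e", unfolded vimage_def] finite_imp_closed fin_S)
       (intro continuous_intros)
  ultimately have "{z. z \<bullet> rot90 e \<in> S} \<in> null_sets lborel"
    by (simp add: null_sets_completion_iff)
  then show ?thesis using AE_not_in by fastforce
qed

end

text \<open>The test function is \<open>\<psi> z * cutoff \<delta> (depth z)\<close>. The bump \<open>\<psi>\<close> lives on the half-size disc, which
  leaves room to move a point of depth less than \<open>2 \<delta>\<close> up to the graph inside the chart.\<close>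

locale chart_bump = graph_chart +
  fixes \<psi> :: "point \<Rightarrow> real" and g :: "point \<Rightarrow> point" and \<delta> :: real
  assumes C1_\<psi>: "C1_on \<Omega> \<psi> g" and supp_\<psi>: "\<And>z. z \<in> \<Omega> - cball x0 (r/2) \<Longrightarrow> \<psi> z = 0"
    and \<delta>_pos: "0 < \<delta>"
begin

definition K where "K = {z \<in> cball x0 (r/2). \<delta> \<le> depth z}"

lemma compact_K: "compact K"
proof -
  have "closed {z. \<delta> \<le> depth z}" by (intro closed_Collect_le continuous_intros continuous_depth)
  moreover have "K = cball x0 (r/2) \<inter> {z. \<delta> \<le> depth z}" by (auto simp: K_def)
  ultimately show ?thesis by (simp add: compact_Int_closed)
qed

lemma K_subset: "K \<subseteq> U"
proof
  fix z assume "z \<in> K"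
  then have "z \<in> ball x0 r" "\<delta> \<le> depth z" using r_pos by (auto simp: K_def)
  then show "z \<in> U" using depth_pos_iff \<delta>_pos by auto
qed

lemma grad_supp: "z \<in> \<Omega> - cball x0 (r/2) \<Longrightarrow> g z = 0"
proof -
  assume z: "z \<in> \<Omega> - cball x0 (r/2)"
  have "GDERIV (\<lambda>_. 0) z :> (0::point)" by (rule GDERIV_const)
  then have "GDERIV \<psi> z :> 0"
    by (rule GDERIV_transform_open[where U="\<Omega> - cball x0 (r/2)"]) (use z supp_\<psi> open_\<Omega> in auto)
  moreover have "GDERIV \<psi> z :> g z" using C1_\<psi> z by (auto simp: C1_on_def)
  ultimately have "(\<lambda>v. v \<bullet> 0) = (\<lambda>v. v \<bullet> g z)" unfolding gderiv_def by (rule has_derivative_unique)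
  then have "g z \<bullet> g z = 0" by (metis inner_zero_right)
  then show "g z = 0" by simp
qed

lemma off_K:
  assumes "z \<in> U - K"
  shows "\<psi> z * cutoff \<delta> (depth z) = 0" "cutoff \<delta> (depth z) *\<^sub>R g z = 0" "\<psi> z * cutoff' \<delta> (depth z) = 0"
  using assms supp_\<psi>[of z] grad_supp[of z] cutoff_0[of "depth z" \<delta>] by (auto simp: K_def)

lemma continuous_\<psi>: "continuous_on U \<psi>" and continuous_g: "continuous_on U g"
  using C1_on_continuous[OF C1_\<psi>] C1_\<psi> by (auto simp: C1_on_def intro: continuous_on_subset)

lemma continuous_cutoff: "continuous_on A (\<lambda>z. cutoff \<delta> (depth z))"
   "continuous_on A (\<lambda>z. cutoff' \<delta> (depth z))"
  by (auto intro: continuous_on_compose2[OF cutoff_continuous[OF \<delta>_pos] continuous_depth]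
      continuous_on_compose2[OF cutoff'_continuous[OF \<delta>_pos] continuous_depth])

lemma integrable_supported':
  assumes "continuous_on U c" "\<And>z. z \<in> U - K \<Longrightarrow> c z = 0"
  shows "integrable lborel (\<lambda>z. indicator U z * c z)"
    "integrable lborel (\<lambda>z. indicator U z * (h' (z \<bullet> rot90 e) * c z))"
proof -
  have [measurable]: "(\<lambda>z. h' (z \<bullet> rot90 e)) \<in> borel_measurable borel"
    using meas_h' by measurable
  show "integrable lborel (\<lambda>z. indicator U z * c z)"
    using integrable_supported[OF open_U compact_K K_subset assms, of "\<lambda>_. 1" 1] by simp
  show "integrable lborel (\<lambda>z. indicator U z * (h' (z \<bullet> rot90 e) * c z))"
    by (rule integrable_supported[OF open_U compact_K K_subset assms]) (use bound_h' in auto)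
qed

lemma integrable_bulk:
  assumes "continuous_on U c" shows "integrable lborel (\<lambda>z. indicator U z * (\<psi> z * cutoff \<delta> (depth z) * c z))"
  by (rule integrable_supported'(1)) (intro continuous_intros continuous_\<psi> continuous_cutoff assms, simp add: off_K)

lemma integrable_gradient:
  assumes "continuous_on U c"
  shows "integrable lborel (\<lambda>z. indicator U z * (cutoff \<delta> (depth z) * (g z \<bullet> c z)))"
proof (rule integrable_supported'(1), intro continuous_intros continuous_g continuous_cutoff assms)
  fix z assume "z \<in> U - K"
  then have "cutoff \<delta> (depth z) *\<^sub>R g z \<bullet> c z = 0" by (simp add: off_K del: inner_scaleR_left scaleR_eq_0_iff)
  then show "cutoff \<delta> (depth z) * (g z \<bullet> c z) = 0" by simp
qed

lemma integrable_layer: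
  assumes "continuous_on U c"
  shows "integrable lborel (\<lambda>z. indicator U z * (\<psi> z * cutoff' \<delta> (depth z) * (slope z \<bullet> c z)))"
proof -
  have c: "continuous_on U (\<lambda>z. \<psi> z * cutoff' \<delta> (depth z) * (d \<bullet> c z))" for d
    by (intro continuous_intros continuous_\<psi> continuous_cutoff assms)
  have s: "\<psi> z * cutoff' \<delta> (depth z) * (d \<bullet> c z) = 0" if "z \<in> U - K" for z d
    using off_K(3)[OF that] by simp
  have "integrable lborel (\<lambda>z. indicator U z * (h' (z \<bullet> rot90 e) * (\<psi> z * cutoff' \<delta> (depth z) * (rot90 e \<bullet> c z)))
      - indicator U z * (\<psi> z * cutoff' \<delta> (depth z) * (e \<bullet> c z)))"
    by (rule Bochner_Integration.integrable_diff[OF integrable_supported'(2)[OF c s] integrable_supported'(1)[OF c s]])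
  then show ?thesis
    by (rule back_subst[of "integrable lborel"]) (simp add: fun_eq_iff slope_def inner_diff_left right_diff_distrib mult_ac)
qed

text \<open>Extended by 0, the product of the test function with \<open>Q\<close> is continuous with compact support in the
  plane, so the integral of its gradient vanishes.\<close>

lemma cutoff_product_integral:
  assumes Q: "C1_on \<Omega> Q gQ"
  defines "G \<equiv> (\<lambda>z. indicator U z *\<^sub>R ((\<psi> z * cutoff \<delta> (depth z)) *\<^sub>R gQ z
     + Q z *\<^sub>R (cutoff \<delta> (depth z) *\<^sub>R g z + (\<psi> z * cutoff' \<delta> (depth z)) *\<^sub>R slope z)))"
  shows "integrable lborel (\<lambda>z. fst (G z))" "integrable lborel (\<lambda>z. snd (G z))"
    "(\<integral>z. fst (G z) \<partial>lborel) = 0" "(\<integral>z. snd (G z) \<partial>lborel) = 0"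
proof -
  have cQ: "continuous_on U Q" "continuous_on U gQ"
    using C1_on_continuous[OF Q] Q by (auto simp: C1_on_def intro: continuous_on_subset)
  have int: "integrable lborel (\<lambda>z. G z \<bullet> b)" for b
  proof -
    have "integrable lborel (\<lambda>z. indicator U z * (\<psi> z * cutoff \<delta> (depth z) * (gQ z \<bullet> b))
      + indicator U z * (cutoff \<delta> (depth z) * (g z \<bullet> (Q z *\<^sub>R b)))
      + indicator U z * (\<psi> z * cutoff' \<delta> (depth z) * (slope z \<bullet> (Q z *\<^sub>R b))))"
      by (intro Bochner_Integration.integrable_add integrable_bulk integrable_gradient integrable_layer continuous_intros cQ)
    then show ?thesis
      by (rule back_subst[of "integrable lborel"]) (simp add: fun_eq_iff G_def inner_add_left distrib_left mult_ac)
  qed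
  show int1: "integrable lborel (\<lambda>z. fst (G z))" using int[of "(1, 0)"] by (simp add: inner_prod_def)
  show int2: "integrable lborel (\<lambda>z. snd (G z))" using int[of "(0, 1)"] by (simp add: inner_prod_def)
  define f where "f z = (if z \<in> U then \<psi> z * cutoff \<delta> (depth z) * Q z else 0)" for z
  have f0: "f z = 0" if "z \<notin> K" for z using that off_K(1)[of z] by (auto simp: f_def)
  have open_K: "open (- K)" using compact_K by (simp add: compact_imp_closed open_Compl)
  have "continuous_on U (\<lambda>z. \<psi> z * cutoff \<delta> (depth z) * Q z)"
    by (intro continuous_intros continuous_\<psi> continuous_cutoff cQ)
  then have "continuous_on U f" by (rule continuous_on_eq) (simp add: f_def)
  moreover have "continuous_on (- K) f"
    by (rule continuous_on_eq[of _ "\<lambda>_. 0"]) (use f0 in auto)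
  moreover have "U \<union> - K = UNIV" using K_subset by auto
  ultimately have cf: "continuous_on UNIV f"
    using continuous_on_open_Un[OF open_U open_K, of f] by simp
  have der: "GDERIV f z :> G z" if "z \<bullet> rot90 e \<notin> S" for z
  proof (cases "z \<in> U")
    case True
    have "GDERIV (\<lambda>z. (\<psi> z * cutoff \<delta> (depth z)) * Q z) z :> (\<psi> z * cutoff \<delta> (depth z)) *\<^sub>R gQ z
       + Q z *\<^sub>R (\<psi> z *\<^sub>R (cutoff' \<delta> (depth z) *\<^sub>R slope z) + cutoff \<delta> (depth z) *\<^sub>R g z)"
      using C1_\<psi> Q True
      by (intro GDERIV_mult GDERIV_DERIV_compose[OF GDERIV_depth[OF that] DERIV_cutoff[OF \<delta>_pos]]) (auto simp: C1_on_def)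
    moreover have "\<dots> = G z" using True by (simp add: G_def algebra_simps)
    ultimately have "GDERIV (\<lambda>z. (\<psi> z * cutoff \<delta> (depth z)) * Q z) z :> G z" by (rule GDERIV_subst)
    then show ?thesis
      by (rule GDERIV_transform_open[OF _ open_U True]) (simp add: f_def)
  next
    case False
    then have "z \<in> - K" using K_subset by auto
    have "GDERIV (\<lambda>_. 0) z :> (0::point)" by (rule GDERIV_const)
    then show ?thesis
      by (rule GDERIV_transform_open[OF GDERIV_subst open_K \<open>z \<in> - K\<close>]) (use False f0 in \<open>auto simp: G_def\<close>)
  qed
  have "rot90 e \<noteq> 0" using norm_e norm_rot90[of e] by force
  obtain B where B: "\<And>z. z \<in> K \<Longrightarrow> norm z \<le> B" 
    using compact_imp_bounded[OF compact_K] by (auto simp: bounded_iff)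
  then have out: "f z = 0" if "B + 1 \<le> norm z" for z 
  proof (cases "z \<in> K")
    case True
    with B[OF True] that show ?thesis by linarith
  qed (rule f0)
  show "(\<integral>z. fst (G z) \<partial>lborel) = 0" "(\<integral>z. snd (G z) \<partial>lborel) = 0"
    by (rule integral_partial_zero(1)[OF cf \<open>rot90 e \<noteq> 0\<close> fin_S der out int1], assumption, assumption,
       rule integral_partial_zero(2)[OF cf \<open>rot90 e \<noteq> 0\<close> fin_S der out int2])
qed

lemma integration_by_parts:
  assumes "C1_on \<Omega> (\<lambda>z. fst (Q z)) g1" "C1_on \<Omega> (\<lambda>z. snd (Q z)) g2"
  shows "(\<integral>z. indicator U z * (\<psi> z * cutoff \<delta> (depth z) * (fst (g1 z) + snd (g2 z))) \<partial>lborel)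
    + (\<integral>z. indicator U z * (cutoff \<delta> (depth z) * (g z \<bullet> Q z)) \<partial>lborel)
    + (\<integral>z. indicator U z * (\<psi> z * cutoff' \<delta> (depth z) * (slope z \<bullet> Q z)) \<partial>lborel) = 0"
proof -
  have "continuous_on U (\<lambda>z. (fst (Q z), snd (Q z)))"
    by (rule continuous_on_Pair[OF continuous_on_subset[OF assms(1)[THEN C1_on_continuous]]
        continuous_on_subset[OF assms(2)[THEN C1_on_continuous]]]) auto
  then have cQ: "continuous_on U Q" by (simp only: prod.collapse)
  have c: "continuous_on U g1" "continuous_on U g2" 
    using assms by (auto simp: C1_on_def intro: continuous_on_subset)
  have "continuous_on U (\<lambda>z. fst (g1 z) + snd (g2 z))" by (intro continuous_intros c)
  note I1 = integrable_bulk[OF this] and I2 = integrable_gradient[OF cQ] and I3 = integrable_layer[OF cQ]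
  note * = cutoff_product_integral[OF assms(1)] cutoff_product_integral[OF assms(2)]
  have "0 = (\<integral>z. fst (indicator U z *\<^sub>R ((\<psi> z * cutoff \<delta> (depth z)) *\<^sub>R g1 z
     + fst (Q z) *\<^sub>R (cutoff \<delta> (depth z) *\<^sub>R g z + (\<psi> z * cutoff' \<delta> (depth z)) *\<^sub>R slope z)))
     + snd (indicator U z *\<^sub>R ((\<psi> z * cutoff \<delta> (depth z)) *\<^sub>R g2 z
     + snd (Q z) *\<^sub>R (cutoff \<delta> (depth z) *\<^sub>R g z + (\<psi> z * cutoff' \<delta> (depth z)) *\<^sub>R slope z))) \<partial>lborel)"
    unfolding Bochner_Integration.integral_add[OF *(1) *(6)] *(3) *(8) by simp
  also have "\<dots> = (\<integral>z. indicator U z * (\<psi> z * cutoff \<delta> (depth z) * (fst (g1 z) + snd (g2 z)))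
    + indicator U z * (cutoff \<delta> (depth z) * (g z \<bullet> Q z))
    + indicator U z * (\<psi> z * cutoff' \<delta> (depth z) * (slope z \<bullet> Q z)) \<partial>lborel)"
  proof (rule Bochner_Integration.integral_cong[OF refl], goal_cases)
    case (1 z)
    show ?case unfolding inner_prod_def inner_real_def fst_scaleR snd_scaleR fst_add snd_add real_scaleR_def
      by (simp only: distrib_left mult_ac add_ac)
  qed
  also have "\<dots> = (\<integral>z. indicator U z * (\<psi> z * cutoff \<delta> (depth z) * (fst (g1 z) + snd (g2 z))) \<partial>lborel)
    + (\<integral>z. indicator U z * (cutoff \<delta> (depth z) * (g z \<bullet> Q z)) \<partial>lborel)
    + (\<integral>z. indicator U z * (\<psi> z * cutoff' \<delta> (depth z) * (slope z \<bullet> Q z)) \<partial>lborel)"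
    by (simp only: Bochner_Integration.integral_add[OF Bochner_Integration.integrable_add[OF I1 I2] I3]
        Bochner_Integration.integral_add[OF I1 I2])
  finally show ?thesis by (rule sym)
qed

end

section \<open>Boundary charts and outward normals\<close>

lemma lipschitz_derivative_bound:
  fixes h :: "real \<Rightarrow> real"
  assumes "L-lipschitz_on UNIV h" "(h has_real_derivative D) (at s)"
  shows "\<bar>D\<bar> \<le> L"
proof -
  have "((\<lambda>k. (h (s + k) - h s) / k) \<longlongrightarrow> D) (at 0)" using assms(2) by (simp add: DERIV_def)
  then have "((\<lambda>k. \<bar>(h (s + k) - h s) / k\<bar>) \<longlongrightarrow> \<bar>D\<bar>) (at 0)" by (rule tendsto_rabs)
  then show ?thesis
  proof (rule tendsto_upperbound)
    have "\<bar>(h (s + k) - h s) / k\<bar> \<le> L" if "k \<noteq> 0" for k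
      using lipschitz_onD[OF assms(1), of "s + k" s] that by (simp add: dist_real_def divide_le_eq)
    then show "\<forall>\<^sub>F k in at 0. \<bar>(h (s + k) - h s) / k\<bar> \<le> L"
      by (simp add: eventually_at_filter)
  qed simp
qed

text \<open>A disc inside \<open>\<Omega>\<close> is also a chart, with a constant graph lying above the disc; so interior points
  and boundary points are treated alike.\<close>

lemma graph_chart_exists:
  assumes "planar_domain \<Omega>" "x \<in> closure \<Omega>"
  shows "\<exists>e r L h h' S. graph_chart \<Omega> x e r L h h' S"
proof (cases "x \<in> \<Omega>")
  case True
  have op: "open \<Omega>" using assms by (simp add: planar_domain_def)
  then obtain r where r: "0 < r" "ball x r \<subseteq> \<Omega>" using True open_contains_ball by blast
  define e where "e = ((1, 0) :: point)"
  have e: "norm e = 1" by (simp add: e_def norm_prod_def)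
  have "y \<bullet> e < x \<bullet> e + r" if "y \<in> ball x r" for y
  proof -
    have "(y - x) \<bullet> e \<le> norm (y - x) * norm e" by (rule norm_cauchy_schwarz)
    also have "\<dots> < r" using that e by (simp add: dist_norm norm_minus_commute)
    finally show ?thesis by (simp add: inner_diff_left)
  qed
  then have "graph_chart \<Omega> x e r 0 (\<lambda>_. x \<bullet> e + r) (\<lambda>_. 0) {}"
    using op r e by unfold_locales (auto simp: lipschitz_on_def)
  then show ?thesis by blast
next
  case False
  have op: "open \<Omega>" using assms by (simp add: planar_domain_def)
  with False assms have "x \<in> frontier \<Omega>" by (simp add: frontier_def interior_open)
  with assms obtain e r L and h :: "real \<Rightarrow> real" where
    *: "norm e = 1" "0 < r" "L-lipschitz_on UNIV h" "h piecewise_C1_differentiable_on UNIV"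
      "\<Omega> \<inter> ball x r = {y \<in> ball x r. y \<bullet> e < h (y \<bullet> rot90 e)}"
    unfolding planar_domain_def by blast
  then obtain S where S: "finite S" "h C1_differentiable_on (UNIV - S)"
    unfolding piecewise_C1_differentiable_on_def by auto
  then obtain D where D: "\<And>s. s \<notin> S \<Longrightarrow> (h has_vector_derivative D s) (at s)" "continuous_on (UNIV - S) D"
    unfolding C1_differentiable_on_def by auto
  define h' where "h' s = (if s \<in> S then 0 else D s)" for s
  have "open (UNIV - S)" using S(1) by (simp add: finite_imp_closed open_Diff)
  then have "(\<lambda>s. indicator (UNIV - S) s *\<^sub>R D s) \<in> borel_measurable borel"
    by (intro borel_measurable_continuous_on_indicator D(2)) auto
  moreover have "(\<lambda>s. indicator (UNIV - S) s *\<^sub>R D s) = h'"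
    by (auto simp: h'_def indicator_def)
  ultimately have meas: "h' \<in> borel_measurable borel" by simp
  have der: "(h has_real_derivative h' s) (at s)" if "s \<notin> S" for s
    using D(1)[OF that] that by (simp add: h'_def has_real_derivative_iff_has_vector_derivative)
  have "0 \<le> L" using *(3) lipschitz_on_nonneg by blast
  then have "\<bar>h' s\<bar> \<le> L" for s
    using lipschitz_derivative_bound[OF *(3) der[of s]] by (cases "s \<in> S") (auto simp: h'_def)
  then have "graph_chart \<Omega> x e r L h h' S" using * S(1) der meas op by unfold_locales
  then show ?thesis by blast
qed

context graph_chart
begin

lemma orthonormal: "e \<bullet> e = 1" "rot90 e \<bullet> rot90 e = 1"
  using norm_e norm_rot90[of e] by (simp_all add: dot_square_norm)

lemma norm_slope: "1 \<le> norm (slope z)" "norm (slope z) \<le> 1 + L"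
proof -
  have "slope z \<bullet> slope z = (h' (z \<bullet> rot90 e))\<^sup>2 + 1"
    by (simp add: slope_def inner_diff_left inner_diff_right orthonormal power2_eq_square)
  then have "1\<^sup>2 \<le> (norm (slope z))\<^sup>2" by (simp add: dot_square_norm)
  then show "1 \<le> norm (slope z)" by (rule power2_le_imp_le) simp
  have "norm (slope z) \<le> norm (h' (z \<bullet> rot90 e) *\<^sub>R rot90 e) + norm e"
    unfolding slope_def by (rule norm_triangle_ineq4)
  then show "norm (slope z) \<le> 1 + L" using bound_h'[of "z \<bullet> rot90 e"] norm_e by simp
qed

text \<open>Differentiability of \<open>h\<close> at the foot point says that the graph is, to first order, its tangent line. The
  error in \<open>h\<close> is divided by \<open>norm (slope z)\<close>, which is at least 1.\<close>

lemma outward_normal_slope: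
  assumes z': "z \<in> ball x0 r" "depth z = 0" "z \<bullet> rot90 e \<notin> S"
  shows "outward_normal \<Omega> z (- (1 / norm (slope z)) *\<^sub>R slope z)"
  unfolding outward_normal_def
proof (intro conjI allI impI)
  define N where "N = norm (slope z)"
  define s where "s = z \<bullet> rot90 e"
  have N: "1 \<le> N" using norm_slope by (simp add: N_def)
  then show "norm (- (1 / norm (slope z)) *\<^sub>R slope z) = 1" by (simp add: N_def[symmetric])
  have hs: "h s = z \<bullet> e" using z' by (simp add: depth_def s_def)
  have "z \<notin> \<Omega>" using depth_pos_iff z' by auto
  moreover have "z \<in> closure \<Omega>"
    unfolding closure_approachable
  proof (intro allI impI)
    fix \<epsilon> :: real assume "0 < \<epsilon>"
    have "0 < r - dist x0 z" using z' by simp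
    \<comment> \<open>moving down by \<open>t\<close> enters \<open>\<Omega>\<close> and stays in the chart\<close>
    define t where "t = min (\<epsilon> / 2) ((r - dist x0 z) / 2)"
    have t: "0 < t" "t < \<epsilon>" "t < r - dist x0 z"
      using \<open>0 < \<epsilon>\<close> \<open>0 < r - dist x0 z\<close> by (auto simp: t_def min_def)
    have d: "dist (z - t *\<^sub>R e) z = t" using t norm_e by (simp add: dist_norm)
    have "dist x0 (z - t *\<^sub>R e) \<le> dist x0 z + t"
      using dist_triangle[of x0 "z - t *\<^sub>R e" z] d by (simp add: dist_commute)
    then have "z - t *\<^sub>R e \<in> ball x0 r" using t by simp
    moreover have "depth (z - t *\<^sub>R e) = t"
      using hs by (simp add: depth_def inner_diff_left orthonormal s_def)
    ultimately have "z - t *\<^sub>R e \<in> \<Omega>" using depth_pos_iff t by simp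
    then show "\<exists>y\<in>\<Omega>. dist y z < \<epsilon>" using d t by (intro bexI[of _ "z - t *\<^sub>R e"]) auto
  qed
  ultimately show "z \<in> frontier \<Omega>" using open_\<Omega> by (simp add: frontier_def interior_open)
  fix \<epsilon> :: real assume "0 < \<epsilon>"
  have "(h has_derivative (\<lambda>k. h' s * k)) (at s)"
    using der_h[OF z'(3)] by (simp add: has_field_derivative_def s_def)
  then obtain \<delta>1 where \<delta>1: "0 < \<delta>1"
    "\<And>k. norm (k - s) < \<delta>1 \<Longrightarrow> norm (h k - h s - h' s * (k - s)) \<le> \<epsilon> * norm (k - s)"
    using \<open>0 < \<epsilon>\<close> unfolding has_derivative_at_alt by blast
  define \<delta> where "\<delta> = min \<delta>1 (r - dist x0 z)"
  have "0 < \<delta>" using \<delta>1 z' by (simp add: \<delta>_def)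
  have "(y \<in> \<Omega> \<longrightarrow> (y - z) \<bullet> (- (1 / norm (slope z)) *\<^sub>R slope z) \<le> \<epsilon> * norm (y - z)) \<and>
        (y \<notin> \<Omega> \<longrightarrow> - \<epsilon> * norm (y - z) \<le> (y - z) \<bullet> (- (1 / norm (slope z)) *\<^sub>R slope z))"
    if y: "y \<in> ball z \<delta>" for y
  proof -
    define k where "k = y \<bullet> rot90 e"
    have "dist x0 y \<le> dist x0 z + dist z y" by (rule dist_triangle)
    then have "y \<in> ball x0 r" using y by (simp add: \<delta>_def)
    then have in_iff: "y \<in> \<Omega> \<longleftrightarrow> y \<bullet> e < h k" using depth_pos_iff by (simp add: depth_def k_def)
    have "\<bar>(y - z) \<bullet> rot90 e\<bar> \<le> norm (y - z) * norm (rot90 e)" by (rule Cauchy_Schwarz_ineq2)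
    then have ks: "\<bar>k - s\<bar> \<le> norm (y - z)" using norm_e by (simp add: k_def s_def inner_diff_left)
    moreover have "norm (y - z) < \<delta>1" using y by (simp add: \<delta>_def dist_norm norm_minus_commute)
    ultimately have "\<bar>h k - h s - h' s * (k - s)\<bar> \<le> \<epsilon> * \<bar>k - s\<bar>" using \<delta>1(2)[of k] by simp
    also have "\<dots> \<le> \<epsilon> * norm (y - z)" using ks \<open>0 < \<epsilon>\<close> by simp
    finally have der: "\<bar>h k - h s - h' s * (k - s)\<bar> \<le> \<epsilon> * norm (y - z)" .
    define w where "w = (y \<bullet> e - h s) - h' s * (k - s)"
    have "(y - z) \<bullet> slope z = - w"
      using hs by (simp add: slope_def w_def k_def s_def inner_diff_left inner_diff_right algebra_simps)
    then have eq: "(y - z) \<bullet> (- (1 / norm (slope z)) *\<^sub>R slope z) = w / N"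
      by (simp add: N_def)
    have p: "0 \<le> \<epsilon> * norm (y - z)" using \<open>0 < \<epsilon>\<close> by simp
    have ub: "w / N \<le> \<epsilon> * norm (y - z)" if "y \<in> \<Omega>"
    proof -
      have "w \<le> \<epsilon> * norm (y - z)" using that der by (auto simp: in_iff w_def)
      also have "\<dots> \<le> \<epsilon> * norm (y - z) * N" using N p mult_left_mono[of 1 N "\<epsilon> * norm (y - z)"] by simp
      finally show ?thesis using N by (simp add: divide_le_eq)
    qed
    have lb: "- \<epsilon> * norm (y - z) \<le> w / N" if "y \<notin> \<Omega>"
    proof -
      have "- (\<epsilon> * norm (y - z)) * N \<le> - (\<epsilon> * norm (y - z))" using N p mult_left_mono[of 1 N "\<epsilon> * norm (y - z)"] by simp
      also have "\<dots> \<le> w" using that der by (auto simp: in_iff w_def)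
      finally show ?thesis using N by (simp add: le_divide_eq)
    qed
    show ?thesis unfolding eq using ub lb by blast
  qed
  then show "\<exists>\<delta>>0. \<forall>y\<in>ball z \<delta>.
     (y \<in> \<Omega> \<longrightarrow> (y - z) \<bullet> (- (1 / norm (slope z)) *\<^sub>R slope z) \<le> \<epsilon> * norm (y - z)) \<and>
     (y \<notin> \<Omega> \<longrightarrow> - \<epsilon> * norm (y - z) \<le> (y - z) \<bullet> (- (1 / norm (slope z)) *\<^sub>R slope z))"
    using \<open>0 < \<delta>\<close> by blast
qed

text \<open>Near the graph \<open>Q\<close> differs by at most \<open>\<omega>\<close> from its value at the boundary point straight
  above, where the lower bound on \<open>Q \<bullet> n\<close> is available.\<close>

lemma slope_flux_bound:
  assumes z: "z \<in> \<Omega>" "z \<in> cball x0 (r/2)" "z \<bullet> rot90 e \<notin> S" "depth z < r / 2"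
    and normal: "\<And>x n. outward_normal \<Omega> x n \<Longrightarrow> - C \<le> Q x \<bullet> n" and "0 \<le> C"
    and osc: "\<And>y. y \<in> closure \<Omega> \<Longrightarrow> dist y z \<le> depth z \<Longrightarrow> dist (Q z) (Q y) \<le> \<omega>"
  shows "slope z \<bullet> Q z \<le> (C + \<omega>) * (1 + L)"
proof -
  have "z \<in> ball x0 r" using z r_pos by auto
  then have "0 < depth z" using depth_pos_iff z by simp
  define y where "y = z + depth z *\<^sub>R e"
  have dist: "dist y z = depth z" using \<open>0 < depth z\<close> norm_e by (simp add: y_def dist_norm)
  have "dist x0 y \<le> dist x0 z + dist y z" by (metis dist_commute dist_triangle)
  then have yb: "y \<in> ball x0 r" using z dist by simp
  have yd: "y \<bullet> rot90 e = z \<bullet> rot90 e" by (simp add: y_def inner_add_left)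
  then have "slope y = slope z" by (simp add: slope_def)
  have "depth y = 0" using yd by (simp add: depth_def y_def inner_add_left orthonormal)
  from outward_normal_slope[OF yb this] z(3) yd
  have n: "outward_normal \<Omega> y (- (1 / norm (slope z)) *\<^sub>R slope z)" by (simp add: \<open>slope y = slope z\<close>)
  then have "y \<in> closure \<Omega>" by (simp add: outward_normal_def frontier_def)
  from osc[OF this] dist have \<omega>: "norm (Q z - Q y) \<le> \<omega>" by (simp add: dist_norm)
  have N: "0 < norm (slope z)" using norm_slope[of z] by linarith
  have "- C \<le> - (1 / norm (slope z)) * (slope z \<bullet> Q y)" using normal[OF n] by (simp add: inner_commute)
  then have 1: "slope z \<bullet> Q y \<le> C * norm (slope z)" using N by (simp add: field_simps)
  have "slope z \<bullet> (Q z - Q y) \<le> norm (slope z) * norm (Q z - Q y)" by (rule norm_cauchy_schwarz)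
  also have "\<dots> \<le> norm (slope z) * \<omega>" using \<omega> by (intro mult_left_mono) auto
  finally have "slope z \<bullet> Q z \<le> (C + \<omega>) * norm (slope z)" using 1 by (simp add: inner_diff_right algebra_simps)
  also have "0 \<le> \<omega>" using \<omega> norm_ge_zero order_trans by blast
  then have "(C + \<omega>) * norm (slope z) \<le> (C + \<omega>) * (1 + L)"
    using norm_slope(2)[of z] \<open>0 \<le> C\<close> by (intro mult_left_mono) auto
  finally show ?thesis .
qed

end

context chart_bump
begin

text \<open>The gradient of the cutoff concentrates on a thin layer, but its total mass stays bounded. Testing
  the constant field \<open>e\<close>, whose divergence vanishes and for which \<open>slope z \<bullet> e = - 1\<close>, turns this mass into an
  integral of the gradient of \<open>\<psi>\<close>; no measure of the layer has to be computed.\<close>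

lemma layer_mass:
  assumes G: "\<And>z. z \<in> \<Omega> \<Longrightarrow> norm (g z) \<le> G" and "0 \<le> G"
  shows "(\<integral>z. indicator U z * (\<psi> z * cutoff' \<delta> (depth z)) \<partial>lborel) \<le> G * measure lborel (ball x0 r)"
proof -
  have C1: "C1_on \<Omega> (\<lambda>_. c) (\<lambda>_. 0)" for c by (simp add: C1_on_def GDERIV_const)
  have s: "slope z \<bullet> e = - 1" for z by (simp add: slope_def inner_diff_left orthonormal)
  have "(\<integral>z. indicator U z * (cutoff \<delta> (depth z) * (g z \<bullet> e)) \<partial>lborel)
    + (\<integral>z. indicator U z * (\<psi> z * cutoff' \<delta> (depth z) * (-1)) \<partial>lborel) = 0"
    using integration_by_parts[of "\<lambda>_. e", OF C1 C1] by (simp add: s)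
  then have "(\<integral>z. indicator U z * (\<psi> z * cutoff' \<delta> (depth z)) \<partial>lborel)
    = (\<integral>z. indicator U z * (cutoff \<delta> (depth z) * (g z \<bullet> e)) \<partial>lborel)" by simp
  also have "\<dots> \<le> (\<integral>z. G * indicator (ball x0 r) z \<partial>lborel)"
  proof (rule integral_mono)
    show "integrable lborel (\<lambda>z. indicator U z * (cutoff \<delta> (depth z) * (g z \<bullet> e)))"
      by (rule integrable_gradient) simp
    show "integrable lborel (\<lambda>z. G * indicator (ball x0 r) z)"
      using emeasure_bounded_finite[of "ball x0 r"] by (intro integrable_mult_right integrable_real_indicator) auto
    fix z
    show "indicator U z * (cutoff \<delta> (depth z) * (g z \<bullet> e)) \<le> G * indicator (ball x0 r) z"
    proof (cases "z \<in> U")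
      case True
      have "g z \<bullet> e \<le> norm (g z) * norm e" by (rule norm_cauchy_schwarz)
      also have "\<dots> \<le> G" using G True norm_e by simp
      finally have "g z \<bullet> e \<le> G" .
      have "cutoff \<delta> (depth z) * (g z \<bullet> e) \<le> cutoff \<delta> (depth z) * G"
        using cutoff_bounds(1) by (rule mult_left_mono[OF \<open>g z \<bullet> e \<le> G\<close>])
      also have "\<dots> \<le> 1 * G" using cutoff_bounds(2) \<open>0 \<le> G\<close> by (rule mult_right_mono)
      finally show ?thesis using True by simp
    qed (use \<open>0 \<le> G\<close> in \<open>auto simp: indicator_def\<close>)
  qed
  also have "\<dots> = G * measure lborel (ball x0 r)" by simp
  finally show ?thesis .
qed

text \<open>One half of the divergence theorem: the layer term of the integration by parts, which would
  converge to the boundary integral, is only bounded from above.\<close>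

lemma divergence_estimate:
  assumes Q: "C1_on \<Omega> (\<lambda>z. fst (Q z)) g1" "C1_on \<Omega> (\<lambda>z. snd (Q z)) g2"
    and pos: "\<And>z. z \<in> \<Omega> \<Longrightarrow> 0 \<le> \<psi> z" and G: "\<And>z. z \<in> \<Omega> \<Longrightarrow> norm (g z) \<le> G"
    and c: "\<And>z. z \<in> \<Omega> \<Longrightarrow> z \<in> cball x0 (r/2) \<Longrightarrow> z \<bullet> rot90 e \<notin> S \<Longrightarrow> depth z < 2 * \<delta> \<Longrightarrow> slope z \<bullet> Q z \<le> c"
    and "0 \<le> c" "0 \<le> G"
  shows "- (\<integral>z. indicator U z * (\<psi> z * cutoff \<delta> (depth z) * (fst (g1 z) + snd (g2 z))) \<partial>lborel)
    \<le> (\<integral>z. indicator U z * (cutoff \<delta> (depth z) * (g z \<bullet> Q z)) \<partial>lborel) + c * (G * measure lborel (ball x0 r))"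
proof -
  have "continuous_on U (\<lambda>z. (fst (Q z), snd (Q z)))"
    by (rule continuous_on_Pair[OF continuous_on_subset[OF Q(1)[THEN C1_on_continuous]]
        continuous_on_subset[OF Q(2)[THEN C1_on_continuous]]]) auto
  then have cQ: "continuous_on U Q" by (simp only: prod.collapse)
  have "continuous_on U (\<lambda>_. - e)" by simp
  from integrable_layer[OF this]
  have int: "integrable lborel (\<lambda>z. indicator U z * (\<psi> z * cutoff' \<delta> (depth z)))"
    by (rule back_subst[of "integrable lborel"])
       (simp add: slope_def inner_diff_left orthonormal)
  have "(\<integral>z. indicator U z * (\<psi> z * cutoff' \<delta> (depth z) * (slope z \<bullet> Q z)) \<partial>lborel)
     \<le> (\<integral>z. c * (indicator U z * (\<psi> z * cutoff' \<delta> (depth z))) \<partial>lborel)"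
  proof (rule integral_mono_AE)
    show "AE z in lborel. indicator U z * (\<psi> z * cutoff' \<delta> (depth z) * (slope z \<bullet> Q z))
      \<le> c * (indicator U z * (\<psi> z * cutoff' \<delta> (depth z)))"
      using AE_regular
    proof eventually_elim
      case (elim z)
      show ?case
      proof (cases "z \<in> U \<and> z \<in> cball x0 (r/2) \<and> depth z < 2 * \<delta>")
        case True
        then have "slope z \<bullet> Q z \<le> c" using c elim by auto
        moreover have "0 \<le> \<psi> z * cutoff' \<delta> (depth z)" using pos cutoff'_nonneg True by auto
        ultimately have "\<psi> z * cutoff' \<delta> (depth z) * (slope z \<bullet> Q z) \<le> \<psi> z * cutoff' \<delta> (depth z) * c"
          by (rule mult_left_mono)
        then show ?thesis using True by (simp add: mult.commute)
      next
        case False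
        then show ?thesis using supp_\<psi>[of z] cutoff_1(2)[of \<delta> "depth z"] by (auto simp: indicator_def)
      qed
    qed
  qed (use int integrable_layer[OF cQ] in auto)
  also have "\<dots> = c * (\<integral>z. indicator U z * (\<psi> z * cutoff' \<delta> (depth z)) \<partial>lborel)" by simp
  also have "\<dots> \<le> c * (G * measure lborel (ball x0 r))"
    using layer_mass[OF G \<open>0 \<le> G\<close>] \<open>0 \<le> c\<close> by (rule mult_left_mono)
  finally show ?thesis using integration_by_parts[OF Q] by simp
qed

end

section \<open>A partition of unity and the localized balance\<close>

lemma GDERIV_sum:
  fixes f :: "'i \<Rightarrow> 'a::real_inner \<Rightarrow> real"
  assumes "\<And>i. i \<in> I \<Longrightarrow> GDERIV (f i) z :> g i"
  shows "GDERIV (\<lambda>z. \<Sum>i\<in>I. f i z) z :> (\<Sum>i\<in>I. g i)"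
  using assms unfolding gderiv_def inner_sum_right by (rule has_derivative_sum)

text \<open>Normalized bumps. The normalizing sum is positive only near \<open>K\<close>, hence the open set \<open>W\<close>.\<close>

lemma C1_partition_of_unity:
  fixes K :: "point set" and r :: "point \<Rightarrow> real"
  assumes "compact K" and r: "\<And>x. x \<in> K \<Longrightarrow> 0 < r x"
  obtains I W G and \<psi> :: "point \<Rightarrow> point \<Rightarrow> real" and g
  where "finite I" "I \<subseteq> K" "K \<subseteq> W" "\<And>x. x \<in> I \<Longrightarrow> C1_on W (\<psi> x) (g x)"
    "\<And>x z. 0 \<le> \<psi> x z" "\<And>x z. z \<notin> cball x (r x / 2) \<Longrightarrow> \<psi> x z = 0"
    "\<And>z. z \<in> K \<Longrightarrow> (\<Sum>x\<in>I. \<psi> x z) = 1"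
    "0 \<le> G" "\<And>x z. x \<in> I \<Longrightarrow> z \<in> K \<Longrightarrow> norm (g x z) \<le> G"
proof -
  obtain I where I: "I \<subseteq> K" "finite I" "K \<subseteq> (\<Union>x\<in>I. ball x (r x / 2))"
    using compactE_image[OF \<open>compact K\<close>, of K "\<lambda>x. ball x (r x / 2)"] r
    by (metis (no_types, lifting) UN_iff centre_in_ball half_gt_zero open_ball subsetI)
  \<comment> \<open>positive exactly on the half-size disc\<close>
  define b where "b x z = (if x \<in> I then ramp ((r x / 2)\<^sup>2 - (z - x) \<bullet> (z - x)) else 0)" for x z :: point
  define gb where "gb x z = (2 * max 0 ((r x / 2)\<^sup>2 - (z - x) \<bullet> (z - x))) *\<^sub>R (- 2 *\<^sub>R (z - x))" for x z :: point
  have b_nonneg: "0 \<le> b x z" for x z by (simp add: b_def)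
  have gb: "GDERIV (b x) z :> gb x z" if "x \<in> I" for x z
  proof -
    have "GDERIV (\<lambda>z. (r x / 2)\<^sup>2 - (z - x) \<bullet> (z - x)) z :> - 2 *\<^sub>R (z - x)"
      unfolding gderiv_def
      by (auto intro!: derivative_eq_intros simp: inner_commute algebra_simps inner_diff_right inner_diff_left)
    from GDERIV_DERIV_compose[OF this DERIV_ramp] show ?thesis
      using that by (simp add: b_def[abs_def] gb_def)
  qed
  have gb_cont: "continuous_on A (gb x)" for A x unfolding gb_def by (intro continuous_intros)
  have b_cont: "continuous_on A (b x)" if "x \<in> I" for A x
    using gb[OF that] unfolding gderiv_def by (meson continuous_at_imp_continuous_on has_derivative_continuous)
  define \<Psi> where "\<Psi> z = (\<Sum>x\<in>I. b x z)" for z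
  define g\<Psi> where "g\<Psi> z = (\<Sum>x\<in>I. gb x z)" for z
  have g\<Psi>: "GDERIV \<Psi> z :> g\<Psi> z" for z
    unfolding \<Psi>_def[abs_def] g\<Psi>_def by (rule GDERIV_sum[OF gb])
  have \<Psi>_pos: "0 < \<Psi> z" if "z \<in> K" for z
  proof -
    obtain x where x: "x \<in> I" "z \<in> ball x (r x / 2)" using subsetD[OF I(3) \<open>z \<in> K\<close>] by blast
    then have "dist x z ^ 2 < (r x / 2)\<^sup>2" by (intro power_strict_mono) auto
    then have "0 < b x z" using x(1) by (simp add: b_def ramp_pos dist_norm norm_minus_commute dot_square_norm)
    then show ?thesis unfolding \<Psi>_def using x(1) I(2) b_nonneg by (intro sum_pos2) auto
  qed
  define W where "W = {z. \<Psi> z \<noteq> 0}"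
  define \<psi> where "\<psi> x z = b x z * inverse (\<Psi> z)" for x z
  define g where "g x z = b x z *\<^sub>R (- (inverse (\<Psi> z))\<^sup>2 *\<^sub>R g\<Psi> z) + inverse (\<Psi> z) *\<^sub>R gb x z" for x z
  have \<Psi>_cont: "continuous_on A \<Psi>" "continuous_on A g\<Psi>" for A
    unfolding \<Psi>_def g\<Psi>_def by (auto intro!: continuous_intros b_cont gb_cont)
  have KW: "K \<subseteq> W" using \<Psi>_pos by (force simp: W_def)
  have C1: "C1_on W (\<psi> x) (g x)" if "x \<in> I" for x
    unfolding C1_on_def
  proof (intro conjI ballI)
    show "continuous_on W (g x)" unfolding g_def
      by (intro continuous_intros \<Psi>_cont b_cont[OF that] gb_cont) (auto simp: W_def)
    show "GDERIV (\<psi> x) z :> g x z" if "z \<in> W" for z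
      unfolding \<psi>_def[abs_def] g_def
      by (rule GDERIV_mult[OF gb[OF \<open>x \<in> I\<close>] GDERIV_inverse[OF g\<Psi>]]) (use that in \<open>simp add: W_def\<close>)
  qed
  have \<psi>_nonneg: "0 \<le> \<psi> x z" for x z
    by (simp add: \<psi>_def \<Psi>_def b_nonneg sum_nonneg)
  have \<psi>_supp: "\<psi> x z = 0" if "z \<notin> cball x (r x / 2)" for x z
  proof (cases "x \<in> I")
    case True
    then have "0 < r x" using r[OF subsetD[OF I(1)]] by simp
    then have "(r x / 2)\<^sup>2 \<le> dist x z ^ 2" using that by (intro power_mono) auto
    then show ?thesis by (simp add: \<psi>_def b_def ramp_eq_0 dist_norm norm_minus_commute dot_square_norm)
  qed (simp add: \<psi>_def b_def)
  have sum1: "(\<Sum>x\<in>I. \<psi> x z) = 1" if "z \<in> K" for z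
    using \<Psi>_pos[OF that] by (simp add: \<psi>_def sum_distrib_right[symmetric] \<Psi>_def[symmetric])
  have "bounded (\<Union>x\<in>I. g x ` K)"
  proof (rule bounded_UN[OF I(2)], rule ballI)
    fix x assume "x \<in> I"
    then have "continuous_on W (g x)" using C1[of x] by (simp add: C1_on_def)
    then have "continuous_on K (g x)" using KW by (rule continuous_on_subset)
    then show "bounded (g x ` K)" using \<open>compact K\<close> compact_continuous_image compact_imp_bounded by blast
  qed
  then obtain G where "\<And>y. y \<in> (\<Union>x\<in>I. g x ` K) \<Longrightarrow> norm y \<le> G" unfolding bounded_iff by meson
  then have "norm (g x z) \<le> max 0 G" if "x \<in> I" "z \<in> K" for x z
    using that by (metis UN_I image_eqI max.coboundedI2)
  then show ?thesis
    by (intro that[of I W \<psi> g "max 0 G"] I KW C1 \<psi>_nonneg \<psi>_supp sum1) auto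
qed

context graph_chart
begin

text \<open>The cutoffs are bounded by 1 and equal 1 at any given interior point once \<open>2 \<delta>\<close> is below its
  depth, so dominated convergence applies.\<close>

lemma cutoff_limit:
  fixes c :: "point \<Rightarrow> real"
  assumes int: "integrable lborel (\<lambda>z. indicator U z * c z)"
    and \<delta>: "\<And>n. 0 < \<delta> n" "\<delta> \<longlonglongrightarrow> 0"
  shows "(\<lambda>n. \<integral>z. indicator U z * (cutoff (\<delta> n) (depth z) * c z) \<partial>lborel)
    \<longlonglongrightarrow> (\<integral>z. indicator U z * c z \<partial>lborel)"
    and "integrable lborel (\<lambda>z. indicator U z * (cutoff (\<delta> n) (depth z) * c z))"
proof -
  have cm: "(\<lambda>z. cutoff (\<delta> n) (depth z)) \<in> borel_measurable borel" for n
    by (intro borel_measurable_continuous_onI continuous_on_compose2[OF cutoff_continuous[OF \<delta>(1)] continuous_depth]) auto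
  have im: "(\<lambda>z. indicator U z * c z) \<in> borel_measurable borel"
    using borel_measurable_integrable[OF int] by simp
  have eq: "indicator U z * (cutoff (\<delta> n) (depth z) * c z) = cutoff (\<delta> n) (depth z) * (indicator U z * c z)" for n z
    by (simp add: mult.left_commute)
  have m: "(\<lambda>z. indicator U z * (cutoff (\<delta> n) (depth z) * c z)) \<in> borel_measurable borel" for n
    unfolding eq by (intro borel_measurable_times cm im)
  have le: "\<bar>indicator U z * (cutoff (\<delta> n) (depth z) * c z)\<bar> \<le> \<bar>indicator U z * c z\<bar>" for n z
    unfolding eq abs_mult[of "cutoff _ _"] using cutoff_bounds[of "\<delta> n" "depth z"]
    by (simp add: mult_left_le_one_le)
  show "integrable lborel (\<lambda>z. indicator U z * (cutoff (\<delta> n) (depth z) * c z))"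
    by (rule Bochner_Integration.integrable_bound[OF int]) (use m le in auto)
  show "(\<lambda>n. \<integral>z. indicator U z * (cutoff (\<delta> n) (depth z) * c z) \<partial>lborel)
    \<longlonglongrightarrow> (\<integral>z. indicator U z * c z \<partial>lborel)"
  proof (rule integral_dominated_convergence[where w="\<lambda>z. \<bar>indicator U z * c z\<bar>"])
    show "integrable lborel (\<lambda>z. \<bar>indicator U z * c z\<bar>)" using int by (rule integrable_abs)
    show "AE z in lborel. (\<lambda>n. indicator U z * (cutoff (\<delta> n) (depth z) * c z)) \<longlonglongrightarrow> indicator U z * c z"
    proof (rule AE_I2)
      fix z
      show "(\<lambda>n. indicator U z * (cutoff (\<delta> n) (depth z) * c z)) \<longlonglongrightarrow> indicator U z * c z"
      proof (cases "z \<in> U")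
        case True
        then have "0 < depth z" using depth_pos_iff[of z] by simp
        then have "eventually (\<lambda>n. \<delta> n < depth z / 2) sequentially"
          using order_tendstoD(2)[OF \<delta>(2), of "depth z / 2"] by simp
        then have "eventually (\<lambda>n. indicator U z * c z = indicator U z * (cutoff (\<delta> n) (depth z) * c z)) sequentially"
        proof eventually_elim
          case (elim n)
          then show ?case using cutoff_1(1)[OF \<delta>(1)[of n], of "depth z"] by simp
        qed
        then show ?thesis by (rule Lim_transform_eventually[OF tendsto_const])
      qed simp
    qed
  qed (use m im le in auto)
qed

end

lemma mean_value_bound:
  fixes f :: "real \<Rightarrow> real"
  assumes "a \<le> b" and der: "\<And>t. t \<in> {a..b} \<Longrightarrow> (f has_real_derivative f' t) (at t within {a..b})"
    and le: "\<And>t. t \<in> {a..b} \<Longrightarrow> f' t \<le> k"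
  shows "f b - f a \<le> k * (b - a)"
proof (cases "a = b")
  case False
  with \<open>a \<le> b\<close> have "a < b" by simp
  moreover have "\<And>x. a \<le> x \<Longrightarrow> x \<le> b \<Longrightarrow> (f has_derivative (\<lambda>h. f' x * h)) (at x within {a..b})"
    using der by (simp add: has_field_derivative_def)
  ultimately obtain x where "x \<in> {a<..<b}" "f b - f a = f' x * (b - a)"
    using mvt_simple[of a b f "\<lambda>x h. f' x * h"] by auto
  then show ?thesis using le[of x] \<open>a < b\<close> by (auto intro: mult_right_mono)
qed simp

text \<open>The test function has compact support in \<open>U\<close>, so the integrand extends continuously by 0 to a box,
  where the Leibniz rule holds although the derivative of \<open>\<eta>\<close> may be unbounded on \<open>U\<close>.\<close>

lemma has_real_derivative_integral_supported:
  fixes \<phi> :: "point \<Rightarrow> real" and \<eta> \<eta>t :: "real \<Rightarrow> point \<Rightarrow> real"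
  assumes U: "open U" and K: "compact K" "K \<subseteq> U"
    and \<phi>: "continuous_on U \<phi>" "\<And>z. z \<in> U - K \<Longrightarrow> \<phi> z = 0"
    and \<eta>: "\<And>t. t \<in> {a..b} \<Longrightarrow> continuous_on U (\<eta> t)"
    and der: "\<And>t z. t \<in> {a..b} \<Longrightarrow> z \<in> U \<Longrightarrow> ((\<lambda>s. \<eta> s z) has_real_derivative \<eta>t t z) (at t within {a..b})"
    and \<eta>t: "continuous_on ({a..b} \<times> U) (\<lambda>(t, z). \<eta>t t z)"
    and t: "t \<in> {a..b}"
  shows "((\<lambda>t. \<integral>z. indicator U z * (\<phi> z * \<eta> t z) \<partial>lborel) has_real_derivative
    (\<integral>z. indicator U z * (\<phi> z * \<eta>t t z) \<partial>lborel)) (at t within {a..b})"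
proof -
  obtain c where c: "K \<subseteq> cbox (- c) c" using bounded_subset_cbox_symmetric[OF compact_imp_bounded[OF K(1)]] by blast
  have to_box: "integral (cbox (- c) c) (\<lambda>z. indicator U z * (\<phi> z * f z)) = (\<integral>z. indicator U z * (\<phi> z * f z) \<partial>lborel)"
      "(\<lambda>z. indicator U z * (\<phi> z * f z)) integrable_on cbox (- c) c"
    if "continuous_on U f" for f
  proof -
    have int: "integrable lborel (\<lambda>z. indicator U z * (\<phi> z * f z))"
      using integrable_supported[OF U K, of "\<lambda>z. \<phi> z * f z" "\<lambda>_. 1" 1] \<phi> that by (auto intro: continuous_on_mult)
    have "(if z \<in> cbox (- c) c then indicator U z * (\<phi> z * f z) else 0) = indicator U z * (\<phi> z * f z)" for z
      using c \<phi>(2)[of z] by (auto simp: indicator_def)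
    then have "integral (cbox (- c) c) (\<lambda>z. indicator U z * (\<phi> z * f z)) = integral UNIV (\<lambda>z. indicator U z * (\<phi> z * f z))"
      by (subst integral_restrict_UNIV[symmetric]) simp
    then show "integral (cbox (- c) c) (\<lambda>z. indicator U z * (\<phi> z * f z)) = (\<integral>z. indicator U z * (\<phi> z * f z) \<partial>lborel)"
      using integral_lborel[OF int] by simp
    show "(\<lambda>z. indicator U z * (\<phi> z * f z)) integrable_on cbox (- c) c"
      using integrable_on_lborel[OF int] by (rule integrable_on_subcbox) simp
  qed
  have cont_t: "continuous_on U (\<eta>t t)" if "t \<in> {a..b}" for t
    using continuous_on_compose2[OF \<eta>t, of U "\<lambda>z. (t, z)"] that by (simp add: continuous_on_Pair image_subset_iff)
  have "((\<lambda>t. integral (cbox (- c) c) (\<lambda>z. indicator U z * (\<phi> z * \<eta> t z))) has_real_derivative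
      integral (cbox (- c) c) (\<lambda>z. indicator U z * (\<phi> z * \<eta>t t z))) (at t within {a..b})"
  proof (rule leibniz_rule_field_derivative[OF _ _ _ t])
    show "((\<lambda>t. indicator U z * (\<phi> z * \<eta> t z)) has_real_derivative indicator U z * (\<phi> z * \<eta>t t z)) (at t within {a..b})"
      if "t \<in> {a..b}" for t z
    proof (cases "z \<in> U")
      case True
      then show ?thesis using DERIV_cmult[OF der[OF that True], of "\<phi> z"] by simp
    qed simp
    show "(\<lambda>z. indicator U z * (\<phi> z * \<eta> t z)) integrable_on cbox (- c) c" if "t \<in> {a..b}" for t
      by (rule to_box(2)[OF \<eta>[OF that]])
    let ?f = "\<lambda>(t, z). indicator U z * (\<phi> z * \<eta>t t z)"
    have "continuous_on ({a..b} \<times> U \<union> {a..b} \<times> - K) ?f"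
    proof (rule continuous_on_Un_local_open)
      have *: "{a..b} \<times> U \<union> {a..b} \<times> - K = {a..b} \<times> UNIV" using K by auto
      show "openin (top_of_set ({a..b} \<times> U \<union> {a..b} \<times> - K)) ({a..b} \<times> U)"
        unfolding * using U by (intro openin_Times) auto
      show "openin (top_of_set ({a..b} \<times> U \<union> {a..b} \<times> - K)) ({a..b} \<times> - K)"
        unfolding * using K(1) by (intro openin_Times) (auto simp: open_Compl compact_imp_closed)
      have "continuous_on ({a..b} \<times> U) (\<lambda>p. \<phi> (snd p) * (case p of (t, z) \<Rightarrow> \<eta>t t z))"
        by (intro continuous_intros \<eta>t continuous_on_compose2[OF \<phi>(1)]) auto
      then show "continuous_on ({a..b} \<times> U) ?f"
        by (rule continuous_on_eq) auto
      show "continuous_on ({a..b} \<times> - K) ?f"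
        by (rule continuous_on_eq[of _ "\<lambda>_. 0"]) (use \<phi>(2) in \<open>auto simp: indicator_def\<close>)
    qed
    then show "continuous_on ({a..b} \<times> cbox (- c) c) ?f"
      by (rule continuous_on_subset) (use K in auto)
  qed simp
  then have "((\<lambda>t. integral (cbox (- c) c) (\<lambda>z. indicator U z * (\<phi> z * \<eta> t z))) has_real_derivative
      (\<integral>z. indicator U z * (\<phi> z * \<eta>t t z) \<partial>lborel)) (at t within {a..b})"
    using to_box(1)[OF cont_t[OF t]] by simp
  then show ?thesis
    by (rule has_field_derivative_transform_within[of _ _ _ _ 1]) (use t to_box(1)[OF \<eta>] in auto)
qed

context chart_bump
begin

text \<open>The right-hand side contains \<open>g z \<bullet> Q t z\<close>, which changes sign. It cancels only in the sum over a
  partition of unity, whose gradients add up to 0.\<close>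

lemma local_evolution:
  fixes \<eta> \<eta>t :: "real \<Rightarrow> point \<Rightarrow> real" and Q :: "real \<Rightarrow> point \<Rightarrow> point"
  assumes \<eta>: "\<And>t. t \<in> {a..b} \<Longrightarrow> continuous_on \<Omega> (\<eta> t)"
    and der: "\<And>t z. t \<in> {a..b} \<Longrightarrow> z \<in> \<Omega> \<Longrightarrow> ((\<lambda>s. \<eta> s z) has_real_derivative \<eta>t t z) (at t within {a..b})"
    and \<eta>t: "continuous_on ({a..b} \<times> \<Omega>) (\<lambda>(t, z). \<eta>t t z)"
    and Q: "\<And>t. t \<in> {a..b} \<Longrightarrow> C1_on \<Omega> (\<lambda>z. fst (Q t z)) (g1 t)"
      "\<And>t. t \<in> {a..b} \<Longrightarrow> C1_on \<Omega> (\<lambda>z. snd (Q t z)) (g2 t)"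
    and balance: "\<And>t z. t \<in> {a..b} \<Longrightarrow> z \<in> \<Omega> \<Longrightarrow> \<eta>t t z + fst (g1 t z) + snd (g2 t z) \<le> 0"
    and pos: "\<And>z. z \<in> \<Omega> \<Longrightarrow> 0 \<le> \<psi> z" and G: "\<And>z. z \<in> \<Omega> \<Longrightarrow> norm (g z) \<le> G" "0 \<le> G"
    and c: "\<And>t z. t \<in> {a..b} \<Longrightarrow> z \<in> \<Omega> \<Longrightarrow> z \<in> cball x0 (r/2) \<Longrightarrow> z \<bullet> rot90 e \<notin> S \<Longrightarrow> depth z < 2 * \<delta> \<Longrightarrow>
        slope z \<bullet> Q t z \<le> c" "0 \<le> c"
  shows "\<exists>m'. \<forall>t\<in>{a..b}.
    ((\<lambda>t. \<integral>z. indicator U z * (cutoff \<delta> (depth z) * (\<psi> z * \<eta> t z)) \<partial>lborel) has_real_derivative m' t) (at t within {a..b})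
    \<and> m' t \<le> (\<integral>z. indicator U z * (cutoff \<delta> (depth z) * (g z \<bullet> Q t z)) \<partial>lborel) + c * (G * measure lborel (ball x0 r))"
proof (intro exI ballI conjI)
  fix t assume t: "t \<in> {a..b}"
  have \<phi>: "continuous_on U (\<lambda>z. \<psi> z * cutoff \<delta> (depth z))"
    by (intro continuous_intros continuous_\<psi> continuous_cutoff)
  have "((\<lambda>t. \<integral>z. indicator U z * (\<psi> z * cutoff \<delta> (depth z) * \<eta> t z) \<partial>lborel) has_real_derivative
      (\<integral>z. indicator U z * (\<psi> z * cutoff \<delta> (depth z) * \<eta>t t z) \<partial>lborel)) (at t within {a..b})"
    by (rule has_real_derivative_integral_supported[OF open_U compact_K K_subset \<phi> off_K(1) _ der _ t])
       (auto intro: continuous_on_subset[OF \<eta>] continuous_on_subset[OF \<eta>t])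
  then show "((\<lambda>t. \<integral>z. indicator U z * (cutoff \<delta> (depth z) * (\<psi> z * \<eta> t z)) \<partial>lborel) has_real_derivative
      (\<integral>z. indicator U z * (\<psi> z * cutoff \<delta> (depth z) * \<eta>t t z) \<partial>lborel)) (at t within {a..b})"
    by (simp add: mult_ac)
  have cont_t: "continuous_on U (\<eta>t t)"
    using continuous_on_compose2[OF \<eta>t, of U "\<lambda>z. (t, z)"] t by (simp add: continuous_on_Pair image_subset_iff)
  have cont_div: "continuous_on U (\<lambda>z. fst (g1 t z) + snd (g2 t z))"
    using Q[OF t] by (auto simp: C1_on_def intro!: continuous_intros intro: continuous_on_subset)
  have "(\<integral>z. indicator U z * (\<psi> z * cutoff \<delta> (depth z) * \<eta>t t z) \<partial>lborel)
    \<le> (\<integral>z. - (indicator U z * (\<psi> z * cutoff \<delta> (depth z) * (fst (g1 t z) + snd (g2 t z)))) \<partial>lborel)"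
  proof (rule integral_mono)
    fix z
    show "indicator U z * (\<psi> z * cutoff \<delta> (depth z) * \<eta>t t z)
      \<le> - (indicator U z * (\<psi> z * cutoff \<delta> (depth z) * (fst (g1 t z) + snd (g2 t z))))"
    proof (cases "z \<in> U")
      case True
      then have "\<eta>t t z \<le> - (fst (g1 t z) + snd (g2 t z))" using balance[OF t, of z] by simp
      moreover have "0 \<le> \<psi> z * cutoff \<delta> (depth z)" using pos cutoff_bounds True by auto
      ultimately have "\<psi> z * cutoff \<delta> (depth z) * \<eta>t t z
        \<le> \<psi> z * cutoff \<delta> (depth z) * - (fst (g1 t z) + snd (g2 t z))" by (rule mult_left_mono)
      then show ?thesis using True by (simp only: indicator_simps mult_1_left mult_minus_right)
    qed simp
  qed (intro integrable_minus integrable_bulk cont_t cont_div)+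
  also have "\<dots> = - (\<integral>z. indicator U z * (\<psi> z * cutoff \<delta> (depth z) * (fst (g1 t z) + snd (g2 t z))) \<partial>lborel)"
    by (rule integral_minus)
  also have "\<dots> \<le> (\<integral>z. indicator U z * (cutoff \<delta> (depth z) * (g z \<bullet> Q t z)) \<partial>lborel) + c * (G * measure lborel (ball x0 r))"
    by (rule divergence_estimate[OF Q(1)[OF t] Q(2)[OF t] pos G(1) c(1)[OF t] c(2) G(2)])
  finally show "(\<integral>z. indicator U z * (\<psi> z * cutoff \<delta> (depth z) * \<eta>t t z) \<partial>lborel)
    \<le> (\<integral>z. indicator U z * (cutoff \<delta> (depth z) * (g z \<bullet> Q t z)) \<partial>lborel) + c * (G * measure lborel (ball x0 r))" .
qed

end

section \<open>The balance inequality on a planar domain\<close>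

lemma integrable_bounded_open:
  fixes f :: "point \<Rightarrow> real"
  assumes "open U" "bounded U" "continuous_on U f" "\<And>z. z \<in> U \<Longrightarrow> \<bar>f z\<bar> \<le> B"
  shows "integrable lborel (\<lambda>z. indicator U z * f z)"
proof -
  have "(\<lambda>z. indicator U z *\<^sub>R f z) \<in> borel_measurable borel"
    using assms by (intro borel_measurable_continuous_on_indicator) auto
  moreover have "emeasure lborel U < \<infinity>" using \<open>bounded U\<close> by (rule emeasure_bounded_finite)
  ultimately have "integrable lborel (\<lambda>z. indicator U z *\<^sub>R f z)"
    by (intro integrableI_bounded_set[where A=U and B=B]) (use assms in \<open>auto simp: indicator_def\<close>)
  then show ?thesis by simp
qed

text \<open>The constant \<open>A\<close> depends on \<open>\<Omega>\<close> alone; it plays the part of the length of the boundary. On a time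
  interval \<open>[a, b]\<close> with \<open>a > 0\<close> the field \<open>Q\<close> is bounded and uniformly continuous, so the limits are taken in the
  order \<open>\<delta> \<rightarrow> 0\<close>, then \<open>\<omega> \<rightarrow> 0\<close> for the oscillation of \<open>Q\<close>, then \<open>a \<rightarrow> 0\<close>.\<close>

lemma evolution_inequality:
  assumes dom: "planar_domain \<Omega>"
  obtains A where "0 \<le> A"
    "\<And>(T::real) C \<eta> \<eta>t Q g1 g2 t. \<lbrakk>0 \<le> C;
      continuous_on ({0..T} \<times> closure \<Omega>) (\<lambda>(t, z). \<eta> t z);
      \<And>t z. t \<in> {0<..T} \<Longrightarrow> z \<in> \<Omega> \<Longrightarrow> ((\<lambda>s. \<eta> s z) has_real_derivative \<eta>t t z) (at t within {0..T});
      continuous_on ({0<..T} \<times> \<Omega>) (\<lambda>(t, z). \<eta>t t z);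
      continuous_on ({0<..T} \<times> closure \<Omega>) (\<lambda>(t, z). Q t z);
      \<And>t. t \<in> {0<..T} \<Longrightarrow> C1_on \<Omega> (\<lambda>z. fst (Q t z)) (g1 t);
      \<And>t. t \<in> {0<..T} \<Longrightarrow> C1_on \<Omega> (\<lambda>z. snd (Q t z)) (g2 t);
      \<And>t z. t \<in> {0<..T} \<Longrightarrow> z \<in> \<Omega> \<Longrightarrow> \<eta>t t z + fst (g1 t z) + snd (g2 t z) \<le> 0;
      \<And>t x n. t \<in> {0<..T} \<Longrightarrow> outward_normal \<Omega> x n \<Longrightarrow> - C \<le> Q t x \<bullet> n;
      t \<in> {0..T}\<rbrakk>
     \<Longrightarrow> (\<integral>z. indicator \<Omega> z * \<eta> t z \<partial>lborel) \<le> (\<integral>z. indicator \<Omega> z * \<eta> 0 z \<partial>lborel) + A * C * t"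
proof -
  have op: "open \<Omega>" and bd: "bounded \<Omega>" using dom by (auto simp: planar_domain_def)
  have cpt: "compact (closure \<Omega>)" using bd by simp
  obtain e r L h h' S where chart: "\<And>x. x \<in> closure \<Omega> \<Longrightarrow> graph_chart \<Omega> x (e x) (r x) (L x) (h x) (h' x) (S x)"
    using graph_chart_exists[OF dom] by metis
  have r: "0 < r x" if "x \<in> closure \<Omega>" for x by (rule graph_chart.r_pos[OF chart[OF that]])
  show ?thesis
  proof (rule C1_partition_of_unity[OF cpt, of r, OF r], assumption)
    fix I W G and \<psi> :: "point \<Rightarrow> point \<Rightarrow> real" and g
    assume I: "finite I" "I \<subseteq> closure \<Omega>" and W: "closure \<Omega> \<subseteq> W"
      and C1: "\<And>x. x \<in> I \<Longrightarrow> C1_on W (\<psi> x) (g x)"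
      and \<psi>: "\<And>x z. 0 \<le> \<psi> x z" "\<And>x z. z \<notin> cball x (r x / 2) \<Longrightarrow> \<psi> x z = 0"
      and sum1: "\<And>z. z \<in> closure \<Omega> \<Longrightarrow> (\<Sum>x\<in>I. \<psi> x z) = 1"
      and G: "0 \<le> G" "\<And>x z. x \<in> I \<Longrightarrow> z \<in> closure \<Omega> \<Longrightarrow> norm (g x z) \<le> G"
    have W\<Omega>: "\<Omega> \<subseteq> W" using W closure_subset by blast
    have C1': "C1_on \<Omega> (\<psi> x) (g x)" if "x \<in> I" for x
      using C1[OF that] continuous_on_subset[OF _ W\<Omega>, of "g x"] W\<Omega> unfolding C1_on_def by blast
    have chartI: "graph_chart \<Omega> x (e x) (r x) (L x) (h x) (h' x) (S x)" if "x \<in> I" for x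
      by (rule chart[OF subsetD[OF I(2) that]])
    have L: "0 \<le> L x" if "x \<in> I" for x by (rule graph_chart.L_nonneg[OF chartI[OF that]])
    have \<psi>1: "\<psi> x z \<le> 1" if "x \<in> I" "z \<in> \<Omega>" for x z
    proof -
      have "\<psi> x z \<le> (\<Sum>x\<in>I. \<psi> x z)" using that I \<psi>(1) by (intro member_le_sum) auto
      moreover have "z \<in> closure \<Omega>" by (rule subsetD[OF closure_subset that(2)])
      ultimately show ?thesis using sum1[of z] by simp
    qed
    have bump: "chart_bump \<Omega> x (e x) (r x) (L x) (h x) (h' x) (S x) (\<psi> x) (g x) \<delta>" if "x \<in> I" "0 < \<delta>" for x \<delta>
      using chartI[OF that(1)] C1'[OF that(1)] that(2) \<psi>(2)
      by (intro chart_bump.intro chart_bump_axioms.intro) auto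
    have grad_sum: "(\<Sum>x\<in>I. g x z) = 0" if "z \<in> \<Omega>" for z
    proof -
      have "GDERIV (\<lambda>z. \<Sum>x\<in>I. \<psi> x z) z :> (\<Sum>x\<in>I. g x z)"
        using C1' that by (intro GDERIV_sum) (auto simp: C1_on_def)
      moreover have "GDERIV (\<lambda>z. \<Sum>x\<in>I. \<psi> x z) z :> 0"
        by (rule GDERIV_transform_open[OF GDERIV_const op that, of 1]) (use sum1 closure_subset in auto)
      ultimately have "(\<lambda>v. v \<bullet> (\<Sum>x\<in>I. g x z)) = (\<lambda>v. v \<bullet> 0)"
        unfolding gderiv_def by (rule has_derivative_unique)
      then have "(\<Sum>x\<in>I. g x z) \<bullet> (\<Sum>x\<in>I. g x z) = 0" by (metis inner_zero_right)
      then show ?thesis by simp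
    qed
    define A where "A = (\<Sum>x\<in>I. (1 + L x) * (G * measure lborel (ball x (r x))))"
    have A: "0 \<le> A" unfolding A_def using L G(1) by (intro sum_nonneg mult_nonneg_nonneg) auto
    define V where "V x = \<Omega> \<inter> ball x (r x)" for x
    define dp where "dp x = graph_chart.depth (e x) (h x)" for x
    have V\<Omega>: "z \<in> V x \<Longrightarrow> z \<in> \<Omega>" for x z by (simp add: V_def)
    have cl: "z \<in> \<Omega> \<Longrightarrow> z \<in> closure \<Omega>" for z by (rule subsetD[OF closure_subset])
    have V: "open (V x)" "bounded (V x)" "V x \<subseteq> \<Omega>" for x using op by (auto simp: V_def)
    show ?thesis
    proof (rule that[OF A])
      fix T C :: real and \<eta> \<eta>t :: "real \<Rightarrow> point \<Rightarrow> real" and Q g1 g2 t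
      assume C: "0 \<le> C" and \<eta>: "continuous_on ({0..T} \<times> closure \<Omega>) (\<lambda>(t, z). \<eta> t z)"
        and der: "\<And>t z. t \<in> {0<..T} \<Longrightarrow> z \<in> \<Omega> \<Longrightarrow> ((\<lambda>s. \<eta> s z) has_real_derivative \<eta>t t z) (at t within {0..T})"
        and \<eta>t: "continuous_on ({0<..T} \<times> \<Omega>) (\<lambda>(t, z). \<eta>t t z)"
        and Q: "continuous_on ({0<..T} \<times> closure \<Omega>) (\<lambda>(t, z). Q t z)"
        and g1: "\<And>t. t \<in> {0<..T} \<Longrightarrow> C1_on \<Omega> (\<lambda>z. fst (Q t z)) (g1 t)"
        and g2: "\<And>t. t \<in> {0<..T} \<Longrightarrow> C1_on \<Omega> (\<lambda>z. snd (Q t z)) (g2 t)"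
        and balance: "\<And>t z. t \<in> {0<..T} \<Longrightarrow> z \<in> \<Omega> \<Longrightarrow> \<eta>t t z + fst (g1 t z) + snd (g2 t z) \<le> 0"
        and normal: "\<And>t x n. t \<in> {0<..T} \<Longrightarrow> outward_normal \<Omega> x n \<Longrightarrow> - C \<le> Q t x \<bullet> n"
        and t: "t \<in> {0..T}"
      define H where "H t = (\<integral>z. indicator \<Omega> z * \<eta> t z \<partial>lborel)" for t
      have "bounded ((\<lambda>(t, z). \<eta> t z) ` ({0..T} \<times> closure \<Omega>))"
        by (intro compact_imp_bounded compact_continuous_image \<eta> compact_Times cpt) auto
      then obtain B\<eta> where "\<And>y. y \<in> (\<lambda>(t, z). \<eta> t z) ` ({0..T} \<times> closure \<Omega>) \<Longrightarrow> norm y \<le> B\<eta>"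
        unfolding bounded_iff by blast
      then have B\<eta>: "\<bar>\<eta> t z\<bar> \<le> B\<eta>" if "t \<in> {0..T}" "z \<in> \<Omega>" for t z
        using image_eqI[of "\<eta> t z" "\<lambda>(t, z). \<eta> t z" "(t, z)"] that subsetD[OF closure_subset that(2)] by simp
      have \<eta>c: "continuous_on (closure \<Omega>) (\<eta> t)" if "t \<in> {0..T}" for t
        using continuous_on_compose2[OF \<eta>, of "closure \<Omega>" "\<lambda>z. (t, z)"] that by (simp add: continuous_on_Pair image_subset_iff)
      have \<eta>c': "continuous_on \<Omega> (\<eta> t)" if "t \<in> {0..T}" for t
        by (rule continuous_on_subset[OF \<eta>c[OF that] closure_subset])
      have int\<eta>: "integrable lborel (\<lambda>z. indicator \<Omega> z * \<eta> t z)" if "t \<in> {0..T}" for t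
        by (rule integrable_bounded_open[OF op bd \<eta>c'[OF that] B\<eta>[OF that]])

      have step: "H b - H a \<le> (C + \<omega>) * A * (b - a)" if ab: "0 < a" "a \<le> b" "b \<le> T" and \<omega>: "0 < \<omega>" for a b \<omega>
      proof -
        have sub: "{a..b} \<subseteq> {0<..T}" "{a..b} \<subseteq> {0..T}" using ab by auto
        have Qab: "continuous_on ({a..b} \<times> closure \<Omega>) (\<lambda>(t, z). Q t z)"
          by (rule continuous_on_subset[OF Q]) (use sub in auto)
        have cab: "compact ({a..b} \<times> closure \<Omega>)" by (intro compact_Times cpt) auto
        have "uniformly_continuous_on ({a..b} \<times> closure \<Omega>) (\<lambda>(t, z). Q t z)"
          by (rule compact_uniformly_continuous[OF Qab cab])
        from this[unfolded uniformly_continuous_on_def, rule_format, OF \<omega>]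
        obtain d where d: "0 < d" "\<forall>p\<in>{a..b} \<times> closure \<Omega>. \<forall>q\<in>{a..b} \<times> closure \<Omega>. dist q p < d \<longrightarrow>
            dist (case q of (t, z) \<Rightarrow> Q t z) (case p of (t, z) \<Rightarrow> Q t z) < \<omega>"
          by (elim exE conjE)
        have osc: "dist (Q t z) (Q t y) \<le> \<omega>" if "t \<in> {a..b}" "z \<in> closure \<Omega>" "y \<in> closure \<Omega>" "dist y z < d" for t y z
          using d(2)[THEN bspec, THEN bspec, of "(t, y)" "(t, z)"] that
          by (simp add: dist_Pair_Pair dist_commute less_imp_le)
        have "bounded ((\<lambda>(t, z). Q t z) ` ({a..b} \<times> closure \<Omega>))"
          by (intro compact_imp_bounded compact_continuous_image Qab cab)
        then obtain B where "\<And>y. y \<in> (\<lambda>(t, z). Q t z) ` ({a..b} \<times> closure \<Omega>) \<Longrightarrow> norm y \<le> B"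
          unfolding bounded_iff by blast
        then have B: "norm (Q t z) \<le> B" if "t \<in> {a..b}" "z \<in> \<Omega>" for t z
          using image_eqI[of "Q t z" "\<lambda>(t, z). Q t z" "(t, z)"] that subsetD[OF closure_subset that(2)] by simp
        have Qc: "continuous_on \<Omega> (Q t)" if "t \<in> {a..b}" for t
          using continuous_on_compose2[OF Qab, of \<Omega> "\<lambda>z. (t, z)"] that cl
          by (simp add: continuous_on_Pair image_subset_iff)
        \<comment> \<open>so small that points of depth below \<open>2 \<delta>\<close> can be moved to the boundary within the chart, changing \<open>Q\<close> by at most \<open>\<omega>\<close>\<close>
        define \<rho> where "\<rho> = min d (Min (insert 1 (r ` I))) / 4"
        have "0 < Min (insert 1 (r ` I))" using I r by (subst Min_gr_iff) auto
        then have \<rho>: "0 < \<rho>" using d by (simp add: \<rho>_def)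
        have r_Min: "Min (insert 1 (r ` I)) \<le> r x" if "x \<in> I" for x using I(1) that by (intro Min_le) auto
        then have \<rho>r: "4 * \<rho> \<le> r x" if "x \<in> I" for x 
          using r_Min[OF that] by (simp add: \<rho>_def min.coboundedI2)
        define \<delta> where "\<delta> n = \<rho> / real (Suc n)" for n
        have \<delta>: "0 < \<delta> n" "\<delta> n \<le> \<rho>" for n
          using \<rho> by (auto simp: \<delta>_def divide_le_eq mult_left_le)
        have \<delta>_lim: "\<delta> \<longlonglongrightarrow> 0" unfolding \<delta>_def
          using tendsto_mult_left[OF LIMSEQ_inverse_real_of_nat, of \<rho>] by (simp add: divide_inverse)

        \<comment> \<open>measures where the cutoff differs from 1; it tends to 0 with the layer\<close>
        define er where "er n x = (\<integral>z. indicator (V x) z * (1 - cutoff (\<delta> n) (dp x z)) \<partial>lborel)" for n x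
        define F where "F n x t = (\<integral>z. indicator (V x) z * (cutoff (\<delta> n) (dp x z) * (\<psi> x z * \<eta> t z)) \<partial>lborel)" for n x t
        note lim = graph_chart.cutoff_limit[OF chartI, folded V_def dp_def, OF _ _ \<delta>(1) \<delta>_lim]
        have int1: "integrable lborel (\<lambda>z. indicator (V x) z * (1::real))" for x
          by (rule integrable_bounded_open[OF V(1,2), where B=1]) auto
        have int2: "integrable lborel (\<lambda>z. indicator (V x) z * (cutoff (\<delta> n) (dp x z) * 1))" if "x \<in> I" for x n
          by (rule lim(2)[OF that int1])
        have er_eq: "er n x = (\<integral>z. indicator (V x) z * 1 \<partial>lborel) - (\<integral>z. indicator (V x) z * (cutoff (\<delta> n) (dp x z) * 1) \<partial>lborel)" 
          and e_int: "integrable lborel (\<lambda>z. indicator (V x) z * (1 - cutoff (\<delta> n) (dp x z)))"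
          if "x \<in> I" for n x
          using Bochner_Integration.integral_diff[OF int1 int2[OF that]] Bochner_Integration.integrable_diff[OF int1 int2[OF that]]
          by (simp_all add: er_def right_diff_distrib)
        have e_lim: "(\<lambda>n. er n x) \<longlonglongrightarrow> 0" if "x \<in> I" for x
          using tendsto_diff[OF tendsto_const lim(1)[OF that int1], of "\<integral>z. indicator (V x) z * 1 \<partial>lborel"]
          by (simp add: er_eq[OF that])
        have int\<psi>\<eta>: "integrable lborel (\<lambda>z. indicator (V x) z * (\<psi> x z * \<eta> t z))" if "x \<in> I" "t \<in> {a..b}" for x t
        proof (rule integrable_bounded_open[OF V(1,2)])
          show "continuous_on (V x) (\<lambda>z. \<psi> x z * \<eta> t z)"
            by (intro continuous_intros continuous_on_subset[OF C1_on_continuous[OF C1'[OF that(1)]] V(3)]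
                continuous_on_subset[OF \<eta>c'[OF subsetD[OF sub(2) that(2)]] V(3)])
          show "\<bar>\<psi> x z * \<eta> t z\<bar> \<le> 1 * B\<eta>" if "z \<in> V x" for z
            unfolding abs_mult using \<psi>(1)[of x z] \<psi>1[OF \<open>x \<in> I\<close> V\<Omega>[OF that]]
              B\<eta>[OF subsetD[OF sub(2) \<open>t \<in> {a..b}\<close>] V\<Omega>[OF that]]
            by (intro mult_mono) auto
        qed
        have F_lim: "(\<lambda>n. \<Sum>x\<in>I. F n x t) \<longlonglongrightarrow> H t" if "t \<in> {a..b}" for t
        proof -
          have "(\<lambda>n. \<Sum>x\<in>I. F n x t) \<longlonglongrightarrow> (\<Sum>x\<in>I. \<integral>z. indicator (V x) z * (\<psi> x z * \<eta> t z) \<partial>lborel)"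
            unfolding F_def by (intro tendsto_sum lim(1) int\<psi>\<eta> that)
          also have "(\<Sum>x\<in>I. \<integral>z. indicator (V x) z * (\<psi> x z * \<eta> t z) \<partial>lborel)
            = (\<integral>z. (\<Sum>x\<in>I. indicator (V x) z * (\<psi> x z * \<eta> t z)) \<partial>lborel)"
            by (rule Bochner_Integration.integral_sum[symmetric]) (rule int\<psi>\<eta>[OF _ that])
          also have "\<dots> = H t" unfolding H_def
          proof (rule Bochner_Integration.integral_cong[OF refl])
            fix z
            show "(\<Sum>x\<in>I. indicator (V x) z * (\<psi> x z * \<eta> t z)) = indicator \<Omega> z * \<eta> t z"
            proof (cases "z \<in> \<Omega>")
              case True
              have "indicator (V x) z * (\<psi> x z * \<eta> t z) = \<psi> x z * \<eta> t z" if "x \<in> I" for x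

              proof (cases "z \<in> ball x (r x)")
                case True
                then show ?thesis using \<open>z \<in> \<Omega>\<close> by (simp add: V_def)
              next
                case False
                then have "z \<notin> cball x (r x / 2)" using r[OF subsetD[OF I(2) that]] by simp
                then show ?thesis using \<psi>(2)[of z x] by simp
              qed
              then have "(\<Sum>x\<in>I. indicator (V x) z * (\<psi> x z * \<eta> t z)) = (\<Sum>x\<in>I. \<psi> x z) * \<eta> t z"
                unfolding sum_distrib_right by (intro sum.cong refl)
              then show ?thesis using sum1[OF cl[OF True]] True by simp
            next
              case False
              then have "indicator (V x) z = (0::real)" for x using V\<Omega>[of z x] by (auto simp: indicator_def)
              then show ?thesis using False by simp
            qed
          qed
          finally show ?thesis .
        qed
        have grad_bound: "(\<Sum>x\<in>I. \<integral>z. indicator (V x) z * (cutoff (\<delta> n) (dp x z) * (g x z \<bullet> Q t z)) \<partial>lborel)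
          \<le> (\<Sum>x\<in>I. G * B * er n x)" if t: "t \<in> {a..b}" for n t
        proof -
          have GB: "\<bar>g x z \<bullet> Q t z\<bar> \<le> G * B" if "x \<in> I" "z \<in> \<Omega>" for x z
          proof -
            have "\<bar>g x z \<bullet> Q t z\<bar> \<le> norm (g x z) * norm (Q t z)" by (rule Cauchy_Schwarz_ineq2)
            also have "\<dots> \<le> G * B" 
              using that(1) G(1) G(2)[OF that(1) cl[OF that(2)]] B[OF t that(2)] by (intro mult_mono) auto
            finally show ?thesis .
          qed
          have cg: "continuous_on \<Omega> (\<lambda>z. g x z \<bullet> Q t z)" if "x \<in> I" for x
            using C1'[OF that] by (intro continuous_intros Qc t) (auto simp: C1_on_def)
          have intg: "integrable lborel (\<lambda>z. indicator \<Omega> z * (g x z \<bullet> Q t z))" if "x \<in> I" for x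
            by (rule integrable_bounded_open[OF op bd cg[OF that] GB[OF that]])
          have intV: "integrable lborel (\<lambda>z. indicator (V x) z * (g x z \<bullet> Q t z))" if "x \<in> I" for x
            by (rule integrable_bounded_open[OF V(1,2) continuous_on_subset[OF cg[OF that] V(3)] GB[OF that V\<Omega>]])
          have "(\<integral>z. indicator (V x) z * (cutoff (\<delta> n) (dp x z) * (g x z \<bullet> Q t z)) \<partial>lborel)
            \<le> (\<integral>z. indicator \<Omega> z * (g x z \<bullet> Q t z) \<partial>lborel) + G * B * er n x" if "x \<in> I" for x
          proof -
            have "(\<integral>z. indicator (V x) z * (cutoff (\<delta> n) (dp x z) * (g x z \<bullet> Q t z)) \<partial>lborel)
              \<le> (\<integral>z. indicator \<Omega> z * (g x z \<bullet> Q t z) + G * B * (indicator (V x) z * (1 - cutoff (\<delta> n) (dp x z))) \<partial>lborel)"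
            proof (rule integral_mono[OF lim(2)[OF that intV[OF that]]])
              show "integrable lborel (\<lambda>z. indicator \<Omega> z * (g x z \<bullet> Q t z)
                + G * B * (indicator (V x) z * (1 - cutoff (\<delta> n) (dp x z))))"
                by (intro Bochner_Integration.integrable_add intg[OF that] integrable_mult_right e_int[OF that])
              fix z
              show "indicator (V x) z * (cutoff (\<delta> n) (dp x z) * (g x z \<bullet> Q t z))
                \<le> indicator \<Omega> z * (g x z \<bullet> Q t z) + G * B * (indicator (V x) z * (1 - cutoff (\<delta> n) (dp x z)))"
              proof (cases "z \<in> V x")
                case True
                then have "z \<in> \<Omega>" by (rule V\<Omega>)
                have "- (g x z \<bullet> Q t z) * (1 - cutoff (\<delta> n) (dp x z)) \<le> G * B * (1 - cutoff (\<delta> n) (dp x z))"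
                  using GB[OF that \<open>z \<in> \<Omega>\<close>] cutoff_bounds(2)[of "\<delta> n" "dp x z"] by (intro mult_right_mono) auto
                then show ?thesis using True \<open>z \<in> \<Omega>\<close> by (simp add: algebra_simps)
              next
                case False
                have "z \<in> \<Omega> \<Longrightarrow> g x z = 0"

                proof (rule chart_bump.grad_supp[OF bump[OF that \<open>0 < \<rho>\<close>]])
                  assume "z \<in> \<Omega>"
                  with False have "z \<notin> ball x (r x)" by (simp add: V_def)
                  then show "z \<in> \<Omega> - cball x (r x / 2)" using r[OF subsetD[OF I(2) that]] \<open>z \<in> \<Omega>\<close> by simp
                qed
                then show ?thesis using False by (auto simp: indicator_def)
              qed
            qed
            also have "\<dots> = (\<integral>z. indicator \<Omega> z * (g x z \<bullet> Q t z) \<partial>lborel) + G * B * er n x"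
              unfolding er_def
              by (subst Bochner_Integration.integral_add[OF intg[OF that] integrable_mult_right[OF e_int[OF that]]]) simp
            finally show ?thesis .
          qed
          then have "(\<Sum>x\<in>I. \<integral>z. indicator (V x) z * (cutoff (\<delta> n) (dp x z) * (g x z \<bullet> Q t z)) \<partial>lborel)
            \<le> (\<Sum>x\<in>I. (\<integral>z. indicator \<Omega> z * (g x z \<bullet> Q t z) \<partial>lborel) + G * B * er n x)" by (rule sum_mono)
          also have "\<dots> = (\<integral>z. (\<Sum>x\<in>I. indicator \<Omega> z * (g x z \<bullet> Q t z)) \<partial>lborel) + (\<Sum>x\<in>I. G * B * er n x)"
            by (simp only: sum.distrib Bochner_Integration.integral_sum[OF intg])
          also have "(\<lambda>z. \<Sum>x\<in>I. indicator \<Omega> z * (g x z \<bullet> Q t z)) = (\<lambda>z. 0)"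
            using grad_sum by (auto simp: fun_eq_iff indicator_def inner_sum_left[symmetric])
          finally show ?thesis by simp
        qed
        have ex: "\<exists>m'. \<forall>t\<in>{a..b}. ((\<lambda>t. F n x t) has_real_derivative m' t) (at t within {a..b}) \<and>
           m' t \<le> (\<integral>z. indicator (V x) z * (cutoff (\<delta> n) (dp x z) * (g x z \<bullet> Q t z)) \<partial>lborel)
             + (C + \<omega>) * (1 + L x) * (G * measure lborel (ball x (r x)))" if "x \<in> I" for n x
          unfolding F_def V_def dp_def
        proof (rule chart_bump.local_evolution[OF bump[OF that \<delta>(1)], where \<eta>t=\<eta>t and ?g1.0=g1 and ?g2.0=g2])
          show "continuous_on ({a..b} \<times> \<Omega>) (\<lambda>(t, z). \<eta>t t z)"
            by (rule continuous_on_subset[OF \<eta>t]) (use sub in auto)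
          show "((\<lambda>s. \<eta> s z) has_real_derivative \<eta>t t z) (at t within {a..b})" if "t \<in> {a..b}" "z \<in> \<Omega>" for t z
            by (rule DERIV_subset[OF der]) (use that sub in auto)
          show "norm (g x z) \<le> G" if "z \<in> \<Omega>" for z by (rule G(2)[OF \<open>x \<in> I\<close> cl[OF that]])
          show "0 \<le> (C + \<omega>) * (1 + L x)" using C \<omega> L[OF that] by simp
          show "graph_chart.slope (e x) (h' x) z \<bullet> Q t z \<le> (C + \<omega>) * (1 + L x)"
            if t: "t \<in> {a..b}" and z: "z \<in> \<Omega>" "z \<in> cball x (r x / 2)" "z \<bullet> rot90 (e x) \<notin> S x"
              and depth: "graph_chart.depth (e x) (h x) z < 2 * \<delta> n" for t z
          proof (rule graph_chart.slope_flux_bound[OF chartI[OF \<open>x \<in> I\<close>] z _ _ C])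
            have "2 * \<delta> n \<le> 2 * \<rho>" using \<delta>(2)[of n] by simp
            moreover have "2 * \<rho> \<le> r x / 2" using \<rho>r[OF \<open>x \<in> I\<close>] by simp
            ultimately show "graph_chart.depth (e x) (h x) z < r x / 2" using depth by linarith
            have "2 * \<rho> < d" using d(1) \<rho> unfolding \<rho>_def by (auto simp: min_def split: if_splits)
            then have "graph_chart.depth (e x) (h x) z < d" using depth \<open>2 * \<delta> n \<le> 2 * \<rho>\<close> by linarith
            then show "dist (Q t z) (Q t y) \<le> \<omega>"
              if "y \<in> closure \<Omega>" "dist y z \<le> graph_chart.depth (e x) (h x) z" for y
              by (rule osc[OF t cl[OF z(1)] that(1) le_less_trans[OF that(2)]])
            show "- C \<le> Q t x' \<bullet> n" if "outward_normal \<Omega> x' n" for x' n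
              by (rule normal[OF subsetD[OF sub(1) t] that])
          qed
          show "continuous_on \<Omega> (\<eta> t)" if "t \<in> {a..b}" for t by (rule \<eta>c'[OF subsetD[OF sub(2) that]])
          show "C1_on \<Omega> (\<lambda>z. fst (Q t z)) (g1 t)" if "t \<in> {a..b}" for t by (rule g1[OF subsetD[OF sub(1) that]])
          show "C1_on \<Omega> (\<lambda>z. snd (Q t z)) (g2 t)" if "t \<in> {a..b}" for t by (rule g2[OF subsetD[OF sub(1) that]])
          show "\<eta>t t z + fst (g1 t z) + snd (g2 t z) \<le> 0" if "t \<in> {a..b}" "z \<in> \<Omega>" for t z
            by (rule balance[OF subsetD[OF sub(1) that(1)] that(2)])
        qed (use \<psi>(1) G(1) in auto)
        have "\<forall>n. \<forall>x\<in>I. \<exists>m'. \<forall>t\<in>{a..b}. ((\<lambda>t. F n x t) has_real_derivative m' t) (at t within {a..b}) \<and>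
           m' t \<le> (\<integral>z. indicator (V x) z * (cutoff (\<delta> n) (dp x z) * (g x z \<bullet> Q t z)) \<partial>lborel)
             + (C + \<omega>) * (1 + L x) * (G * measure lborel (ball x (r x)))"
          by (intro allI ballI ex)
        from this[unfolded bchoice_iff choice_iff] obtain m' where
          m'_ex: "\<forall>n. \<forall>x\<in>I. \<forall>t\<in>{a..b}. ((\<lambda>t. F n x t) has_real_derivative m' n x t) (at t within {a..b}) \<and>
           m' n x t \<le> (\<integral>z. indicator (V x) z * (cutoff (\<delta> n) (dp x z) * (g x z \<bullet> Q t z)) \<partial>lborel)
             + (C + \<omega>) * (1 + L x) * (G * measure lborel (ball x (r x)))"
          by (elim exE)
        note m' = m'_ex[rule_format, THEN conjunct1] m'_ex[rule_format, THEN conjunct2]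
        have F_bound: "(\<Sum>x\<in>I. F n x b) - (\<Sum>x\<in>I. F n x a) \<le> ((\<Sum>x\<in>I. G * B * er n x) + (C + \<omega>) * A) * (b - a)" for n
        proof (rule mean_value_bound[OF ab(2)])
          fix t assume t: "t \<in> {a..b}"
          show "((\<lambda>t. \<Sum>x\<in>I. F n x t) has_real_derivative (\<Sum>x\<in>I. m' n x t)) (at t within {a..b})"
            by (intro DERIV_sum m'(1) t)
          have "(\<Sum>x\<in>I. m' n x t) \<le> (\<Sum>x\<in>I. (\<integral>z. indicator (V x) z * (cutoff (\<delta> n) (dp x z) * (g x z \<bullet> Q t z)) \<partial>lborel)
             + (C + \<omega>) * ((1 + L x) * (G * measure lborel (ball x (r x)))))"
            using m'(2)[OF _ t] by (intro sum_mono) (simp add: mult.assoc)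
          also have "\<dots> \<le> (\<Sum>x\<in>I. G * B * er n x) + (C + \<omega>) * A"
            using grad_bound[OF t, of n] unfolding A_def sum.distrib sum_distrib_left[symmetric] by simp
          finally show "(\<Sum>x\<in>I. m' n x t) \<le> (\<Sum>x\<in>I. G * B * er n x) + (C + \<omega>) * A" .
        qed
        have "(\<lambda>n. ((\<Sum>x\<in>I. G * B * er n x) + (C + \<omega>) * A) * (b - a))
          \<longlonglongrightarrow> ((\<Sum>x\<in>I. G * B * 0) + (C + \<omega>) * A) * (b - a)"
          by (intro tendsto_intros e_lim)
        moreover have "(\<lambda>n. (\<Sum>x\<in>I. F n x b) - (\<Sum>x\<in>I. F n x a)) \<longlonglongrightarrow> H b - H a"
          using ab by (intro tendsto_diff F_lim) auto
        ultimately have "H b - H a \<le> ((\<Sum>x\<in>I. G * B * 0) + (C + \<omega>) * A) * (b - a)"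
          using F_bound by (intro LIMSEQ_le) auto
        then show ?thesis by simp
      qed
      have step0: "H b - H a \<le> C * A * (b - a)" if ab: "0 < a" "a \<le> b" "b \<le> T" for a b
      proof (rule tendsto_lowerbound)
        show "((\<lambda>\<omega>. (C + \<omega>) * A * (b - a)) \<longlongrightarrow> C * A * (b - a)) (at_right 0)"
          by (auto intro!: tendsto_eq_intros)
        show "\<forall>\<^sub>F \<omega> in at_right 0. H b - H a \<le> (C + \<omega>) * A * (b - a)"
          using step[OF ab] by (auto simp: eventually_at_filter)
      qed simp
      have "H t \<le> H 0 + A * C * t"
      proof (cases "t = 0")
        case False
        define a where "a n = t / real (Suc n)" for n
        have a: "0 < a n" "a n \<le> t" for n using False t by (auto simp: a_def divide_le_eq mult_left_le)
        have a_lim: "a \<longlonglongrightarrow> 0" unfolding a_def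
          using tendsto_mult_left[OF LIMSEQ_inverse_real_of_nat, of t] by (simp add: divide_inverse)
        have aT: "a n \<in> {0..T}" for n using a[of n] t by auto
        have "(\<lambda>n. H (a n)) \<longlonglongrightarrow> H 0" unfolding H_def
        proof (rule integral_dominated_convergence[where w="\<lambda>z. indicator \<Omega> z * B\<eta>"])
          show "(\<lambda>z. indicator \<Omega> z * \<eta> 0 z) \<in> borel_measurable lborel"
            using int\<eta>[of 0] t by (intro borel_measurable_integrable) auto
          show "(\<lambda>z. indicator \<Omega> z * \<eta> (a n) z) \<in> borel_measurable lborel" for n
            using int\<eta>[OF aT] by (rule borel_measurable_integrable)
          show "integrable lborel (\<lambda>z. indicator \<Omega> z * B\<eta>)"
            by (rule integrable_bounded_open[OF op bd, where B="\<bar>B\<eta>\<bar>"]) auto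
          show "AE z in lborel. (\<lambda>n. indicator \<Omega> z * \<eta> (a n) z) \<longlonglongrightarrow> indicator \<Omega> z * \<eta> 0 z"
          proof (rule AE_I2)
            fix z
            show "(\<lambda>n. indicator \<Omega> z * \<eta> (a n) z) \<longlonglongrightarrow> indicator \<Omega> z * \<eta> 0 z"
            proof (cases "z \<in> \<Omega>")
              case True
              then have "continuous_on {0..T} (\<lambda>s. \<eta> s z)"
                using continuous_on_compose2[OF \<eta>, of "{0..T}" "\<lambda>s. (s, z)"] cl
                by (simp add: continuous_on_Pair image_subset_iff)
              then have "(\<lambda>n. \<eta> (a n) z) \<longlonglongrightarrow> \<eta> 0 z"
                by (rule continuous_on_tendsto_compose[OF _ a_lim]) (use t aT in auto)
              then show ?thesis using True by simp
            qed simp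
          qed
          show "AE z in lborel. norm (indicator \<Omega> z * \<eta> (a n) z) \<le> indicator \<Omega> z * B\<eta>" for n
            using B\<eta>[OF aT] by (auto simp: indicator_def)
        qed
        then have "(\<lambda>n. H t - H (a n)) \<longlonglongrightarrow> H t - H 0" by (intro tendsto_intros)
        moreover have "H t - H (a n) \<le> C * A * t" for n
        proof -
          have "H t - H (a n) \<le> C * A * (t - a n)" using step0[of "a n" t] a t by auto
          also have "\<dots> \<le> C * A * t" using a C A by (intro mult_left_mono) (auto simp: less_imp_le)
          finally show ?thesis .
        qed
        ultimately have "H t - H 0 \<le> C * A * t" by (intro LIMSEQ_le_const2) auto
        then show ?thesis by (simp add: mult.commute)
      qed simp
      then show "(\<integral>z. indicator \<Omega> z * \<eta> t z \<partial>lborel) \<le> (\<integral>z. indicator \<Omega> z * \<eta> 0 z \<partial>lborel) + A * C * t"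
        by (simp add: H_def)
    qed
  qed
qed

section \<open>Scalar inequalities for the boundary regimes\<close>

lemma ln_add_inverse_ge:
  fixes T l :: real
  assumes "0 < T" "0 < l" shows "1 + ln l \<le> ln T + l / T"
  using ln_le_minus_one[of "l / T"] assms by (simp add: ln_div)

lemma mult_ln_ge:
  fixes \<rho> :: real
  assumes "0 < \<rho>" shows "- 1 \<le> \<rho> * ln \<rho>"
proof -
  have "1 - 1 / \<rho> \<le> ln \<rho>" using ln_le_minus_one[of "1 / \<rho>"] assms by (simp add: ln_div)
  then have "\<rho> * (1 - 1 / \<rho>) \<le> \<rho> * ln \<rho>" using assms by (intro mult_left_mono) auto
  then show ?thesis using assms by (simp add: right_diff_distrib)
qed

text \<open>Only \<open>\<rho> a\<close> and \<open>\<rho> a\<^sup>3\<close>, the outflow of mass and of kinetic energy, are controlled, while the left factor \<open>a\<close>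
  may be large when \<open>\<rho>\<close> is small. If \<open>\<rho> a\<^sup>2 \<le> 1\<close>, then \<open>a\<close> is at most \<open>1 / sqrt \<rho>\<close> and
  \<open>sqrt \<rho> * ln \<rho>\<close> is bounded below; otherwise \<open>- ln \<rho> \<le> 2 ln a\<close> is dominated by \<open>1 + a\<^sup>2\<close>.\<close>

lemma outflow_mult_ln_ge:
  fixes \<rho> a :: real
  assumes "0 < \<rho>" "0 < a" shows "- (2 + \<rho> * a + \<rho> * a ^ 3) \<le> a * (\<rho> * ln \<rho>)"
proof (cases "\<rho> * a\<^sup>2 \<le> 1")
  case True
  define s where "s = sqrt \<rho>"
  have s: "0 < s" "\<rho> = s\<^sup>2" using assms by (auto simp: s_def)
  have "(s * a)\<^sup>2 \<le> 1\<^sup>2" using True s by (simp add: power_mult_distrib)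
  then have sa: "s * a \<le> 1" by (rule power2_le_imp_le) simp
  have "a * s * (-1) \<le> a * s * (s * ln s)" using mult_ln_ge[OF s(1)] s assms by (intro mult_left_mono) auto
  moreover have "ln \<rho> = 2 * ln s" using s by (simp add: power2_eq_square ln_mult)
  then have "a * (\<rho> * ln \<rho>) = 2 * (a * s * (s * ln s))" by (simp add: s(2) power2_eq_square)
  moreover have "0 \<le> \<rho> * a" "0 \<le> \<rho> * a ^ 3" using assms by auto
  moreover have "a * s \<le> 1" using sa by (simp add: mult.commute)
  ultimately show ?thesis by linarith
next
  case False
  then have "1 / \<rho> \<le> a\<^sup>2" using assms by (simp add: divide_le_eq mult.commute)
  then have "ln (1 / \<rho>) \<le> ln (a\<^sup>2)" using assms by simp
  also have "\<dots> = 2 * ln a" using assms by (simp add: ln_realpow)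
  also have "\<dots> \<le> 2 * (a - 1)" using ln_le_minus_one[OF assms(2)] by simp
  also have "\<dots> \<le> 1 + a\<^sup>2" using zero_le_power2[of "a - 1"] by (simp add: power2_diff)
  finally have "- (1 + a\<^sup>2) \<le> ln \<rho>" using assms by (simp add: ln_div)
  then have "(a * \<rho>) * - (1 + a\<^sup>2) \<le> (a * \<rho>) * ln \<rho>" using assms by (intro mult_left_mono) auto
  moreover have "(a * \<rho>) * - (1 + a\<^sup>2) = - (\<rho> * a + \<rho> * a ^ 3)" by (simp add: algebra_simps power3_eq_cube power2_eq_square)
  ultimately show ?thesis by (simp add: mult.assoc)
qed

text \<open>Here \<open>a\<close> is the normal velocity, \<open>q\<close> the normal heat flux and \<open>V2\<close> the squared speed. Each bad term is
  at most a multiple of \<open>\<rho> a\<close> or \<open>a E\<close>, and these are part of the outflow of mass and energy.\<close>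

lemma outflow_entropy_bound:
  fixes \<rho> T R cv V2 a q p E K :: real
  assumes pos: "0 < \<rho>" "0 < T" "0 < R" "0 < cv" "0 < a" and p: "p = \<rho> * R * T"
    and E: "E = cv * \<rho> * T + 1/2 * \<rho> * V2" and V2: "a\<^sup>2 \<le> V2" and K: "1 + 2 * R \<le> K"
    and q: "- a * p \<le> q"
  shows "- 2 * R \<le> q / T - \<rho> * (cv * ln T - R * ln \<rho>) * a + K * (\<rho> * a + a * (E + p))"
proof -
  have nn: "0 \<le> V2" using V2 zero_le_power2 order_trans by blast
  have E0: "0 \<le> E" "0 \<le> p" using pos nn by (auto simp: E p)
  have 1: "q / T \<ge> - (R * (\<rho> * a))"
  proof -
    have "- a * p / T \<le> q / T" using q pos by (intro divide_right_mono) auto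
    then show ?thesis using pos by (simp add: p mult_ac)
  qed
  have 2: "- \<rho> * (cv * ln T) * a \<ge> - (a * E)"
  proof -
    have "cv * \<rho> * ln T \<le> cv * \<rho> * T" using pos ln_le_minus_one[of T] by (intro mult_left_mono) auto
    also have "\<dots> \<le> E" using pos nn by (simp add: E)
    finally have "a * (cv * \<rho> * ln T) \<le> a * E" using pos by (intro mult_left_mono) auto
    then show ?thesis by (simp add: mult_ac)
  qed
  have 3: "R * (a * (\<rho> * ln \<rho>)) \<ge> - (R * (2 + \<rho> * a + 2 * (a * E)))"
  proof -
    have "\<rho> * a\<^sup>2 \<le> \<rho> * V2" using V2 pos by (intro mult_left_mono) auto
    also have "\<dots> \<le> 2 * E" using pos by (simp add: E)
    finally have "a * (\<rho> * a\<^sup>2) \<le> a * (2 * E)" using pos by (intro mult_left_mono) auto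
    then have "\<rho> * a ^ 3 \<le> 2 * (a * E)" by (simp add: power3_eq_cube power2_eq_square mult_ac)
    then have "- (2 + \<rho> * a + 2 * (a * E)) \<le> a * (\<rho> * ln \<rho>)"
      using outflow_mult_ln_ge[OF pos(1,5)] by linarith
    then have "R * - (2 + \<rho> * a + 2 * (a * E)) \<le> R * (a * (\<rho> * ln \<rho>))" using pos by (intro mult_left_mono) auto
    then show ?thesis by (simp only: mult_minus_right)
  qed
  have "(1 + 2 * R) * (\<rho> * a + a * E) \<le> K * (\<rho> * a + a * (E + p))"
    using K pos E0 by (intro mult_mono) (auto simp: distrib_left)
  moreover have "(1 + 2 * R) * (\<rho> * a + a * E) = \<rho> * a + a * E + 2 * (R * (\<rho> * a)) + 2 * (R * (a * E))"
    by (simp add: algebra_simps)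
  moreover have "0 \<le> \<rho> * a" using pos by simp
  moreover have "q / T - \<rho> * (cv * ln T - R * ln \<rho>) * a = q / T + (- \<rho> * (cv * ln T) * a) + R * (a * (\<rho> * ln \<rho>))"
    by (simp add: algebra_simps)
  moreover have "R * (2 + \<rho> * a + 2 * (a * E)) = 2 * R + R * (\<rho> * a) + 2 * (R * (a * E))" by (simp add: algebra_simps)
  ultimately show ?thesis using 1 2 3 by linarith
qed

lemma abs_mult_le: "\<bar>x\<bar> \<le> a \<Longrightarrow> \<bar>y\<bar> \<le> b \<Longrightarrow> \<bar>x * y\<bar> \<le> a * (b::real)"
  unfolding abs_mult by (intro mult_mono) auto

text \<open>Here \<open>a = - v\<^sub>n\<close> is bounded by the sound speed of the data and the density is the prescribed one. The only
  uncontrolled quantity is \<open>T\<close>; it enters through \<open>ln T + l / T\<close> with \<open>l = p\<^sub>b / (\<rho>\<^sub>b R)\<close>, the prescribed temperature,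
  which is at least \<open>1 + ln l\<close>.\<close>

lemma subsonic_inflow_entropy_bound:
  fixes \<rho> T R cv a q p vt K M \<epsilon> Am :: real
  assumes pos: "0 < T" "0 < R" "0 < cv" "0 < \<epsilon>" "0 \<le> K"
    and a: "0 < a" "a \<le> Am" and \<rho>: "\<epsilon> \<le> \<rho>" "\<rho> \<le> M" and p: "\<epsilon> \<le> p" "p \<le> M" "\<epsilon> \<le> p / (\<rho> * R)" and vt: "\<bar>vt\<bar> \<le> M"
    and q: "- (a * (cv * \<rho> * T)) + a * (p * cv / R) \<le> q"
  shows "- (Am * (K * (M + (1/2 * M * (Am\<^sup>2 + M\<^sup>2) + M * cv / R + M)) + (cv * M * \<bar>ln \<epsilon>\<bar> + R * M\<^sup>2)))
     \<le> q / T + \<rho> * (cv * ln T - R * ln \<rho>) * a - K * (\<rho> * a + a * (1/2 * \<rho> * (a\<^sup>2 + vt\<^sup>2) + p * cv / R + p))"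
proof -
  have \<rho>0: "0 < \<rho>" and p0: "0 < p" and M0: "0 < M" and Am0: "0 < Am" using pos \<rho> p a by linarith+
  have vt2: "vt\<^sup>2 \<le> M\<^sup>2" using vt by (rule abs_le_square_iff[THEN iffD1, of vt M, simplified abs_of_pos[OF M0]])
  have X: "\<rho> + (1/2 * \<rho> * (a\<^sup>2 + vt\<^sup>2) + p * cv / R + p) \<le> M + (1/2 * M * (Am\<^sup>2 + M\<^sup>2) + M * cv / R + M)"
  proof -
    have "\<rho> * (a\<^sup>2 + vt\<^sup>2) \<le> M * (Am\<^sup>2 + M\<^sup>2)" using \<rho> \<rho>0 M0 vt2 power_mono[of a Am 2] a
      by (intro mult_mono add_mono) auto
    moreover have "p * cv / R \<le> M * cv / R" using p pos by (intro divide_right_mono mult_right_mono) auto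
    ultimately show ?thesis using \<rho> p by linarith
  qed
  define l where "l = p / (\<rho> * R)"
  have l: "0 < l" "\<epsilon> \<le> l" using \<rho>0 p0 pos p by (auto simp: l_def)
  have qT: "q / T \<ge> - (a * cv * \<rho>) + a * (cv * \<rho>) * (l / T)"
  proof -
    have "(- (a * (cv * \<rho> * T)) + a * (p * cv / R)) / T \<le> q / T" using q pos by (intro divide_right_mono) auto
    moreover have "(- (a * (cv * \<rho> * T)) + a * (p * cv / R)) / T = - (a * cv * \<rho>) + a * (cv * \<rho>) * (l / T)"
      using pos \<rho>0 by (simp add: l_def field_simps)
    ultimately show ?thesis by simp
  qed
  have "a * (cv * \<rho>) * (1 + ln l) \<le> a * (cv * \<rho>) * (ln T + l / T)"
    using ln_add_inverse_ge[OF pos(1) l(1)] a pos \<rho>0 by (intro mult_left_mono) auto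
  then have 1: "q / T + \<rho> * (cv * ln T) * a \<ge> a * (cv * \<rho>) * ln l"
    using qT by (simp add: algebra_simps)
  have "- \<bar>ln \<epsilon>\<bar> \<le> ln l" using l pos ln_le_cancel_iff[of "\<epsilon>" l] by linarith
  then have "cv * \<rho> * (- \<bar>ln \<epsilon>\<bar>) \<le> cv * \<rho> * ln l" using pos \<rho>0 by (intro mult_left_mono) auto
  moreover have "cv * \<rho> * \<bar>ln \<epsilon>\<bar> \<le> cv * M * \<bar>ln \<epsilon>\<bar>" using \<rho> pos by (intro mult_right_mono mult_left_mono) auto
  ultimately have 2: "- (cv * M * \<bar>ln \<epsilon>\<bar>) \<le> cv * \<rho> * ln l" by linarith
  have "\<rho> * ln \<rho> \<le> \<rho> * M" using \<rho> \<rho>0 ln_le_minus_one[OF \<rho>0] by (intro mult_left_mono) linarith+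
  also have "\<dots> \<le> M * M" using \<rho> M0 by (intro mult_right_mono) auto
  finally have "\<rho> * ln \<rho> \<le> M * M" .
  then have 3: "R * (\<rho> * ln \<rho>) \<le> R * M\<^sup>2" using pos by (intro mult_left_mono) (auto simp: power2_eq_square)
  define Y where "Y = K * (M + (1/2 * M * (Am\<^sup>2 + M\<^sup>2) + M * cv / R + M)) + (cv * M * \<bar>ln \<epsilon>\<bar> + R * M\<^sup>2)"
  define Z where "Z = K * (\<rho> + (1/2 * \<rho> * (a\<^sup>2 + vt\<^sup>2) + p * cv / R + p)) - cv * \<rho> * ln l + R * (\<rho> * ln \<rho>)"
  have "Z \<le> Y" using mult_left_mono[OF X pos(5)] 2 3 unfolding Z_def Y_def by linarith
  moreover have "0 \<le> Y" unfolding Y_def using pos M0 by (intro add_nonneg_nonneg mult_nonneg_nonneg) auto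
  ultimately have "a * Z \<le> Am * Y"
    using a mult_left_mono[of Z Y a] mult_right_mono[of a Am Y] by linarith
  moreover have "a * Z = K * (\<rho> * a + a * (1/2 * \<rho> * (a\<^sup>2 + vt\<^sup>2) + p * cv / R + p)) - a * (cv * \<rho>) * ln l + R * (\<rho> * ln \<rho>) * a"
    by (simp add: Z_def algebra_simps)
  moreover have "\<rho> * (cv * ln T - R * ln \<rho>) * a = \<rho> * (cv * ln T) * a - R * (\<rho> * ln \<rho>) * a" by (simp add: algebra_simps)
  ultimately show ?thesis using 1 unfolding Y_def by linarith
qed

text \<open>Here \<open>m\<close> is the prescribed mass flux, \<open>a = - v\<^sub>n\<close> and \<open>ab\<close> its prescribed counterpart, and \<open>Vb2\<close> the squared
  prescribed speed. Minimizing the heat flux bound over \<open>a - ab\<close> costs \<open>p\<^sup>2 / (2 m)\<close>, and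
  \<open>ab\<^sup>2 \<ge> \<gamma> p / \<rho>b\<close> makes this at most half of the gain \<open>ab * p * cv / R\<close>. So again \<open>ln T\<close> is
  outweighed by a positive multiple of \<open>1 / T\<close>.\<close>

lemma supersonic_inflow_entropy_bound:
  fixes \<rho> \<rho>b T R cv a ab q p K M \<epsilon> am m Vb2 :: real
  assumes pos: "0 < T" "0 < R" "0 < cv" "0 < \<epsilon>" "0 \<le> K" "0 < am"
    and a: "am \<le> a" "0 < \<rho>" "\<rho> * a = m" and m: "m = \<rho>b * ab"
    and ab: "0 < ab" "ab \<le> 2 * M" "(1 + R / cv) * (p / \<rho>b) \<le> ab\<^sup>2"
    and \<rho>: "\<epsilon> \<le> \<rho>b" "\<rho>b \<le> M" and p: "\<epsilon> \<le> p" "p \<le> M" "\<epsilon> \<le> p / (\<rho>b * R)"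
    and Vb: "0 \<le> Vb2" "Vb2 \<le> 2 * M\<^sup>2"
    and q: "- (m * cv * T) + 1/2 * m * (a - ab)\<^sup>2 + p * (ab - a) + ab * (p * cv / R) \<le> q"
  shows "- (K * (2 * M\<^sup>2 + 2 * M * (1/2 * M * (2 * M\<^sup>2) + M * cv / R + M)) + (2 * M\<^sup>2 * cv * \<bar>ln (\<epsilon> / 2)\<bar> + R * ((2 * M\<^sup>2)\<^sup>2 / am)))
     \<le> q / T + m * (cv * ln T - R * ln \<rho>) - K * (m + ab * (1/2 * \<rho>b * Vb2 + p * cv / R + p))"
proof -
  have \<rho>b0: "0 < \<rho>b" and p0: "0 < p" and M0: "0 < M" using pos \<rho> p by linarith+
  have a0: "0 < a" using a pos by linarith
  have m0: "0 < m" using m \<rho>b0 ab by simp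
  have mM: "m \<le> 2 * M\<^sup>2"
  proof -
    have "\<rho>b * ab \<le> M * (2 * M)" using \<rho> ab \<rho>b0 M0 by (intro mult_mono) auto
    then show ?thesis by (simp add: m power2_eq_square)
  qed
  have X: "m + ab * (1/2 * \<rho>b * Vb2 + p * cv / R + p) \<le> 2 * M\<^sup>2 + 2 * M * (1/2 * M * (2 * M\<^sup>2) + M * cv / R + M)"
  proof -
    have "1/2 * \<rho>b * Vb2 \<le> 1/2 * M * (2 * M\<^sup>2)" using \<rho> Vb \<rho>b0 by (intro mult_mono) auto
    moreover have "p * cv / R \<le> M * cv / R" using p pos by (intro divide_right_mono mult_right_mono) auto
    ultimately have "1/2 * \<rho>b * Vb2 + p * cv / R + p \<le> 1/2 * M * (2 * M\<^sup>2) + M * cv / R + M" using p by linarith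
    moreover have "0 \<le> 1/2 * \<rho>b * Vb2 + p * cv / R + p" using \<rho>b0 Vb p0 pos by (intro add_nonneg_nonneg) auto
    ultimately have "ab * (1/2 * \<rho>b * Vb2 + p * cv / R + p) \<le> 2 * M * (1/2 * M * (2 * M\<^sup>2) + M * cv / R + M)"
      using ab M0 by (intro mult_mono) auto
    then show ?thesis using mM by linarith
  qed
  define l where "l = p / (\<rho>b * R) / 2"
  have l: "0 < l" "\<epsilon> / 2 \<le> l" using \<rho>b0 p0 pos p by (auto simp: l_def)
  have q2: "- (m * cv * T) + m * cv * l \<le> q"
  proof -
    define d where "d = ab - a"
    have sq: "1/2 * m * d\<^sup>2 + p * d \<ge> - (p\<^sup>2 / (2 * m))"
    proof -
      \<comment> \<open>completing the square in the velocity mismatch\<close>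
      have "0 \<le> (m * d + p)\<^sup>2 / (2 * m)" using m0 by simp
      also have "\<dots> = 1/2 * m * d\<^sup>2 + p * d + p\<^sup>2 / (2 * m)"
        using m0 by (simp add: power2_eq_square field_simps)
      finally show ?thesis by simp
    qed
    have "R / cv * (p / \<rho>b) \<le> (1 + R / cv) * (p / \<rho>b)" using p0 \<rho>b0 pos by (intro mult_right_mono) auto
    then have "R / cv * (p / \<rho>b) \<le> ab\<^sup>2" using ab by linarith
    then have "R / cv * (p / \<rho>b) * (cv / R) \<le> ab\<^sup>2 * (cv / R)" using pos by (intro mult_right_mono) auto
    then have "p / \<rho>b \<le> ab\<^sup>2 * (cv / R)" using pos by simp
    then have "p / \<rho>b * (p / (2 * ab)) \<le> ab\<^sup>2 * (cv / R) * (p / (2 * ab))" using p0 ab by (intro mult_right_mono) auto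
    moreover have "p / \<rho>b * (p / (2 * ab)) = p\<^sup>2 / (2 * m)" by (simp add: m power2_eq_square field_simps)
    moreover have "ab\<^sup>2 * (cv / R) * (p / (2 * ab)) = ab * (p * cv / R) / 2" using ab by (simp add: power2_eq_square field_simps)
    ultimately have "p\<^sup>2 / (2 * m) \<le> ab * (p * cv / R) / 2" by simp
    moreover have "ab * (p * cv / R) / 2 = m * cv * l" using \<rho>b0 pos by (simp add: m l_def field_simps)
    moreover have "- (m * cv * T) + 1/2 * m * d\<^sup>2 + p * d + ab * (p * cv / R) \<le> q"
      using q by (simp add: d_def power2_commute)
    moreover have "A + Z \<le> q" if "Y \<le> X / 2" "X / 2 = Z" "A + D + P + X \<le> q" "- Y \<le> D + P" for A D P X Y Z :: real
      using that by linarith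
    ultimately show ?thesis using sq by blast
  qed
  have qT: "q / T \<ge> - (m * cv) + m * cv * (l / T)"
  proof -
    have "(- (m * cv * T) + m * cv * l) / T \<le> q / T" using q2 pos by (intro divide_right_mono) auto
    moreover have "(- (m * cv * T) + m * cv * l) / T = - (m * cv) + m * cv * (l / T)"
      using pos by (simp add: field_simps)
    ultimately show ?thesis by simp
  qed
  have "m * cv * (1 + ln l) \<le> m * cv * (ln T + l / T)"
    using ln_add_inverse_ge[OF pos(1) l(1)] pos m0 by (intro mult_left_mono) auto
  then have 1: "q / T + m * cv * ln T \<ge> m * cv * ln l"
    using qT by (simp add: algebra_simps)
  have "- \<bar>ln (\<epsilon> / 2)\<bar> \<le> ln l" using l pos ln_le_cancel_iff[of "\<epsilon> / 2" l] by linarith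
  then have "m * cv * (- \<bar>ln (\<epsilon> / 2)\<bar>) \<le> m * cv * ln l" using pos m0 by (intro mult_left_mono) auto
  moreover have "m * cv * \<bar>ln (\<epsilon> / 2)\<bar> \<le> 2 * M\<^sup>2 * cv * \<bar>ln (\<epsilon> / 2)\<bar>" using mM pos by (intro mult_right_mono) auto
  ultimately have 2: "- (2 * M\<^sup>2 * cv * \<bar>ln (\<epsilon> / 2)\<bar>) \<le> m * cv * ln l" by linarith
  have "m * ln \<rho> \<le> (2 * M\<^sup>2)\<^sup>2 / am"
  proof -
    have "\<rho> \<le> m / am"
    proof -
      have "\<rho> * am \<le> \<rho> * a" using a by (intro mult_left_mono) auto
      then show ?thesis using a pos by (simp add: le_divide_eq)
    qed
    then have "ln \<rho> \<le> m / am" using ln_le_minus_one[OF a(2)] by linarith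
    then have "m * ln \<rho> \<le> m * (m / am)" using m0 by (intro mult_left_mono) auto
    also have "\<dots> = m\<^sup>2 / am" by (simp add: power2_eq_square)
    also have "\<dots> \<le> (2 * M\<^sup>2)\<^sup>2 / am" using m0 mM pos by (intro divide_right_mono power_mono) auto
    finally show ?thesis .
  qed
  then have 3: "R * (m * ln \<rho>) \<le> R * ((2 * M\<^sup>2)\<^sup>2 / am)" using pos by (intro mult_left_mono) auto
  have "m * (cv * ln T - R * ln \<rho>) = m * cv * ln T - R * (m * ln \<rho>)" by (simp add: algebra_simps)
  then show ?thesis using mult_left_mono[OF X pos(5)] 1 2 3 by linarith
qed

section \<open>The flux of the functional at the boundary\<close>

lemma state_components:
  "dens q = fst q" "velx q = fst (snd q) / fst q" "vely q = fst (snd (snd q)) / fst q" "energy q = snd (snd (snd q))"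
  by (cases q; simp)+

lemma gas_okD:
  assumes "gas_ok G"
  shows "0 < gas_const G" "0 < cv G" "gam G = 1 + gas_const G / cv G" "0 < visc G" "0 < cond G"
  using assms by (auto simp: gas_ok_def gam_def gas_const_def field_simps)

lemma pressure_temperature:
  assumes "gas_ok G" "0 < dens q"
  shows "pressure G q = dens q * gas_const G * temperature G q"
    "energy q = cv G * dens q * temperature G q + 1/2 * dens q * ((velx q)\<^sup>2 + (vely q)\<^sup>2)"
proof -
  note G = gas_okD[OF assms(1)]
  show p: "pressure G q = dens q * gas_const G * temperature G q"
    using G(1) assms(2) by (simp add: temperature_def)
  have "gas_const G / cv G * (energy q - 1/2 * dens q * ((velx q)\<^sup>2 + (vely q)\<^sup>2)) = dens q * gas_const G * temperature G q"
    using p by (simp add: pressure_def G(3))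
  then have "cv G / gas_const G * (gas_const G / cv G * (energy q - 1/2 * dens q * ((velx q)\<^sup>2 + (vely q)\<^sup>2)))
     = cv G / gas_const G * (dens q * gas_const G * temperature G q)" by simp
  then have "energy q - 1/2 * dens q * ((velx q)\<^sup>2 + (vely q)\<^sup>2) = cv G * dens q * temperature G q"
    using G(1,2) by simp
  then show "energy q = cv G * dens q * temperature G q + 1/2 * dens q * ((velx q)\<^sup>2 + (vely q)\<^sup>2)" by simp
qed

definition spec_entropy :: "gas \<Rightarrow> state \<Rightarrow> real" where
  "spec_entropy G q = cv G * ln (temperature G q) - gas_const G * ln (dens q)"

definition lyapunov :: "gas \<Rightarrow> real \<Rightarrow> state \<Rightarrow> real" where
  "lyapunov G K q = K * (dens q + energy q) - dens q * spec_entropy G q"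

definition net_flux_x :: "gas \<Rightarrow> point set \<Rightarrow> (point \<Rightarrow> state) \<Rightarrow> point \<Rightarrow> state" where
  "net_flux_x G \<Omega> s x = inv_flux_x G (s x) - visc_flux_x G \<Omega> s x"

definition net_flux_y :: "gas \<Rightarrow> point set \<Rightarrow> (point \<Rightarrow> state) \<Rightarrow> point \<Rightarrow> state" where
  "net_flux_y G \<Omega> s x = inv_flux_y G (s x) - visc_flux_y G \<Omega> s x"

text \<open>The component sum \<open>dens + energy\<close> of a flux vector is the sum of its mass and energy fluxes.\<close>

definition lyapunov_flux :: "gas \<Rightarrow> point set \<Rightarrow> real \<Rightarrow> (point \<Rightarrow> state) \<Rightarrow> point \<Rightarrow> point" where
  "lyapunov_flux G \<Omega> K s x =
    (K * (dens (net_flux_x G \<Omega> s x) + energy (net_flux_x G \<Omega> s x)) - dens (s x) * velx (s x) * spec_entropy G (s x)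
       + cond G * dx \<Omega> (\<lambda>y. temperature G (s y)) x / temperature G (s x),
     K * (dens (net_flux_y G \<Omega> s x) + energy (net_flux_y G \<Omega> s x)) - dens (s x) * vely (s x) * spec_entropy G (s x)
       + cond G * dy \<Omega> (\<lambda>y. temperature G (s y)) x / temperature G (s x))"

text \<open>The momentum components of the boundary condition determine the normal stress. Substituting it in the
  energy component leaves the normal heat flux as a function of the state and the data alone.\<close>

lemma boundary_condition_heat_flux:
  assumes "gas_ok G" "0 < dens (s x)" and bc: "boundary_condition G \<Omega> s b x n"
    and bf: "boundary_flux G (s x) (b x) n = (b1, b2, b3, b4)"
  shows "dens (s x) * normal_vel (s x) n = b1"
    and "cond G * (fst n * dx \<Omega> (\<lambda>y. temperature G (s y)) x + snd n * dy \<Omega> (\<lambda>y. temperature G (s y)) x)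
      = normal_vel (s x) n * (energy (s x) - dens (s x) * ((velx (s x))\<^sup>2 + (vely (s x))\<^sup>2)) + velx (s x) * b2 + vely (s x) * b3 - b4"
    and "fst n * (dens (net_flux_x G \<Omega> s x) + energy (net_flux_x G \<Omega> s x))
      + snd n * (dens (net_flux_y G \<Omega> s x) + energy (net_flux_y G \<Omega> s x)) = b1 + b4"
proof -
  define \<rho> u v E p where "\<rho> = dens (s x)" and "u = velx (s x)" and "v = vely (s x)" and "E = energy (s x)" and "p = pressure G (s x)"
  define xx xy yy Tx Ty where "xx = tau_xx G \<Omega> s x" and "xy = tau_xy G \<Omega> s x" and "yy = tau_yy G \<Omega> s x"
    and "Tx = dx \<Omega> (\<lambda>y. temperature G (s y)) x" and "Ty = dy \<Omega> (\<lambda>y. temperature G (s y)) x"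
  note folds = \<rho>_def[symmetric] u_def[symmetric] v_def[symmetric] E_def[symmetric] p_def[symmetric]
    xx_def[symmetric] xy_def[symmetric] yy_def[symmetric] Tx_def[symmetric] Ty_def[symmetric]
  obtain n1 n2 where n: "n = (n1, n2)" by (cases n)
  have "n1 *\<^sub>R (inv_flux_x G (s x) - visc_flux_x G \<Omega> s x) + n2 *\<^sub>R (inv_flux_y G (s x) - visc_flux_y G \<Omega> s x) = (b1, b2, b3, b4)"
    using bc bf by (simp add: boundary_condition_def n)
  then have e: "n1 * (\<rho> * u) + n2 * (\<rho> * v) = b1"
    "n1 * (\<rho> * u\<^sup>2 + p - xx) + n2 * (\<rho> * u * v - xy) = b2"
    "n1 * (\<rho> * u * v - xy) + n2 * (\<rho> * v\<^sup>2 + p - yy) = b3"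
    "n1 * (u * (E + p) - (u * xx + v * xy + cond G * Tx)) + n2 * (v * (E + p) - (u * xy + v * yy + cond G * Ty)) = b4"
    unfolding inv_flux_x_def inv_flux_y_def visc_flux_x_def visc_flux_y_def Let_def folds by simp_all
  show "dens (s x) * normal_vel (s x) n = b1"
    using e(1) unfolding normal_vel_def folds n by (simp add: algebra_simps)
  show "cond G * (fst n * dx \<Omega> (\<lambda>y. temperature G (s y)) x + snd n * dy \<Omega> (\<lambda>y. temperature G (s y)) x)
      = normal_vel (s x) n * (energy (s x) - dens (s x) * ((velx (s x))\<^sup>2 + (vely (s x))\<^sup>2)) + velx (s x) * b2 + vely (s x) * b3 - b4"
    unfolding normal_vel_def folds n e(2,3,4)[symmetric] by (simp add: algebra_simps power2_eq_square)
  show "fst n * (dens (net_flux_x G \<Omega> s x) + energy (net_flux_x G \<Omega> s x))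
      + snd n * (dens (net_flux_y G \<Omega> s x) + energy (net_flux_y G \<Omega> s x)) = b1 + b4"
    unfolding e(1,4)[symmetric] net_flux_x_def net_flux_y_def inv_flux_x_def inv_flux_y_def visc_flux_x_def visc_flux_y_def Let_def folds n
    by (simp add: algebra_simps)
qed

definition bvals_ok :: "gas \<Rightarrow> real \<Rightarrow> real \<Rightarrow> bvals \<Rightarrow> bool" where
  "bvals_ok G M \<epsilon> B \<longleftrightarrow> rho_b B \<le> M \<and> p_b B \<le> M \<and> \<bar>u_b B\<bar> \<le> M \<and> \<bar>v_b B\<bar> \<le> M \<and> \<bar>vtau_b B\<bar> \<le> M \<and>
     \<epsilon> \<le> rho_b B \<and> \<epsilon> \<le> p_b B \<and> \<epsilon> \<le> temp_b G B"

text \<open>In each regime the heat flux \<open>h\<close> is computed from the flux data: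
  \<open>h = 0\<close> at supersonic outflow, \<open>h = v\<^sub>n (p\<^sub>b - p)\<close> at subsonic outflow, and at inflow \<open>h\<close> contains
  a nonnegative square of the velocity mismatch.\<close>

lemma boundary_entropy_bound:
  assumes G: "gas_ok G" and "0 < \<epsilon>" and K: "1 + 2 * gas_const G \<le> K"
  obtains C where "0 \<le> C"
    "\<And>q B n b1 b2 b3 b4 h. \<lbrakk>0 < dens q; 0 < temperature G q; norm n = 1; bvals_ok G M \<epsilon> B;
      supersonic_inflow G q B n \<Longrightarrow> normal_vel_b B n < 0 \<and> \<bar>normal_vel_b B n\<bar> > sound_b G B;
      boundary_flux G q B n = (b1, b2, b3, b4);
      dens q * normal_vel q n = b1;
      h = normal_vel q n * (energy q - dens q * ((velx q)\<^sup>2 + (vely q)\<^sup>2)) + velx q * b2 + vely q * b3 - b4\<rbrakk>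
     \<Longrightarrow> - C \<le> h / temperature G q - dens q * spec_entropy G q * normal_vel q n + K * (b1 + b4)"
proof -
  note G = gas_okD[OF G] and ok = \<open>gas_ok G\<close>
  define R where "R = gas_const G"
  define c where "c = cv G"
  have R: "0 < R" and c: "0 < c" and gam: "gam G = 1 + R / c" using G by (auto simp: R_def c_def)
  have K0: "0 \<le> K" and K: "1 + 2 * R \<le> K" using K R by (auto simp: R_def)
  define Am where "Am = sqrt (gam G * M / \<epsilon>)"
  define am where "am = sqrt (gam G * \<epsilon> / M)"
  \<comment> \<open>the two inflow constants; \<open>Am\<close> and \<open>am\<close> bound the sound speed of the data\<close>
  define C3 where "C3 = Am * (K * (M + (1/2 * M * (Am\<^sup>2 + M\<^sup>2) + M * c / R + M)) + (c * M * \<bar>ln \<epsilon>\<bar> + R * M\<^sup>2))"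
  define C4 where "C4 = K * (2 * M\<^sup>2 + 2 * M * (1/2 * M * (2 * M\<^sup>2) + M * c / R + M)) + (2 * M\<^sup>2 * c * \<bar>ln (\<epsilon> / 2)\<bar> + R * ((2 * M\<^sup>2)\<^sup>2 / am))"
  define C where "C = max 0 (max (2 * R) (max C3 C4))"
  show ?thesis
  proof (rule that[of C])
    show "0 \<le> C" by (simp add: C_def)
    fix q B n and b1 b2 b3 b4 h :: real
    assume \<rho>: "0 < dens q" and T: "0 < temperature G q" and n1: "norm n = 1" and B: "bvals_ok G M \<epsilon> B"
      and sup: "supersonic_inflow G q B n \<Longrightarrow> normal_vel_b B n < 0 \<and> \<bar>normal_vel_b B n\<bar> > sound_b G B"
      and bf: "boundary_flux G q B n = (b1, b2, b3, b4)" and b1: "dens q * normal_vel q n = b1"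
      and h: "h = normal_vel q n * (energy q - dens q * ((velx q)\<^sup>2 + (vely q)\<^sup>2)) + velx q * b2 + vely q * b3 - b4"
    define r u v T' E p a where "r = dens q" and "u = velx q" and "v = vely q" and "T' = temperature G q"
      and "E = energy q" and "p = pressure G q" and "a = normal_vel q n"
    note folds = r_def[symmetric] u_def[symmetric] v_def[symmetric] T'_def[symmetric] E_def[symmetric] p_def[symmetric]
      a_def[symmetric] R_def[symmetric] c_def[symmetric]
    have p: "p = r * R * T'" and E: "E = c * r * T' + 1/2 * r * (u\<^sup>2 + v\<^sup>2)"
      using pressure_temperature[OF ok \<rho>] by (simp_all add: folds)
    obtain n1 n2 where n: "n = (n1, n2)" by (cases n)
    have an: "normal_vel q (n1, n2) = a" by (simp add: a_def n)
    have nn: "n1\<^sup>2 + n2\<^sup>2 = 1" using n1 by (simp add: n norm_prod_def)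
    have a: "a = u * n1 + v * n2" by (simp add: a_def normal_vel_def n u_def v_def)
    have a2: "a\<^sup>2 \<le> u\<^sup>2 + v\<^sup>2"
    proof -
      have "u\<^sup>2 + v\<^sup>2 = (u\<^sup>2 + v\<^sup>2) * (n1\<^sup>2 + n2\<^sup>2)" by (simp add: nn)
      also have "\<dots> = a\<^sup>2 + (u * n2 - v * n1)\<^sup>2" by (simp add: a power2_eq_square algebra_simps)
      finally show ?thesis by simp
    qed
    define \<rho>b pb vt where "\<rho>b = rho_b B" and "pb = p_b B" and "vt = vtau_b B"
    have Bb: "\<epsilon> \<le> \<rho>b" "\<rho>b \<le> M" "\<epsilon> \<le> pb" "pb \<le> M" "\<epsilon> \<le> pb / (\<rho>b * R)" "\<bar>vt\<bar> \<le> M"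
      using B by (auto simp: bvals_ok_def temp_b_def \<rho>b_def pb_def vt_def R_def)
    have M0: "0 < M" and \<rho>b0: "0 < \<rho>b" and pb0: "0 < pb" using Bb \<open>0 < \<epsilon>\<close> by auto
    have gam0: "0 < gam G" using gam R c by (simp add: add_pos_pos)
    have sb: "sound_b G B = sqrt (gam G * pb / \<rho>b)" by (simp add: sound_b_def pb_def \<rho>b_def)
    have sb_le: "sound_b G B \<le> Am" unfolding sb Am_def
      using Bb M0 \<rho>b0 pb0 gam0 \<open>0 < \<epsilon>\<close> by (intro real_sqrt_le_mono frac_le mult_left_mono) auto
    have sb_ge: "am \<le> sound_b G B" unfolding sb am_def
      using Bb M0 \<rho>b0 pb0 gam0 \<open>0 < \<epsilon>\<close> by (intro real_sqrt_le_mono frac_le mult_left_mono) auto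
    have am: "0 < am" using M0 gam0 \<open>0 < \<epsilon>\<close> by (simp add: am_def)
    have h: "h = a * (E - r * (u\<^sup>2 + v\<^sup>2)) + u * b2 + v * b3 - b4" using h by (simp add: folds)
    have b1: "r * a = b1" using b1 by (simp add: folds)
    have goal: "- C \<le> h / T' - r * (c * ln T' - R * ln r) * a + K * (b1 + b4)"
    proof -
      consider (sup_in) "supersonic_inflow G q B n" | (sub_in) "\<not> supersonic_inflow G q B n" "subsonic_inflow G q B n"
        | (sub_out) "\<not> supersonic_inflow G q B n" "\<not> subsonic_inflow G q B n" "subsonic_outflow G q n"
        | (sup_out) "\<not> supersonic_inflow G q B n" "\<not> subsonic_inflow G q B n" "\<not> subsonic_outflow G q n" "supersonic_outflow G q n"
        | (zero) "\<not> supersonic_inflow G q B n" "\<not> subsonic_inflow G q B n" "\<not> subsonic_outflow G q n" "\<not> supersonic_outflow G q n"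
        by blast
      then show ?thesis
      proof cases
        case sup_out
        have a0: "0 < a" using sup_out by (simp add: supersonic_outflow_def a_def)
        have b: "b2 = n1 * (r * u\<^sup>2 + p) + n2 * (r * u * v)" "b3 = n1 * (r * u * v) + n2 * (r * v\<^sup>2 + p)" "b4 = a * (E + p)"
          using bf sup_out by (auto simp: boundary_flux_def inv_flux_x_def inv_flux_y_def n a folds algebra_simps)
        have h0: "h = 0" unfolding h b a by (simp add: power2_eq_square algebra_simps)
        have "- 2 * R \<le> h / T' - r * (c * ln T' - R * ln r) * a + K * (r * a + a * (E + p))"
          by (rule outflow_entropy_bound[OF _ _ R c a0 p E a2 K]) (use \<rho> T a0 R p in \<open>auto simp: folds h0\<close>)
        then show ?thesis by (simp add: b b1 C_def)
      next
        case sub_out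
        have a0: "0 < a" using sub_out by (simp add: subsonic_outflow_def a_def)
        have b: "b2 = r * u * a + n1 * pb" "b3 = r * v * a + n2 * pb" "b4 = a * (E + p)"
          using bf sub_out by (auto simp: boundary_flux_def flux_subsonic_outflow_def Let_def n an folds pb_def)
        have h0: "h = a * (pb - p)" unfolding h b by (simp add: a power2_eq_square algebra_simps)
        have "- 2 * R \<le> h / T' - r * (c * ln T' - R * ln r) * a + K * (r * a + a * (E + p))"
          by (rule outflow_entropy_bound[OF _ _ R c a0 p E a2 K])
            (use \<rho> T a0 pb0 in \<open>auto simp: folds h0 right_diff_distrib\<close>)
        then show ?thesis by (simp add: b b1 C_def)
      next
        case zero
        have a0: "a = 0"
          using zero by (force simp: supersonic_inflow_def subsonic_inflow_def subsonic_outflow_def supersonic_outflow_def a_def)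
        have b: "b2 = n1 * pb" "b3 = n2 * pb" "b4 = 0" "b1 = 0"
          using bf zero by (auto simp: boundary_flux_def n pb_def)
        have "u * (n1 * pb) + v * (n2 * pb) = a * pb" by (simp add: a algebra_simps)
        then have "h = 0" unfolding h b using a0 by simp
        then show ?thesis by (simp add: a0 b C_def)
      next
        case sub_in
        have a0: "0 < - a" "- a \<le> Am" using sub_in sb_le by (auto simp: subsonic_inflow_def a_def)
        define us vs where "us = a * n1 - vt * n2" and "vs = a * n2 + vt * n1"
        have b: "b1 = \<rho>b * a" "b2 = \<rho>b * a * us + n1 * pb" "b3 = \<rho>b * a * vs + n2 * pb"
          "b4 = a * (1/2 * \<rho>b * (a\<^sup>2 + vt\<^sup>2) + pb * c / R + pb)"
          using bf sub_in R c by (auto simp: boundary_flux_def flux_subsonic_inflow_def Let_def n an folds pb_def \<rho>b_def vt_def us_def vs_def gam)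
        have "r = \<rho>b" using b1 b a0 by simp
        have us: "us\<^sup>2 + vs\<^sup>2 = a\<^sup>2 + vt\<^sup>2"
        proof -
          have "us\<^sup>2 + vs\<^sup>2 = (a\<^sup>2 + vt\<^sup>2) * (n1\<^sup>2 + n2\<^sup>2)" by (simp add: us_def vs_def power2_eq_square algebra_simps)
          then show ?thesis by (simp add: nn)
        qed
        have "h = a * (c * \<rho>b * T' - pb * c / R) - 1/2 * \<rho>b * a * ((u - us)\<^sup>2 + (v - vs)\<^sup>2)"
          unfolding h b us[symmetric] E \<open>r = \<rho>b\<close> by (simp add: a power2_eq_square algebra_simps add_divide_distrib)
        moreover have "1/2 * \<rho>b * a * ((u - us)\<^sup>2 + (v - vs)\<^sup>2) \<le> 0"
          using a0 \<rho>b0 by (intro mult_nonpos_nonneg mult_nonneg_nonpos) auto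
        ultimately have h1: "- (- a * (c * \<rho>b * T')) + - a * (pb * c / R) \<le> h" by (simp add: algebra_simps)
        have "- C3 \<le> h / T' + \<rho>b * (c * ln T' - R * ln \<rho>b) * - a
          - K * (\<rho>b * - a + - a * (1/2 * \<rho>b * ((- a)\<^sup>2 + vt\<^sup>2) + pb * c / R + pb))"
          unfolding C3_def
          by (rule subsonic_inflow_entropy_bound[OF _ R c \<open>0 < \<epsilon>\<close> K0 a0 Bb h1]) (use T in \<open>simp add: folds\<close>)
        also have "\<dots> = h / T' - r * (c * ln T' - R * ln r) * a + K * (b1 + b4)"
          unfolding b \<open>r = \<rho>b\<close> by (simp add: algebra_simps)
        finally show ?thesis unfolding C_def by linarith
      next
        case sup_in
        define ub vb ab where "ub = u_b B" and "vb = v_b B" and "ab = - normal_vel_b B n"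
        have a0: "a < 0" "sound_b G B < - a" using sup_in by (auto simp: supersonic_inflow_def a_def)
        have ab: "0 < ab" "sound_b G B < ab" using sup[OF sup_in] by (auto simp: ab_def)
        have ab_eq: "ab = - (ub * n1 + vb * n2)" by (simp add: ab_def normal_vel_b_def n ub_def vb_def)
        have uv: "\<bar>ub\<bar> \<le> M" "\<bar>vb\<bar> \<le> M" using B by (auto simp: bvals_ok_def ub_def vb_def)
        have Vb: "ub\<^sup>2 + vb\<^sup>2 \<le> 2 * M\<^sup>2"
          using uv power_mono[of "\<bar>ub\<bar>" M 2] power_mono[of "\<bar>vb\<bar>" M 2] by simp
        have abM: "ab \<le> 2 * M"
        proof -
          have "n1\<^sup>2 \<le> 1\<^sup>2" "n2\<^sup>2 \<le> 1\<^sup>2" 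
            using nn zero_le_power2[of n1] zero_le_power2[of n2] unfolding power_one by linarith+
          then have "\<bar>n1\<bar> \<le> 1" "\<bar>n2\<bar> \<le> 1" using abs_le_square_iff[of n1 1] abs_le_square_iff[of n2 1] by auto
          then have "\<bar>ub * n1\<bar> \<le> M * 1" "\<bar>vb * n2\<bar> \<le> M * 1" using uv by (intro abs_mult_le; simp)+
          then show ?thesis unfolding ab_eq by linarith
        qed
        have b: "b1 = - (\<rho>b * ab)" "b2 = - (\<rho>b * ab) * ub + n1 * pb" "b3 = - (\<rho>b * ab) * vb + n2 * pb"
          "b4 = - ab * (1/2 * \<rho>b * (ub\<^sup>2 + vb\<^sup>2) + pb * c / R + pb)"
          using bf sup_in R c by (auto simp: boundary_flux_def flux_supersonic_inflow_def Let_def n folds pb_def \<rho>b_def ub_def vb_def ab_def gam)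
        have m: "r * - a = \<rho>b * ab" using b1 b by simp
        have "h = - (\<rho>b * ab * c * T') + 1/2 * (\<rho>b * ab) * ((u - ub)\<^sup>2 + (v - vb)\<^sup>2) + pb * (ab + a) + ab * (pb * c / R)"
        proof -
          have ra: "r * a = - (\<rho>b * ab)" using m by simp
          have "a * (E - r * (u\<^sup>2 + v\<^sup>2)) = (r * a) * (c * T' - 1/2 * (u\<^sup>2 + v\<^sup>2))" unfolding E by (simp add: algebra_simps)
          then have "a * (E - r * (u\<^sup>2 + v\<^sup>2)) = - (\<rho>b * ab) * (c * T' - 1/2 * (u\<^sup>2 + v\<^sup>2))" unfolding ra .
          moreover have "u * (n1 * pb) + v * (n2 * pb) = a * pb" by (simp add: a algebra_simps)
          ultimately show ?thesis unfolding h b by (simp add: power2_eq_square algebra_simps add_divide_distrib)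
        qed
        moreover have "(- a - ab)\<^sup>2 \<le> (u - ub)\<^sup>2 + (v - vb)\<^sup>2"
        proof -
          have "(u - ub)\<^sup>2 + (v - vb)\<^sup>2 = ((u - ub)\<^sup>2 + (v - vb)\<^sup>2) * (n1\<^sup>2 + n2\<^sup>2)" by (simp add: nn)
          also have "\<dots> = (- a - ab)\<^sup>2 + ((u - ub) * n2 - (v - vb) * n1)\<^sup>2"
            by (simp add: a ab_eq power2_eq_square algebra_simps)
          finally show ?thesis by simp
        qed
        then have "1/2 * (\<rho>b * ab) * (- a - ab)\<^sup>2 \<le> 1/2 * (\<rho>b * ab) * ((u - ub)\<^sup>2 + (v - vb)\<^sup>2)"
          using ab \<rho>b0 by (intro mult_left_mono) auto
        ultimately have h1: "- (\<rho>b * ab * c * T') + 1/2 * (\<rho>b * ab) * (- a - ab)\<^sup>2 + pb * (ab - - a) + ab * (pb * c / R) \<le> h"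
          by simp
        have ab2: "(1 + R / c) * (pb / \<rho>b) \<le> ab\<^sup>2"
        proof -
          have nn': "0 \<le> gam G * pb / \<rho>b" using gam0 pb0 \<rho>b0 by simp
          have "(sqrt (gam G * pb / \<rho>b))\<^sup>2 \<le> ab\<^sup>2" using ab sb nn' by (intro power_mono) auto
          then show ?thesis using nn' by (simp add: gam)
        qed
        have "- C4 \<le> h / T' + \<rho>b * ab * (c * ln T' - R * ln r) - K * (\<rho>b * ab + ab * (1/2 * \<rho>b * (ub\<^sup>2 + vb\<^sup>2) + pb * c / R + pb))"
          unfolding C4_def
          by (rule supersonic_inflow_entropy_bound[OF _ R c \<open>0 < \<epsilon>\<close> K0 am _ _ m refl ab(1) abM ab2 Bb(1-5) _ Vb h1])
            (use T \<rho> a0 sb_ge in \<open>auto simp: folds\<close>)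
        also have "\<rho>b * ab * (c * ln T' - R * ln r) = - (r * (c * ln T' - R * ln r) * a)"
          unfolding m[symmetric] by simp
        finally have "- C4 \<le> h / T' - r * (c * ln T' - R * ln r) * a + K * (b1 + b4)"
          unfolding b by (simp add: algebra_simps)
        then show ?thesis unfolding C_def by linarith
      qed
    qed
    then show "- C \<le> h / temperature G q - dens q * spec_entropy G q * normal_vel q n + K * (b1 + b4)"
      unfolding spec_entropy_def folds .
  qed
qed

section \<open>Calculus of gradients and the entropy identity\<close>

lemma C1_on_const: "C1_on W (\<lambda>_. c) (\<lambda>_. 0)"
  by (simp add: C1_on_def GDERIV_const)

lemma C1_on_add: "C1_on W f gf \<Longrightarrow> C1_on W k gk \<Longrightarrow> C1_on W (\<lambda>z. f z + k z) (\<lambda>z. gf z + gk z)"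
  unfolding C1_on_def by (auto intro!: continuous_intros GDERIV_add)

lemma C1_on_diff: "C1_on W f gf \<Longrightarrow> C1_on W k gk \<Longrightarrow> C1_on W (\<lambda>z. f z - k z) (\<lambda>z. gf z - gk z)"
  unfolding C1_on_def by (auto intro!: continuous_intros GDERIV_diff)

lemma C1_on_mult: "C1_on W f gf \<Longrightarrow> C1_on W k gk \<Longrightarrow> C1_on W (\<lambda>z. f z * k z) (\<lambda>z. f z *\<^sub>R gk z + k z *\<^sub>R gf z)"
  using C1_on_continuous[of W f gf] C1_on_continuous[of W k gk]
  unfolding C1_on_def by (auto intro!: continuous_intros GDERIV_mult)

lemma C1_on_cmult: "C1_on W f gf \<Longrightarrow> C1_on W (\<lambda>z. c * f z) (\<lambda>z. c *\<^sub>R gf z)"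
  using C1_on_mult[OF C1_on_const[of W c], of f gf] by simp

lemma C1_on_divide:
  assumes "C1_on W f gf" "C1_on W k gk" "\<forall>z\<in>W. k z \<noteq> 0"
  shows "C1_on W (\<lambda>z. f z / k z) (\<lambda>z. (1 / k z) *\<^sub>R (gf z - (f z / k z) *\<^sub>R gk z))"
  unfolding C1_on_def
proof (intro conjI ballI)
  have "continuous_on W f" "continuous_on W k" "continuous_on W gf" "continuous_on W gk"
    using assms C1_on_continuous by (auto simp: C1_on_def)
  then show "continuous_on W (\<lambda>z. (1 / k z) *\<^sub>R (gf z - (f z / k z) *\<^sub>R gk z))"
    using assms(3) by (intro continuous_intros) auto
  fix z assume z: "z \<in> W"
  have "GDERIV (\<lambda>z. f z * inverse (k z)) z :> f z *\<^sub>R (- (inverse (k z))\<^sup>2 *\<^sub>R gk z) + inverse (k z) *\<^sub>R gf z"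
    using assms z by (intro GDERIV_mult GDERIV_inverse) (auto simp: C1_on_def)
  then show "GDERIV (\<lambda>z. f z / k z) z :> (1 / k z) *\<^sub>R (gf z - (f z / k z) *\<^sub>R gk z)"
    unfolding divide_inverse[symmetric]
    by (rule GDERIV_subst) (simp add: power2_eq_square divide_inverse scaleR_diff_right)
qed

lemma C1_on_ln:
  assumes "C1_on W f gf" "\<forall>z\<in>W. 0 < f z"
  shows "C1_on W (\<lambda>z. ln (f z)) (\<lambda>z. (1 / f z) *\<^sub>R gf z)"
  unfolding C1_on_def
proof (intro conjI ballI)
  have c: "continuous_on W f" "continuous_on W gf" using assms C1_on_continuous by (auto simp: C1_on_def)
  have "f z \<noteq> 0" if "z \<in> W" for z using bspec[OF assms(2) that] by simp
  with c show "continuous_on W (\<lambda>z. (1 / f z) *\<^sub>R gf z)" by (intro continuous_intros) auto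
  fix z assume z: "z \<in> W"
  have "DERIV ln (f z) :> 1 / f z" using DERIV_ln_divide[OF bspec[OF assms(2) z]] .
  then show "GDERIV (\<lambda>z. ln (f z)) z :> (1 / f z) *\<^sub>R gf z"
    using assms(1) z by (intro GDERIV_DERIV_compose) (auto simp: C1_on_def)
qed

text \<open>Subtracting \<open>u\<close> and \<open>v\<close> times the momentum equations and a multiple of the mass equation from the energy
  equation gives the heat equation \<open>c\<^sub>v \<rho> DT/Dt = - p div v + \<kappa> \<Delta>T + \<Phi>\<close>. Divided by \<open>T\<close>, it shows that the
  expression equals \<open>- \<Phi> / T - \<kappa> |\<nabla>T|\<^sup>2 / T\<^sup>2\<close>. Subscripts such as \<open>xx_x\<close> are derivatives of stress components,
  treated as independent numbers.\<close>

lemma entropy_balance_identity: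
  fixes r u v T rt ut vt Tt rx ry ux uy vx vy Tx Ty Txx Tyy xx_x xy_y xy_x yy_y xx xy yy R cv \<kappa> \<mu> K :: real
  assumes pos: "0 < r" "0 < T" "0 < \<mu>" "0 < \<kappa>"
    and xx: "xx = 4/3 * \<mu> * ux - 2/3 * \<mu> * vy" and xy: "xy = \<mu> * (uy + vx)" and yy: "yy = 4/3 * \<mu> * vy - 2/3 * \<mu> * ux"
    and mass: "rt + (rx * u + r * ux) + (ry * v + r * vy) = 0"
    and momx: "(rt * u + r * ut) + (rx * u * u + 2 * r * u * ux + R * (rx * T + r * Tx)) + (ry * u * v + r * uy * v + r * u * vy) = xx_x + xy_y"
    and momy: "(rt * v + r * vt) + (rx * u * v + r * ux * v + r * u * vx) + (ry * v * v + 2 * r * v * vy + R * (ry * T + r * Ty)) = xy_x + yy_y"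
    and energy: "(cv * (rt * T + r * Tt) + 1/2 * rt * (u * u + v * v) + r * (u * ut + v * vt))
       + (ux * ((cv + R) * (r * T) + 1/2 * r * (u * u + v * v)) + u * ((cv + R) * (rx * T + r * Tx) + 1/2 * rx * (u * u + v * v) + r * (u * ux + v * vx)))
       + (vy * ((cv + R) * (r * T) + 1/2 * r * (u * u + v * v)) + v * ((cv + R) * (ry * T + r * Ty) + 1/2 * ry * (u * u + v * v) + r * (u * uy + v * vy)))
      = (ux * xx + u * xx_x + vx * xy + v * xy_x + \<kappa> * Txx) + (uy * xy + u * xy_y + vy * yy + v * yy_y + \<kappa> * Tyy)"
  shows "R * rt * (ln r + 1) - cv * rt * ln T - cv * r * Tt / T
     - ((rx * u + r * ux) * (cv * ln T - R * ln r) + r * u * (cv * Tx / T - R * rx / r))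
     - ((ry * v + r * vy) * (cv * ln T - R * ln r) + r * v * (cv * Ty / T - R * ry / r))
     + \<kappa> * (Txx / T - Tx * Tx / (T * T)) + \<kappa> * (Tyy / T - Ty * Ty / (T * T)) \<le> 0"
proof -
  define \<Phi> where "\<Phi> = ux * xx + (vx + uy) * xy + vy * yy"
  have "\<Phi> = \<mu> * ((ux - vy)\<^sup>2 + 1/3 * (ux + vy)\<^sup>2 + (vx + uy)\<^sup>2)"
    unfolding \<Phi>_def xx xy yy by (simp add: power2_eq_square algebra_simps)
  then have \<Phi>: "0 \<le> \<Phi>" using pos by simp
  have heat: "cv * r * (Tt + u * Tx + v * Ty) = - (R * r * T) * (ux + vy) + \<kappa> * (Txx + Tyy) + \<Phi>"
  proof -
    have "cv * r * (Tt + u * Tx + v * Ty) + (R * r * T) * (ux + vy) - \<kappa> * (Txx + Tyy) - \<Phi>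
      = (((cv * (rt * T + r * Tt) + 1/2 * rt * (u * u + v * v) + r * (u * ut + v * vt))
       + (ux * ((cv + R) * (r * T) + 1/2 * r * (u * u + v * v)) + u * ((cv + R) * (rx * T + r * Tx) + 1/2 * rx * (u * u + v * v) + r * (u * ux + v * vx)))
       + (vy * ((cv + R) * (r * T) + 1/2 * r * (u * u + v * v)) + v * ((cv + R) * (ry * T + r * Ty) + 1/2 * ry * (u * u + v * v) + r * (u * uy + v * vy))))
      - ((ux * xx + u * xx_x + vx * xy + v * xy_x + \<kappa> * Txx) + (uy * xy + u * xy_y + vy * yy + v * yy_y + \<kappa> * Tyy)))
      - u * (((rt * u + r * ut) + (rx * u * u + 2 * r * u * ux + R * (rx * T + r * Tx)) + (ry * u * v + r * uy * v + r * u * vy)) - (xx_x + xy_y))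
      - v * (((rt * v + r * vt) + (rx * u * v + r * ux * v + r * u * vx) + (ry * v * v + 2 * r * v * vy + R * (ry * T + r * Ty))) - (xy_x + yy_y))
      + (1/2 * (u * u + v * v) - cv * T) * (rt + (rx * u + r * ux) + (ry * v + r * vy))"
      unfolding \<Phi>_def by (simp add: algebra_simps add_divide_distrib)
    also have "\<dots> = 0" unfolding mass momx momy energy by simp
    finally show ?thesis by simp
  qed
  \<comment> \<open>with \<open>rt\<close> eliminated, all logarithms cancel\<close>
  have rt: "rt = - (rx * u + r * ux) - (ry * v + r * vy)" using mass by simp
  have "R * rt * (ln r + 1) - cv * rt * ln T - cv * r * Tt / T
     - ((rx * u + r * ux) * (cv * ln T - R * ln r) + r * u * (cv * Tx / T - R * rx / r))
     - ((ry * v + r * vy) * (cv * ln T - R * ln r) + r * v * (cv * Ty / T - R * ry / r))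
     = - (R * r) * (ux + vy) - (cv * r * (Tt + u * Tx + v * Ty)) / T"
    unfolding rt using pos by (simp add: field_simps)
  also have "\<dots> = - \<kappa> * (Txx + Tyy) / T - \<Phi> / T"
    unfolding heat using pos by (simp add: field_simps)
  finally have "R * rt * (ln r + 1) - cv * rt * ln T - cv * r * Tt / T
     - ((rx * u + r * ux) * (cv * ln T - R * ln r) + r * u * (cv * Tx / T - R * rx / r))
     - ((ry * v + r * vy) * (cv * ln T - R * ln r) + r * v * (cv * Ty / T - R * ry / r))
     + \<kappa> * (Txx / T - Tx * Tx / (T * T)) + \<kappa> * (Tyy / T - Ty * Ty / (T * T))
     = - \<Phi> / T - \<kappa> * ((Tx * Tx + Ty * Ty) / (T * T))"
    by (simp add: diff_divide_distrib add_divide_distrib algebra_simps)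
  also have "\<dots> \<le> 0"
  proof -
    have "0 \<le> \<Phi> / T" using \<Phi> pos by simp
    moreover have "0 \<le> \<kappa> * ((Tx * Tx + Ty * Ty) / (T * T))" using pos by simp
    ultimately show ?thesis by simp
  qed
  finally show ?thesis .
qed

section \<open>Rates of change of the primitive variables\<close>

text \<open>The rate of change of the velocity when the state \<open>q\<close> changes at the rate \<open>d\<close>. The same
  formulas give time derivatives and both spatial derivatives, and they make sense on the boundary.\<close>

definition velx_rate :: "state \<Rightarrow> state \<Rightarrow> real" where
  "velx_rate q d = (fst (snd d) - velx q * fst d) / dens q"

definition vely_rate :: "state \<Rightarrow> state \<Rightarrow> real" where
  "vely_rate q d = (fst (snd (snd d)) - vely q * fst d) / dens q"

definition temp_rate :: "gas \<Rightarrow> state \<Rightarrow> state \<Rightarrow> real" where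
  "temp_rate G q d = ((snd (snd (snd d)) - energy q / dens q * fst d) / dens q
     - velx q * velx_rate q d - vely q * vely_rate q d) / cv G"

definition lyapunov_rate :: "gas \<Rightarrow> real \<Rightarrow> state \<Rightarrow> state \<Rightarrow> real" where
  "lyapunov_rate G K q d = K * (fst d + snd (snd (snd d))) + gas_const G * fst d * (ln (dens q) + 1)
     - cv G * fst d * ln (temperature G q) - cv G * dens q * temp_rate G q d / temperature G q"

lemma temperature_eq:
  assumes "gas_ok G" "dens q \<noteq> 0"
  shows "temperature G q = (energy q / dens q - 1/2 * (velx q * velx q + vely q * vely q)) / cv G"
  using gas_okD(1,2)[OF assms(1)] assms(2)
  unfolding temperature_def pressure_def gas_okD(3)[OF assms(1)]
  by (simp add: power2_eq_square field_simps)

lemma state_has_derivative: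
  assumes "(f has_derivative f') (at x within S)"
  shows "((\<lambda>y. dens (f y)) has_derivative (\<lambda>h. fst (f' h))) (at x within S)"
    "((\<lambda>y. fst (snd (f y))) has_derivative (\<lambda>h. fst (snd (f' h)))) (at x within S)"
    "((\<lambda>y. fst (snd (snd (f y)))) has_derivative (\<lambda>h. fst (snd (snd (f' h))))) (at x within S)"
    "((\<lambda>y. energy (f y)) has_derivative (\<lambda>h. snd (snd (snd (f' h))))) (at x within S)"
  unfolding state_components by (intro has_derivative_fst has_derivative_snd assms)+

lemma velocity_has_derivative:
  assumes f: "(f has_derivative f') (at x within S)" and nz: "dens (f x) \<noteq> 0"
  shows "((\<lambda>y. velx (f y)) has_derivative (\<lambda>h. velx_rate (f x) (f' h))) (at x within S)"
    "((\<lambda>y. vely (f y)) has_derivative (\<lambda>h. vely_rate (f x) (f' h))) (at x within S)"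
proof -
  have eq: "velx q = fst (snd q) / dens q" "vely q = fst (snd (snd q)) / dens q" for q
    by (simp_all add: state_components)
  show "((\<lambda>y. velx (f y)) has_derivative (\<lambda>h. velx_rate (f x) (f' h))) (at x within S)"
    unfolding eq velx_rate_def
    by (rule has_derivative_eq_rhs[OF has_derivative_divide'[OF state_has_derivative(2)[OF f] state_has_derivative(1)[OF f] nz]])
       (use nz in \<open>simp add: fun_eq_iff field_simps\<close>)
  show "((\<lambda>y. vely (f y)) has_derivative (\<lambda>h. vely_rate (f x) (f' h))) (at x within S)"
    unfolding eq vely_rate_def
    by (rule has_derivative_eq_rhs[OF has_derivative_divide'[OF state_has_derivative(3)[OF f] state_has_derivative(1)[OF f] nz]])
       (use nz in \<open>simp add: fun_eq_iff field_simps\<close>)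
qed

lemma temperature_has_derivative:
  assumes f: "(f has_derivative f') (at x within S)" and G: "gas_ok G" and x: "x \<in> S"
    and nz: "\<And>y. y \<in> S \<Longrightarrow> dens (f y) \<noteq> 0"
  shows "((\<lambda>y. temperature G (f y)) has_derivative (\<lambda>h. temp_rate G (f x) (f' h))) (at x within S)"
proof -
  note d = state_has_derivative[OF f] velocity_has_derivative[OF f nz[OF x]]
  have "((\<lambda>y. (energy (f y) / dens (f y) - 1/2 * (velx (f y) * velx (f y) + vely (f y) * vely (f y))) / cv G)
     has_derivative (\<lambda>h. temp_rate G (f x) (f' h))) (at x within S)"
    unfolding temp_rate_def
    by (rule has_derivative_eq_rhs[OF bounded_linear.has_derivative[OF bounded_linear_divide has_derivative_diff[OF has_derivative_divide'[OF d(4,1) nz[OF x]]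
         has_derivative_mult_right[OF has_derivative_add[OF has_derivative_mult[OF d(5,5)] has_derivative_mult[OF d(6,6)]]]]]])
       (use nz[OF x] gas_okD(2)[OF G] in \<open>simp add: fun_eq_iff field_simps\<close>)
  then show ?thesis
    by (rule has_derivative_transform[OF x, rotated]) (simp add: temperature_eq[OF G nz])
qed

lemma lyapunov_has_derivative:
  assumes f: "(f has_derivative f') (at x within S)" and G: "gas_ok G" and x: "x \<in> S"
    and pos: "\<And>y. y \<in> S \<Longrightarrow> 0 < dens (f y)" "\<And>y. y \<in> S \<Longrightarrow> 0 < temperature G (f y)"
  shows "((\<lambda>y. lyapunov G K (f y)) has_derivative (\<lambda>h. lyapunov_rate G K (f x) (f' h))) (at x within S)"
proof -
  have nz: "dens (f y) \<noteq> 0" if "y \<in> S" for y using pos(1)[OF that] by simp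
  note d = state_has_derivative[OF f] temperature_has_derivative[OF f G x nz]
  note l = has_derivative_ln[OF pos(2)[OF x] d(5)] has_derivative_ln[OF pos(1)[OF x] d(1)]
  show ?thesis
    unfolding lyapunov_def spec_entropy_def lyapunov_rate_def
    by (rule has_derivative_eq_rhs[OF has_derivative_diff[OF has_derivative_mult_right[OF has_derivative_add[OF d(1,4)]]
        has_derivative_mult[OF d(1) has_derivative_diff[OF has_derivative_mult_right[OF l(1)] has_derivative_mult_right[OF l(2)]]]]])
      (assumption, rule ext, use pos[OF x] in \<open>simp add: field_simps\<close>)
qed

lemma primitive_continuous:
  assumes q: "continuous_on P q" and nz: "\<And>p. p \<in> P \<Longrightarrow> dens (q p) \<noteq> 0"
  shows "continuous_on P (\<lambda>p. dens (q p))" "continuous_on P (\<lambda>p. velx (q p))"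
    "continuous_on P (\<lambda>p. vely (q p))" "continuous_on P (\<lambda>p. energy (q p))"
  using nz unfolding state_components by (auto intro!: continuous_intros q)

lemma temperature_continuous:
  assumes q: "continuous_on P q" and nz: "\<And>p. p \<in> P \<Longrightarrow> dens (q p) \<noteq> 0" and G: "gas_ok G"
  shows "continuous_on P (\<lambda>p. temperature G (q p))"
proof (rule continuous_on_eq)
  show "continuous_on P (\<lambda>p. (energy (q p) / dens (q p) - 1/2 * (velx (q p) * velx (q p) + vely (q p) * vely (q p))) / cv G)"
    using nz gas_okD(2)[OF G] by (intro continuous_intros primitive_continuous q) auto
qed (simp add: temperature_eq[OF G nz])

lemma rate_continuous:
  assumes q: "continuous_on P q" and nz: "\<And>p. p \<in> P \<Longrightarrow> dens (q p) \<noteq> 0" and G: "gas_ok G"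
    and d: "continuous_on P d"
  shows "continuous_on P (\<lambda>p. velx_rate (q p) (d p))" "continuous_on P (\<lambda>p. vely_rate (q p) (d p))"
    "continuous_on P (\<lambda>p. temp_rate G (q p) (d p))"
proof -
  note c = primitive_continuous[OF q nz]
  show *: "continuous_on P (\<lambda>p. velx_rate (q p) (d p))" "continuous_on P (\<lambda>p. vely_rate (q p) (d p))"
    using nz unfolding velx_rate_def vely_rate_def by (intro continuous_intros c d; auto)+
  show "continuous_on P (\<lambda>p. temp_rate G (q p) (d p))"
    using nz gas_okD(2)[OF G] unfolding temp_rate_def by (intro continuous_intros c d *; auto)
qed

lemma has_derivative_imp_GDERIV:
  fixes f :: "point \<Rightarrow> real"
  assumes "(f has_derivative f') (at z)"
  shows "GDERIV f z :> (f' (1, 0), f' (0, 1))"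
proof -
  interpret bounded_linear f' using assms by (rule has_derivative_bounded_linear)
  have "f' h = h \<bullet> (f' (1, 0), f' (0, 1))" for h
  proof -
    have "h = fst h *\<^sub>R (1, 0) + snd h *\<^sub>R (0, 1)" by (simp add: prod_eq_iff)
    then have "f' h = f' (fst h *\<^sub>R (1, 0) + snd h *\<^sub>R (0, 1))" by simp
    also have "\<dots> = fst h * f' (1, 0) + snd h * f' (0, 1)" unfolding add scaleR by simp
    finally show ?thesis by (simp add: inner_prod_def)
  qed
  then have "f' = (\<lambda>h. h \<bullet> (f' (1, 0), f' (0, 1)))" by blast
  with assms show ?thesis unfolding gderiv_def by simp
qed

lemma pderiv_ext_interior:
  assumes "(f has_derivative f') (at x)" "x \<in> \<Omega>"
  shows "pderiv_ext \<Omega> i f x = f' i"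
  using frechet_derivative_at[OF assms(1)] assms(2) by (simp add: pderiv_ext_def)

lemma C1_on_linear:
  assumes L: "bounded_linear L" and f: "\<And>x. x \<in> \<Omega> \<Longrightarrow> f differentiable (at x)"
    and c: "continuous_on \<Omega> (dx \<Omega> f)" "continuous_on \<Omega> (dy \<Omega> f)"
  shows "C1_on \<Omega> (\<lambda>x. L (f x)) (\<lambda>x. (L (dx \<Omega> f x), L (dy \<Omega> f x)))"
  unfolding C1_on_def
proof (intro conjI ballI)
  show "continuous_on \<Omega> (\<lambda>x. (L (dx \<Omega> f x), L (dy \<Omega> f x)))"
    by (intro continuous_on_Pair bounded_linear.continuous_on[OF L] c)
  fix x assume x: "x \<in> \<Omega>"
  have "(f has_derivative frechet_derivative f (at x)) (at x)" using f[OF x] by (simp add: frechet_derivative_works)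
  from has_derivative_imp_GDERIV[OF bounded_linear.has_derivative[OF L this]]
  show "GDERIV (\<lambda>x. L (f x)) x :> (L (dx \<Omega> f x), L (dy \<Omega> f x))"
    using x by (simp add: pderiv_ext_def)
qed

text \<open>A gradient that is continuous up to the boundary has its own values as boundary limits.\<close>

lemma pderiv_ext_C1:
  assumes "open \<Omega>" and f: "C1_on \<Omega> f g" and c: "continuous_on (closure \<Omega>) g" and x: "x \<in> closure \<Omega>"
  shows "pderiv_ext \<Omega> i f x = i \<bullet> g x"
proof -
  have in_\<Omega>: "frechet_derivative f (at y) i = i \<bullet> g y" if "y \<in> \<Omega>" for y
  proof -
    have "(f has_derivative (\<lambda>h. h \<bullet> g y)) (at y)" using f that by (auto simp: C1_on_def gderiv_def)
    from frechet_derivative_at[OF this] show ?thesis by metis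
  qed
  show ?thesis
  proof (cases "x \<in> \<Omega>")
    case False
    then have "x islimpt \<Omega>" using x by (simp add: closure_def)
    then have nt: "\<not> trivial_limit (at x within \<Omega>)" by (simp add: trivial_limit_within)
    have "(g \<longlongrightarrow> g x) (at x within \<Omega>)"
      using c x closure_subset[of \<Omega>] unfolding continuous_on_def by (blast intro: tendsto_within_subset)
    then have "((\<lambda>y. i \<bullet> g y) \<longlongrightarrow> i \<bullet> g x) (at x within \<Omega>)" by (intro tendsto_intros)
    then have "((\<lambda>y. frechet_derivative f (at y) i) \<longlongrightarrow> i \<bullet> g x) (at x within \<Omega>)"
      by (rule Lim_transform_within[OF _ zero_less_one]) (simp add: in_\<Omega>)
    then show ?thesis using False tendsto_Lim[OF nt] by (simp add: pderiv_ext_def)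
  qed (simp add: pderiv_ext_def in_\<Omega>)
qed

lemma pderiv_ext_tuple:
  assumes "open \<Omega>" "x \<in> \<Omega>" and C: "C1_on \<Omega> f1 g1" "C1_on \<Omega> f2 g2" "C1_on \<Omega> f3 g3" "C1_on \<Omega> f4 g4"
    and F: "\<forall>y\<in>\<Omega>. F y = (f1 y, f2 y, f3 y, f4 y)"
  shows "pderiv_ext \<Omega> i F x = (i \<bullet> g1 x, i \<bullet> g2 x, i \<bullet> g3 x, i \<bullet> g4 x)"
proof (rule pderiv_ext_interior)
  have "((\<lambda>y. (f1 y, f2 y, f3 y, f4 y)) has_derivative (\<lambda>i. (i \<bullet> g1 x, i \<bullet> g2 x, i \<bullet> g3 x, i \<bullet> g4 x))) (at x)"
    using C assms(2) by (intro has_derivative_Pair) (auto simp: C1_on_def gderiv_def)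
  then show "(F has_derivative (\<lambda>i. (i \<bullet> g1 x, i \<bullet> g2 x, i \<bullet> g3 x, i \<bullet> g4 x))) (at x)"
    by (rule has_derivative_transform_within_open[OF _ assms(1,2)]) (simp add: F)
qed fact

lemma bounded_linear_components:
  "bounded_linear (\<lambda>q::state. fst q)" "bounded_linear (\<lambda>q::state. fst (snd q))"
  "bounded_linear (\<lambda>q::state. fst (snd (snd q)))" "bounded_linear (\<lambda>q::state. snd (snd (snd q)))"
  by (intro bounded_linear_fst bounded_linear_fst_comp bounded_linear_snd_comp bounded_linear_ident bounded_linear_snd)+

section \<open>Smooth states\<close>

locale smooth_state =
  fixes G :: gas and \<Omega> :: "point set" and s :: "point \<Rightarrow> state"
  assumes gas: "gas_ok G" and open_\<Omega>: "open \<Omega>"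
    and cont: "continuous_on (closure \<Omega>) s"
    and diff: "\<And>x. x \<in> \<Omega> \<Longrightarrow> s differentiable (at x)"
    and grad_cont: "continuous_on (closure \<Omega>) (dx \<Omega> s)" "continuous_on (closure \<Omega>) (dy \<Omega> s)"
    and diff2: "\<And>x. x \<in> \<Omega> \<Longrightarrow> dx \<Omega> s differentiable (at x)" "\<And>x. x \<in> \<Omega> \<Longrightarrow> dy \<Omega> s differentiable (at x)"
    and hess_cont: "continuous_on \<Omega> (dx \<Omega> (dx \<Omega> s))" "continuous_on \<Omega> (dy \<Omega> (dx \<Omega> s))"
      "continuous_on \<Omega> (dx \<Omega> (dy \<Omega> s))" "continuous_on \<Omega> (dy \<Omega> (dy \<Omega> s))"
    and pos: "\<And>x. x \<in> closure \<Omega> \<Longrightarrow> 0 < dens (s x)" "\<And>x. x \<in> closure \<Omega> \<Longrightarrow> 0 < temperature G (s x)"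
begin

lemma in_closure: "x \<in> \<Omega> \<Longrightarrow> x \<in> closure \<Omega>" using closure_subset by (rule subsetD)

lemma nz: "x \<in> closure \<Omega> \<Longrightarrow> dens (s x) \<noteq> 0" "x \<in> closure \<Omega> \<Longrightarrow> temperature G (s x) \<noteq> 0"
  using pos[of x] by simp_all

lemma cv_nz: "cv G \<noteq> 0" using gas_okD(2)[OF gas] by simp

lemma rates_continuous:
  assumes "continuous_on (closure \<Omega>) d"
  shows "continuous_on (closure \<Omega>) (\<lambda>x. velx_rate (s x) (d x))" "continuous_on (closure \<Omega>) (\<lambda>x. vely_rate (s x) (d x))"
    "continuous_on (closure \<Omega>) (\<lambda>x. temp_rate G (s x) (d x))"
  by (rule rate_continuous[OF cont _ gas assms]; simp add: nz)+

abbreviation "X \<equiv> dx \<Omega> s"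
abbreviation "Y \<equiv> dy \<Omega> s"

lemma has_derivative_s: "x \<in> \<Omega> \<Longrightarrow> (s has_derivative frechet_derivative s (at x)) (at x)"
  "x \<in> \<Omega> \<Longrightarrow> frechet_derivative s (at x) (1, 0) = X x" "x \<in> \<Omega> \<Longrightarrow> frechet_derivative s (at x) (0, 1) = Y x"
  using diff by (simp_all add: frechet_derivative_works[symmetric] pderiv_ext_def)

lemma C1_primitive:
  "C1_on \<Omega> (\<lambda>x. dens (s x)) (\<lambda>x. (fst (X x), fst (Y x)))"
  "C1_on \<Omega> (\<lambda>x. velx (s x)) (\<lambda>x. (velx_rate (s x) (X x), velx_rate (s x) (Y x)))"
  "C1_on \<Omega> (\<lambda>x. vely (s x)) (\<lambda>x. (vely_rate (s x) (X x), vely_rate (s x) (Y x)))"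
  "C1_on \<Omega> (\<lambda>x. temperature G (s x)) (\<lambda>x. (temp_rate G (s x) (X x), temp_rate G (s x) (Y x)))"
proof -
  note sub = closure_subset[of \<Omega>]
  have XY: "continuous_on \<Omega> X" "continuous_on \<Omega> Y" using grad_cont sub by (auto intro: continuous_on_subset)
  show "C1_on \<Omega> (\<lambda>x. dens (s x)) (\<lambda>x. (fst (X x), fst (Y x)))"
    unfolding state_components by (rule C1_on_linear[OF bounded_linear_components(1) diff XY])
  show "C1_on \<Omega> (\<lambda>x. velx (s x)) (\<lambda>x. (velx_rate (s x) (X x), velx_rate (s x) (Y x)))"
    unfolding C1_on_def
  proof (intro conjI ballI)
    show "continuous_on \<Omega> (\<lambda>x. (velx_rate (s x) (X x), velx_rate (s x) (Y x)))"
      by (intro continuous_on_Pair continuous_on_subset[OF rates_continuous(1) sub] grad_cont)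
    fix x assume x: "x \<in> \<Omega>"
    from has_derivative_imp_GDERIV[OF velocity_has_derivative(1)[OF has_derivative_s(1)[OF x] nz(1)[OF in_closure[OF x]]]]
    show "GDERIV (\<lambda>x. velx (s x)) x :> (velx_rate (s x) (X x), velx_rate (s x) (Y x))"
      by (simp add: has_derivative_s x)
  qed
  show "C1_on \<Omega> (\<lambda>x. vely (s x)) (\<lambda>x. (vely_rate (s x) (X x), vely_rate (s x) (Y x)))"
    unfolding C1_on_def
  proof (intro conjI ballI)
    show "continuous_on \<Omega> (\<lambda>x. (vely_rate (s x) (X x), vely_rate (s x) (Y x)))"
      by (intro continuous_on_Pair continuous_on_subset[OF rates_continuous(2) sub] grad_cont)
    fix x assume x: "x \<in> \<Omega>"
    from has_derivative_imp_GDERIV[OF velocity_has_derivative(2)[OF has_derivative_s(1)[OF x] nz(1)[OF in_closure[OF x]]]]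
    show "GDERIV (\<lambda>x. vely (s x)) x :> (vely_rate (s x) (X x), vely_rate (s x) (Y x))"
      by (simp add: has_derivative_s x)
  qed
  show "C1_on \<Omega> (\<lambda>x. temperature G (s x)) (\<lambda>x. (temp_rate G (s x) (X x), temp_rate G (s x) (Y x)))"
    unfolding C1_on_def
  proof (intro conjI ballI)
    show "continuous_on \<Omega> (\<lambda>x. (temp_rate G (s x) (X x), temp_rate G (s x) (Y x)))"
      by (intro continuous_on_Pair continuous_on_subset[OF rates_continuous(3) sub] grad_cont)
    fix x assume x: "x \<in> \<Omega>"
    have "(s has_derivative frechet_derivative s (at x)) (at x within \<Omega>)"
      using has_derivative_s(1)[OF x] by (rule has_derivative_at_withinI)
    then have "((\<lambda>x. temperature G (s x)) has_derivative (\<lambda>h. temp_rate G (s x) (frechet_derivative s (at x) h))) (at x within \<Omega>)"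
      by (rule temperature_has_derivative[OF _ gas x]) (rule nz(1)[OF in_closure])
    then have "((\<lambda>x. temperature G (s x)) has_derivative (\<lambda>h. temp_rate G (s x) (frechet_derivative s (at x) h))) (at x)"
      using at_within_open[OF x open_\<Omega>] by simp
    from has_derivative_imp_GDERIV[OF this]
    show "GDERIV (\<lambda>x. temperature G (s x)) x :> (temp_rate G (s x) (X x), temp_rate G (s x) (Y x))"
      by (simp add: has_derivative_s x)
  qed
qed

lemma pderiv_primitive:
  assumes "x \<in> closure \<Omega>"
  shows "pderiv_ext \<Omega> i (\<lambda>x. velx (s x)) x = i \<bullet> (velx_rate (s x) (X x), velx_rate (s x) (Y x))"
    "pderiv_ext \<Omega> i (\<lambda>x. vely (s x)) x = i \<bullet> (vely_rate (s x) (X x), vely_rate (s x) (Y x))"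
    "pderiv_ext \<Omega> i (\<lambda>x. temperature G (s x)) x = i \<bullet> (temp_rate G (s x) (X x), temp_rate G (s x) (Y x))"
  by (rule pderiv_ext_C1[OF open_\<Omega> C1_primitive(2) _ assms] pderiv_ext_C1[OF open_\<Omega> C1_primitive(3) _ assms]
      pderiv_ext_C1[OF open_\<Omega> C1_primitive(4) _ assms]; intro continuous_on_Pair rates_continuous grad_cont)+

lemma C1_rates:
  assumes d: "\<And>x. x \<in> \<Omega> \<Longrightarrow> d differentiable (at x)" "continuous_on \<Omega> (dx \<Omega> d)" "continuous_on \<Omega> (dy \<Omega> d)"
  shows "\<exists>g. C1_on \<Omega> (\<lambda>x. velx_rate (s x) (d x)) g" "\<exists>g. C1_on \<Omega> (\<lambda>x. vely_rate (s x) (d x)) g"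
    "\<exists>g. C1_on \<Omega> (\<lambda>x. temp_rate G (s x) (d x)) g"
proof -
  have nz': "\<forall>x\<in>\<Omega>. dens (s x) \<noteq> 0" using nz(1)[OF in_closure] by blast
  have cv': "\<forall>x\<in>\<Omega>. cv G \<noteq> 0" using cv_nz by simp
  note L = bounded_linear_components[THEN C1_on_linear[OF _ d]]
  have "\<exists>g. C1_on \<Omega> (\<lambda>x. energy (s x)) g"
    unfolding state_components
    using C1_on_linear[OF bounded_linear_components(4) diff] continuous_on_subset[OF grad_cont(1) closure_subset]
      continuous_on_subset[OF grad_cont(2) closure_subset] by blast
  then obtain ge where ge: "C1_on \<Omega> (\<lambda>x. energy (s x)) ge" ..
  note u = C1_on_divide[OF C1_on_diff[OF L(2) C1_on_mult[OF C1_primitive(2) L(1)]] C1_primitive(1) nz', folded velx_rate_def]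
  note v = C1_on_divide[OF C1_on_diff[OF L(3) C1_on_mult[OF C1_primitive(3) L(1)]] C1_primitive(1) nz', folded vely_rate_def]
  note T = C1_on_divide[OF C1_on_diff[OF C1_on_diff[OF
      C1_on_divide[OF C1_on_diff[OF L(4) C1_on_mult[OF C1_on_divide[OF ge C1_primitive(1) nz'] L(1)]] C1_primitive(1) nz']
      C1_on_mult[OF C1_primitive(2) u]] C1_on_mult[OF C1_primitive(3) v]] C1_on_const cv', folded temp_rate_def]
  show "\<exists>g. C1_on \<Omega> (\<lambda>x. velx_rate (s x) (d x)) g" "\<exists>g. C1_on \<Omega> (\<lambda>x. vely_rate (s x) (d x)) g"
    "\<exists>g. C1_on \<Omega> (\<lambda>x. temp_rate G (s x) (d x)) g"
    by (rule exI, rule u v T; assumption)+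
qed

end

section \<open>The entropy balance of a smooth state\<close>

text \<open>The flux as an explicit function of the state and its two spatial derivatives, which shows its
  joint continuity in time and space and its differentiability.\<close>

definition lyapunov_flux_fun :: "gas \<Rightarrow> real \<Rightarrow> state \<Rightarrow> state \<Rightarrow> state \<Rightarrow> point" where
  "lyapunov_flux_fun G K q d1 d2 = (let r = dens q; u = velx q; v = vely q; T = temperature G q; R = gas_const G;
      ux = velx_rate q d1; uy = velx_rate q d2; vx = vely_rate q d1; vy = vely_rate q d2;
      xx = 4/3 * visc G * ux - 2/3 * visc G * vy; xy = visc G * (uy + vx); yy = 4/3 * visc G * vy - 2/3 * visc G * ux;
      H = (cv G + R) * (r * T) + 1/2 * r * (u * u + v * v); S = cv G * ln T - R * ln r;
      Tx = temp_rate G q d1; Ty = temp_rate G q d2 in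
    (K * (r * u + (u * H - (u * xx + v * xy + cond G * Tx))) - r * u * S + cond G * (Tx / T),
     K * (r * v + (v * H - (u * xy + v * yy + cond G * Ty))) - r * v * S + cond G * (Ty / T)))"

lemma rate_inverse:
  assumes G: "gas_ok G" and r: "0 < dens q"
  shows "fst (snd d) = fst d * velx q + dens q * velx_rate q d"
    "fst (snd (snd d)) = fst d * vely q + dens q * vely_rate q d"
    "snd (snd (snd d)) = cv G * (fst d * temperature G q + dens q * temp_rate G q d)
       + 1/2 * fst d * (velx q * velx q + vely q * vely q) + dens q * (velx q * velx_rate q d + vely q * vely_rate q d)"
proof -
  show 1: "fst (snd d) = fst d * velx q + dens q * velx_rate q d"
    "fst (snd (snd d)) = fst d * vely q + dens q * vely_rate q d"
    using r by (simp_all add: velx_rate_def vely_rate_def)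
  have c: "cv G \<noteq> 0" using gas_okD(2)[OF G] by simp
  have "energy q / dens q = cv G * temperature G q + 1/2 * (velx q * velx q + vely q * vely q)"
    using temperature_eq[OF G, of q] r c by (simp add: field_simps)
  then have t: "cv G * temp_rate G q d = (snd (snd (snd d)) - (cv G * temperature G q + 1/2 * (velx q * velx q + vely q * vely q)) * fst d) / dens q
     - velx q * velx_rate q d - vely q * vely_rate q d"
    using c by (simp add: temp_rate_def)
  have "dens q * (cv G * temp_rate G q d) = snd (snd (snd d)) - (cv G * temperature G q + 1/2 * (velx q * velx q + vely q * vely q)) * fst d
     - dens q * (velx q * velx_rate q d + vely q * vely_rate q d)"
    unfolding t using r by (simp add: field_simps)
  then show "snd (snd (snd d)) = cv G * (fst d * temperature G q + dens q * temp_rate G q d)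
       + 1/2 * fst d * (velx q * velx q + vely q * vely q) + dens q * (velx q * velx_rate q d + vely q * vely_rate q d)"
    by (simp add: algebra_simps)
qed

context smooth_state
begin

lemma stress_rates:
  assumes "x \<in> closure \<Omega>"
  shows "tau_xx G \<Omega> s x = 4/3 * visc G * velx_rate (s x) (X x) - 2/3 * visc G * vely_rate (s x) (Y x)"
    "tau_xy G \<Omega> s x = visc G * (velx_rate (s x) (Y x) + vely_rate (s x) (X x))"
    "tau_yy G \<Omega> s x = 4/3 * visc G * vely_rate (s x) (Y x) - 2/3 * visc G * velx_rate (s x) (X x)"
    "dx \<Omega> (\<lambda>y. temperature G (s y)) x = temp_rate G (s x) (X x)"
    "dy \<Omega> (\<lambda>y. temperature G (s y)) x = temp_rate G (s x) (Y x)"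
  unfolding tau_xx_def tau_xy_def tau_yy_def pderiv_primitive[OF assms] by (simp_all add: inner_prod_def)

lemma enthalpy: "x \<in> closure \<Omega> \<Longrightarrow> energy (s x) + pressure G (s x) = (cv G + gas_const G) * (dens (s x) * temperature G (s x))
    + 1/2 * dens (s x) * (velx (s x) * velx (s x) + vely (s x) * vely (s x))"
  using pressure_temperature[OF gas pos(1)] by (simp add: power2_eq_square algebra_simps)

lemma lyapunov_flux_eq:
  assumes "x \<in> closure \<Omega>"
  shows "lyapunov_flux G \<Omega> K s x = lyapunov_flux_fun G K (s x) (X x) (Y x)"
  unfolding lyapunov_flux_def lyapunov_flux_fun_def net_flux_x_def net_flux_y_def inv_flux_x_def inv_flux_y_def
    visc_flux_x_def visc_flux_y_def stress_rates[OF assms] enthalpy[OF assms] Let_def spec_entropy_def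
  by simp

text \<open>All gradients are built by the calculus of \<open>C1_on\<close> from those of the primitive variables and their
  first derivatives. The four components of the equations then become the hypotheses of the scalar
  identity, and the terms with factor \<open>K\<close> cancel by conservation of mass and energy.\<close>

lemma interior_balance:
  assumes NS: "\<And>x. x \<in> \<Omega> \<Longrightarrow> qt x + dx \<Omega> (\<lambda>y. inv_flux_x G (s y)) x + dy \<Omega> (\<lambda>y. inv_flux_y G (s y)) x
      = dx \<Omega> (visc_flux_x G \<Omega> s) x + dy \<Omega> (visc_flux_y G \<Omega> s) x"
  shows "\<exists>g1 g2. C1_on \<Omega> (\<lambda>x. fst (lyapunov_flux_fun G K (s x) (X x) (Y x))) g1 \<and>
    C1_on \<Omega> (\<lambda>x. snd (lyapunov_flux_fun G K (s x) (X x) (Y x))) g2 \<and>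
    (\<forall>x\<in>\<Omega>. lyapunov_rate G K (s x) (qt x) + fst (g1 x) + snd (g2 x) \<le> 0)"
proof -
  define r u v T where "r x = dens (s x)" and "u x = velx (s x)" and "v x = vely (s x)" and "T x = temperature G (s x)" for x
  define ux uy vx vy Tx Ty where "ux x = velx_rate (s x) (X x)" and "uy x = velx_rate (s x) (Y x)"
    and "vx x = vely_rate (s x) (X x)" and "vy x = vely_rate (s x) (Y x)"
    and "Tx x = temp_rate G (s x) (X x)" and "Ty x = temp_rate G (s x) (Y x)" for x
  define rx ry where "rx x = fst (X x)" and "ry x = fst (Y x)" for x
  define R c \<mu> \<kappa> where "R = gas_const G" and "c = cv G" and "\<mu> = visc G" and "\<kappa> = cond G"
  note folds = r_def[symmetric] u_def[symmetric] v_def[symmetric] T_def[symmetric] ux_def[symmetric] uy_def[symmetric]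
    vx_def[symmetric] vy_def[symmetric] Tx_def[symmetric] Ty_def[symmetric] rx_def[symmetric] ry_def[symmetric]
    R_def[symmetric] c_def[symmetric] \<mu>_def[symmetric] \<kappa>_def[symmetric]
  have rT: "0 < r x" "0 < T x" if "x \<in> \<Omega>" for x using pos[OF in_closure[OF that]] by (simp_all add: r_def T_def)
  have r_pos: "\<forall>x\<in>\<Omega>. 0 < r x" and T_pos: "\<forall>x\<in>\<Omega>. 0 < T x" using rT by blast+
  have Tnz: "\<forall>x\<in>\<Omega>. T x \<noteq> 0" using T_pos by force
  note C = C1_primitive[folded r_def u_def v_def T_def ux_def uy_def vx_def vy_def Tx_def Ty_def rx_def ry_def]
  note X' = diff2(1) hess_cont(1,2) and Y' = diff2(2) hess_cont(3,4)
  obtain gux where gux: "C1_on \<Omega> ux gux" using C1_rates(1)[OF X'] unfolding folds by blast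
  obtain guy where guy: "C1_on \<Omega> uy guy" using C1_rates(1)[OF Y'] unfolding folds by blast
  obtain gvx where gvx: "C1_on \<Omega> vx gvx" using C1_rates(2)[OF X'] unfolding folds by blast
  obtain gvy where gvy: "C1_on \<Omega> vy gvy" using C1_rates(2)[OF Y'] unfolding folds by blast
  obtain gTx where gTx: "C1_on \<Omega> Tx gTx" using C1_rates(3)[OF X'] unfolding folds by blast
  obtain gTy where gTy: "C1_on \<Omega> Ty gTy" using C1_rates(3)[OF Y'] unfolding folds by blast
  define xx xy yy where "xx x = 4/3 * \<mu> * ux x - 2/3 * \<mu> * vy x" and "xy x = \<mu> * (uy x + vx x)"
    and "yy x = 4/3 * \<mu> * vy x - 2/3 * \<mu> * ux x" for x
  obtain gxx where gxx: "C1_on \<Omega> xx gxx"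
    using C1_on_diff[OF C1_on_cmult[OF gux, of "4/3 * \<mu>"] C1_on_cmult[OF gvy, of "2/3 * \<mu>"], folded xx_def] by blast
  obtain gxy where gxy: "C1_on \<Omega> xy gxy"
    using C1_on_cmult[OF C1_on_add[OF guy gvx], of \<mu>, folded xy_def] by blast
  obtain gyy where gyy: "C1_on \<Omega> yy gyy"
    using C1_on_diff[OF C1_on_cmult[OF gvy, of "4/3 * \<mu>"] C1_on_cmult[OF gux, of "2/3 * \<mu>"], folded yy_def] by blast
  note ru = C1_on_mult[OF C(1,2)] and rv = C1_on_mult[OF C(1,3)]
  note RrT = C1_on_cmult[OF C1_on_mult[OF C(1,4)], of R]
  note ruu = C1_on_mult[OF ru C(2)] and ruv = C1_on_mult[OF ru C(3)] and rvv = C1_on_mult[OF rv C(3)]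
  note H = C1_on_add[OF C1_on_cmult[OF C1_on_mult[OF C(1,4)], of "c + R"]
      C1_on_mult[OF C1_on_cmult[OF C(1), of "1/2"] C1_on_add[OF C1_on_mult[OF C(2,2)] C1_on_mult[OF C(3,3)]]]]
  note uH = C1_on_mult[OF C(2) H] and vH = C1_on_mult[OF C(3) H]
  note ex = C1_on_add[OF C1_on_add[OF C1_on_mult[OF C(2) gxx] C1_on_mult[OF C(3) gxy]] C1_on_cmult[OF gTx, of \<kappa>]]
  note ey = C1_on_add[OF C1_on_add[OF C1_on_mult[OF C(2) gxy] C1_on_mult[OF C(3) gyy]] C1_on_cmult[OF gTy, of \<kappa>]]
  note S = C1_on_diff[OF C1_on_cmult[OF C1_on_ln[OF C(4) T_pos], of c] C1_on_cmult[OF C1_on_ln[OF C(1) r_pos], of R]]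
  note hx = C1_on_cmult[OF C1_on_divide[OF gTx C(4) Tnz], of \<kappa>] and hy = C1_on_cmult[OF C1_on_divide[OF gTy C(4) Tnz], of \<kappa>]
  note Qx = C1_on_add[OF C1_on_diff[OF C1_on_cmult[OF C1_on_add[OF ru C1_on_diff[OF uH ex]], of K] C1_on_mult[OF ru S]] hx]
  note Qy = C1_on_add[OF C1_on_diff[OF C1_on_cmult[OF C1_on_add[OF rv C1_on_diff[OF vH ey]], of K] C1_on_mult[OF rv S]] hy]
  have flux: "lyapunov_flux_fun G K (s x) (X x) (Y x) =
     (K * (r x * u x + (u x * ((c + R) * (r x * T x) + 1/2 * r x * (u x * u x + v x * v x)) - (u x * xx x + v x * xy x + \<kappa> * Tx x)))
        - r x * u x * (c * ln (T x) - R * ln (r x)) + \<kappa> * (Tx x / T x),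
      K * (r x * v x + (v x * ((c + R) * (r x * T x) + 1/2 * r x * (u x * u x + v x * v x)) - (u x * xy x + v x * yy x + \<kappa> * Ty x)))
        - r x * v x * (c * ln (T x) - R * ln (r x)) + \<kappa> * (Ty x / T x))" for x
    unfolding lyapunov_flux_fun_def Let_def folds xx_def xy_def yy_def by simp
  have inv: "inv_flux_x G (s y) = (r y * u y, r y * u y * u y + R * (r y * T y), r y * u y * v y,
       u y * ((c + R) * (r y * T y) + 1/2 * r y * (u y * u y + v y * v y)))"
     "inv_flux_y G (s y) = (r y * v y, r y * u y * v y, r y * v y * v y + R * (r y * T y),
       v y * ((c + R) * (r y * T y) + 1/2 * r y * (u y * u y + v y * v y)))" if "y \<in> \<Omega>" for y
    using pressure_temperature(1)[OF gas pos(1)[OF in_closure[OF that]]]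
    unfolding inv_flux_x_def inv_flux_y_def Let_def enthalpy[OF in_closure[OF that]] folds
    by (simp_all add: power2_eq_square)
  have visc: "visc_flux_x G \<Omega> s y = (0, xx y, xy y, u y * xx y + v y * xy y + \<kappa> * Tx y)"
     "visc_flux_y G \<Omega> s y = (0, xy y, yy y, u y * xy y + v y * yy y + \<kappa> * Ty y)" if "y \<in> \<Omega>" for y
    unfolding visc_flux_x_def visc_flux_y_def stress_rates[OF in_closure[OF that]]
    unfolding folds xx_def xy_def yy_def by simp_all
  have inv': "\<forall>y\<in>\<Omega>. inv_flux_x G (s y) = (r y * u y, r y * u y * u y + R * (r y * T y), r y * u y * v y,
       u y * ((c + R) * (r y * T y) + 1/2 * r y * (u y * u y + v y * v y)))"
     "\<forall>y\<in>\<Omega>. inv_flux_y G (s y) = (r y * v y, r y * u y * v y, r y * v y * v y + R * (r y * T y),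
       v y * ((c + R) * (r y * T y) + 1/2 * r y * (u y * u y + v y * v y)))"
     "\<forall>y\<in>\<Omega>. visc_flux_x G \<Omega> s y = (0, xx y, xy y, u y * xx y + v y * xy y + \<kappa> * Tx y)"
     "\<forall>y\<in>\<Omega>. visc_flux_y G \<Omega> s y = (0, xy y, yy y, u y * xy y + v y * yy y + \<kappa> * Ty y)"
    using inv visc by blast+
  have fx: "(\<lambda>x. fst (lyapunov_flux_fun G K (s x) (X x) (Y x))) = (\<lambda>x. K * (r x * u x + (u x * ((c + R) * (r x * T x) + 1/2 * r x * (u x * u x + v x * v x)) - (u x * xx x + v x * xy x + \<kappa> * Tx x)))
        - r x * u x * (c * ln (T x) - R * ln (r x)) + \<kappa> * (Tx x / T x))"
     "(\<lambda>x. snd (lyapunov_flux_fun G K (s x) (X x) (Y x))) = (\<lambda>x. K * (r x * v x + (v x * ((c + R) * (r x * T x) + 1/2 * r x * (u x * u x + v x * v x)) - (u x * xy x + v x * yy x + \<kappa> * Ty x)))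
        - r x * v x * (c * ln (T x) - R * ln (r x)) + \<kappa> * (Ty x / T x))"
    unfolding flux by simp_all
  show ?thesis
  proof (rule exI, rule exI, rule conjI[OF Qx[folded fx] conjI[OF Qy[folded fx] ballI]], goal_cases)
    case (1 x)
    then have x: "x \<in> \<Omega>" .
    note t = pderiv_ext_tuple[OF open_\<Omega> x]
    have r0: "0 < dens (s x)" using rT(1)[OF x] by (simp add: r_def)
    define ut vt Tt rt where "ut = velx_rate (s x) (qt x)" and "vt = vely_rate (s x) (qt x)" and "Tt = temp_rate G (s x) (qt x)" and "rt = fst (qt x)"
    have q: "fst (snd (qt x)) = rt * u x + r x * ut" "fst (snd (snd (qt x))) = rt * v x + r x * vt"
      "snd (snd (snd (qt x))) = c * (rt * T x + r x * Tt) + 1/2 * rt * (u x * u x + v x * v x) + r x * (u x * ut + v x * vt)"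
      using rate_inverse[OF gas r0, of "qt x"] unfolding folds ut_def vt_def Tt_def rt_def by simp_all
    have qt: "qt x = (rt, rt * u x + r x * ut, rt * v x + r x * vt,
        c * (rt * T x + r x * Tt) + 1/2 * rt * (u x * u x + v x * v x) + r x * (u x * ut + v x * vt))"
      unfolding q[symmetric] by (simp add: rt_def)
    have ns: "qt x + dx \<Omega> (\<lambda>y. inv_flux_x G (s y)) x + dy \<Omega> (\<lambda>y. inv_flux_y G (s y)) x
      = dx \<Omega> (visc_flux_x G \<Omega> s) x + dy \<Omega> (visc_flux_y G \<Omega> s) x" by (rule NS[OF x])
    note ns' = ns[unfolded qt t[OF ru C1_on_add[OF ruu RrT] ruv uH inv'(1)] t[OF rv ruv C1_on_add[OF rvv RrT] vH inv'(2)]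
       t[OF C1_on_const gxx gxy ex inv'(3)] t[OF C1_on_const gxy gyy ey inv'(4)]]
    have e1: "rt + (rx x * u x + r x * ux x) + (ry x * v x + r x * vy x) = 0"
      using ns' by (simp add: inner_prod_def algebra_simps)
    have e2: "(rt * u x + r x * ut) + (rx x * u x * u x + 2 * r x * u x * ux x + R * (rx x * T x + r x * Tx x))
        + (ry x * u x * v x + r x * uy x * v x + r x * u x * vy x) = fst (gxx x) + snd (gxy x)"
      using ns' by (simp add: inner_prod_def algebra_simps)
    have e3: "(rt * v x + r x * vt) + (rx x * u x * v x + r x * ux x * v x + r x * u x * vx x)
        + (ry x * v x * v x + 2 * r x * v x * vy x + R * (ry x * T x + r x * Ty x)) = fst (gxy x) + snd (gyy x)"
      using ns' by (simp add: inner_prod_def algebra_simps)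
    have e4: "(c * (rt * T x + r x * Tt) + 1/2 * rt * (u x * u x + v x * v x) + r x * (u x * ut + v x * vt))
       + (ux x * ((c + R) * (r x * T x) + 1/2 * r x * (u x * u x + v x * v x)) + u x * ((c + R) * (rx x * T x + r x * Tx x) + 1/2 * rx x * (u x * u x + v x * v x) + r x * (u x * ux x + v x * vx x)))
       + (vy x * ((c + R) * (r x * T x) + 1/2 * r x * (u x * u x + v x * v x)) + v x * ((c + R) * (ry x * T x + r x * Ty x) + 1/2 * ry x * (u x * u x + v x * v x) + r x * (u x * uy x + v x * vy x)))
      = (ux x * xx x + u x * fst (gxx x) + vx x * xy x + v x * fst (gxy x) + \<kappa> * fst (gTx x)) + (uy x * xy x + u x * snd (gxy x) + vy x * yy x + v x * snd (gyy x) + \<kappa> * snd (gTy x))"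
      using ns' by (simp add: inner_prod_def algebra_simps)
    have \<mu>\<kappa>: "0 < \<mu>" "0 < \<kappa>" using gas_okD[OF gas] by (simp_all add: \<mu>_def \<kappa>_def)
    note id = entropy_balance_identity[OF rT[OF x] \<mu>\<kappa> xx_def xy_def yy_def e1 e2 e3 e4]
    define A where "A = rt + (rx x * u x + r x * ux x) + (ry x * v x + r x * vy x)"
    define B1 where "B1 = (c * (rt * T x + r x * Tt) + 1/2 * rt * (u x * u x + v x * v x) + r x * (u x * ut + v x * vt))
       + (ux x * ((c + R) * (r x * T x) + 1/2 * r x * (u x * u x + v x * v x)) + u x * ((c + R) * (rx x * T x + r x * Tx x) + 1/2 * rx x * (u x * u x + v x * v x) + r x * (u x * ux x + v x * vx x)))
       + (vy x * ((c + R) * (r x * T x) + 1/2 * r x * (u x * u x + v x * v x)) + v x * ((c + R) * (ry x * T x + r x * Ty x) + 1/2 * ry x * (u x * u x + v x * v x) + r x * (u x * uy x + v x * vy x)))"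
    define B2 where "B2 = (ux x * xx x + u x * fst (gxx x) + vx x * xy x + v x * fst (gxy x) + \<kappa> * fst (gTx x)) + (uy x * xy x + u x * snd (gxy x) + vy x * yy x + v x * snd (gyy x) + \<kappa> * snd (gTy x))"
    have key: "Z \<le> 0" if "Z = K * A + K * (B1 - B2) + (R * rt * (ln (r x) + 1) - c * rt * ln (T x) - c * r x * Tt / T x
     - ((rx x * u x + r x * ux x) * (c * ln (T x) - R * ln (r x)) + r x * u x * (c * Tx x / T x - R * rx x / r x))
     - ((ry x * v x + r x * vy x) * (c * ln (T x) - R * ln (r x)) + r x * v x * (c * Ty x / T x - R * ry x / r x))
     + \<kappa> * (fst (gTx x) / T x - Tx x * Tx x / (T x * T x)) + \<kappa> * (snd (gTy x) / T x - Ty x * Ty x / (T x * T x)))" for Z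
      using id e1 e4 that unfolding A_def[symmetric] B1_def[symmetric] B2_def[symmetric] by simp
    \<comment> \<open>separates the terms with factor \<open>K\<close>, so that each part can be normalized on its own\<close>
    have comb: "K * m0 + n1 - n2 - n3 + (K * m1 - n4 + n5) + (K * m2 - n6 + n7) = K * A + K * (B1 - B2) + P"
      if "m0 + m1 + m2 = A + (B1 - B2)" "n1 - n2 - n3 - n4 - n6 + n5 + n7 = P"
      for m0 m1 m2 n1 n2 n3 n4 n5 n6 n7 P :: real
    proof -
      have "K * m0 + K * m1 + K * m2 = K * (A + (B1 - B2))" unfolding that(1)[symmetric] by (simp only: distrib_left)
      then show ?thesis using that(2) by (simp only: distrib_left)
    qed
    show ?case
      apply (rule key, unfold lyapunov_rate_def q, unfold folds Tt_def[symmetric] rt_def[symmetric])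
      apply (simp only: fst_add fst_diff fst_scaleR snd_add snd_diff snd_scaleR real_scaleR_def fst_conv snd_conv)
      apply (rule comb)
      subgoal unfolding A_def B1_def B2_def by (simp add: algebra_simps)
      subgoal by (simp add: divide_inverse algebra_simps)
      done
  qed
qed

end

section \<open>Coercivity of the functional and norms\<close>

lemma lyapunov_continuous:
  assumes q: "continuous_on P q" and G: "gas_ok G"
    and pos: "\<And>p. p \<in> P \<Longrightarrow> 0 < dens (q p)" "\<And>p. p \<in> P \<Longrightarrow> 0 < temperature G (q p)"
  shows "continuous_on P (\<lambda>p. lyapunov G K (q p))"
proof -
  have nz: "dens (q p) \<noteq> 0" "temperature G (q p) \<noteq> 0" if "p \<in> P" for p using pos[OF that] by simp_all
  show ?thesis
    unfolding lyapunov_def spec_entropy_def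
    by (intro continuous_intros primitive_continuous[OF q nz(1)] temperature_continuous[OF q nz(1) G]) (auto dest: nz)
qed

lemma lyapunov_rate_continuous:
  assumes q: "continuous_on P q" and G: "gas_ok G" and d: "continuous_on P d"
    and pos: "\<And>p. p \<in> P \<Longrightarrow> 0 < dens (q p)" "\<And>p. p \<in> P \<Longrightarrow> 0 < temperature G (q p)"
  shows "continuous_on P (\<lambda>p. lyapunov_rate G K (q p) (d p))"
proof -
  have nz: "dens (q p) \<noteq> 0" "temperature G (q p) \<noteq> 0" if "p \<in> P" for p using pos[OF that] by simp_all
  show ?thesis
    unfolding lyapunov_rate_def
    by (intro continuous_intros primitive_continuous[OF q nz(1)] temperature_continuous[OF q nz(1) G]
        rate_continuous[OF q nz(1) G d] d) (auto dest: nz)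
qed

lemma lyapunov_flux_fun_continuous:
  assumes q: "continuous_on P q" and G: "gas_ok G" and d: "continuous_on P d1" "continuous_on P d2"
    and pos: "\<And>p. p \<in> P \<Longrightarrow> 0 < dens (q p)" "\<And>p. p \<in> P \<Longrightarrow> 0 < temperature G (q p)"
  shows "continuous_on P (\<lambda>p. lyapunov_flux_fun G K (q p) (d1 p) (d2 p))"
proof -
  have nz: "dens (q p) \<noteq> 0" "temperature G (q p) \<noteq> 0" if "p \<in> P" for p using pos[OF that] by simp_all
  show ?thesis
    unfolding lyapunov_flux_fun_def Let_def
    by (intro continuous_intros primitive_continuous[OF q nz(1)] temperature_continuous[OF q nz(1) G]
        rate_continuous[OF q nz(1) G d(1)] rate_continuous[OF q nz(1) G d(2)]) (auto dest: nz)
qed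

lemma lyapunov_rate_scale: "lyapunov_rate G K q (h *\<^sub>R d) = h * lyapunov_rate G K q d"
  unfolding lyapunov_rate_def temp_rate_def velx_rate_def vely_rate_def
  by (simp add: divide_inverse algebra_simps)

lemma Basis_point: "(1, 0) \<in> (Basis :: point set)" "(0, 1) \<in> (Basis :: point set)"
  by (simp_all add: Basis_prod_def)

lemma lebesgue_on_lborel:
  fixes f :: "point \<Rightarrow> real"
  assumes "open \<Omega>" "bounded \<Omega>" "continuous_on (closure \<Omega>) f"
  shows "integrable (lebesgue_on \<Omega>) f" "(LINT x|lebesgue_on \<Omega>. f x) = (\<integral>z. indicator \<Omega> z * f z \<partial>lborel)"
    "integrable lborel (\<lambda>z. indicator \<Omega> z * f z)"
proof -
  have "bounded (f ` closure \<Omega>)"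
    using assms by (intro compact_imp_bounded compact_continuous_image) auto
  then obtain B where "\<And>z. z \<in> closure \<Omega> \<Longrightarrow> \<bar>f z\<bar> \<le> B" unfolding bounded_iff by auto
  then have B: "\<bar>f z\<bar> \<le> B" if "z \<in> \<Omega>" for z using subsetD[OF closure_subset that] by blast
  show int: "integrable lborel (\<lambda>z. indicator \<Omega> z * f z)"
    by (rule integrable_bounded_open[OF assms(1,2) continuous_on_subset[OF assms(3) closure_subset] B])
  then have m: "(\<lambda>z. indicator \<Omega> z * f z) \<in> borel_measurable lborel" by (rule borel_measurable_integrable)
  have \<Omega>: "\<Omega> \<inter> space lebesgue \<in> sets lebesgue" using assms(1) by simp
  show "integrable (lebesgue_on \<Omega>) f"
    using int integrable_completion[OF m] by (simp add: integrable_restrict_space[OF \<Omega>])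
  show "(LINT x|lebesgue_on \<Omega>. f x) = (\<integral>z. indicator \<Omega> z * f z \<partial>lborel)"
    using integral_completion[OF m] by (simp add: integral_restrict_space[OF \<Omega>])
qed

lemma Linf_L1_norm_leI:
  assumes \<Omega>: "open \<Omega>" "bounded \<Omega>" and f: "continuous_on ({0..T} \<times> closure \<Omega>) (\<lambda>(t, x). f t x)"
    and le: "\<And>t. t \<in> {0..T} \<Longrightarrow> (\<integral>z. indicator \<Omega> z * \<bar>f t z\<bar> \<partial>lborel) \<le> C"
  shows "Linf_L1_norm_le \<Omega> T f C"
  unfolding Linf_L1_norm_le_def
proof
  have "open ({0<..<T} \<times> \<Omega>)" using \<Omega> by (intro open_Times) auto
  moreover have "continuous_on ({0<..<T} \<times> \<Omega>) (\<lambda>(t, x). f t x)"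
    by (rule continuous_on_subset[OF f]) (use closure_subset[of \<Omega>] in auto)
  ultimately show "(\<lambda>(t, x). f t x) \<in> borel_measurable (lebesgue_on ({0<..<T} \<times> \<Omega>))"
    by (intro continuous_imp_measurable_on_sets_lebesgue) auto
  show "AE t in lebesgue_on {0<..<T}. integrable (lebesgue_on \<Omega>) (f t) \<and> (LINT x|lebesgue_on \<Omega>. \<bar>f t x\<bar>) \<le> C"
  proof (rule AE_I2)
    fix t assume "t \<in> space (lebesgue_on {0<..<T})"
    then have t: "t \<in> {0..T}" by (simp add: space_restrict_space)
    have c: "continuous_on (closure \<Omega>) (f t)"
      using continuous_on_compose2[OF f, of "closure \<Omega>" "\<lambda>z. (t, z)"] t by (simp add: continuous_on_Pair image_subset_iff)
    then have "continuous_on (closure \<Omega>) (\<lambda>x. \<bar>f t x\<bar>)" by (intro continuous_intros)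
    from lebesgue_on_lborel(2)[OF \<Omega> this] lebesgue_on_lborel(1)[OF \<Omega> c] le[OF t]
    show "integrable (lebesgue_on \<Omega>) (f t) \<and> (LINT x|lebesgue_on \<Omega>. \<bar>f t x\<bar>) \<le> C" by simp
  qed
qed

lemma H1_domain_le_L2:
  assumes "H1_domain_le \<Omega> f M"
  shows "integrable (lebesgue_on \<Omega>) (\<lambda>x. (f x)\<^sup>2)" "(LINT x|lebesgue_on \<Omega>. (f x)\<^sup>2) \<le> M\<^sup>2"
proof -
  from assms obtain g1 g2 where *: "square_integrable (lebesgue_on \<Omega>) f" "square_integrable (lebesgue_on \<Omega>) g1"
    "square_integrable (lebesgue_on \<Omega>) g2" "sqrt (LINT x|lebesgue_on \<Omega>. (f x)\<^sup>2 + (g1 x)\<^sup>2 + (g2 x)\<^sup>2) \<le> M"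
    unfolding H1_domain_le_def H1_norm_le_def by blast
  then have int: "integrable (lebesgue_on \<Omega>) (\<lambda>x. (f x)\<^sup>2)" "integrable (lebesgue_on \<Omega>) (\<lambda>x. (g1 x)\<^sup>2)"
    "integrable (lebesgue_on \<Omega>) (\<lambda>x. (g2 x)\<^sup>2)" by (auto simp: square_integrable_def)
  then show "integrable (lebesgue_on \<Omega>) (\<lambda>x. (f x)\<^sup>2)" by simp
  let ?I = "LINT x|lebesgue_on \<Omega>. (f x)\<^sup>2 + (g1 x)\<^sup>2 + (g2 x)\<^sup>2"
  have "0 \<le> ?I" by (rule Bochner_Integration.integral_nonneg) simp
  have "(LINT x|lebesgue_on \<Omega>. (f x)\<^sup>2) \<le> ?I"
    by (rule integral_mono) (use int in auto)
  also have "?I = (sqrt ?I)\<^sup>2" using \<open>0 \<le> ?I\<close> by simp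
  also have "\<dots> \<le> M\<^sup>2" using *(4) \<open>0 \<le> ?I\<close> by (intro power_mono) auto
  finally show "(LINT x|lebesgue_on \<Omega>. (f x)\<^sup>2) \<le> M\<^sup>2" .
qed

text \<open>The right-hand side is integrable for initial data in \<open>L\<^sup>2\<close>.\<close>

lemma lyapunov_upper:
  assumes G: "gas_ok G" and \<rho>: "0 < dens q" and p: "0 < pressure G q" and T: "\<epsilon> \<le> temperature G q" and "0 < \<epsilon>" "0 \<le> K"
  shows "lyapunov G K q \<le> (K + gas_const G + cv G * \<bar>ln \<epsilon>\<bar>) * (1 + ((dens q)\<^sup>2 + (energy q)\<^sup>2))"
proof -
  note R = gas_okD[OF G]
  define W where "W = 1 + ((dens q)\<^sup>2 + (energy q)\<^sup>2)"
  have sq: "a \<le> 1/2 + a\<^sup>2 / 2" for a :: real using zero_le_power2[of "a - 1"] by (simp add: power2_diff)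
  have "dens q + energy q \<le> W" "dens q \<le> W"
    using sq[of "dens q"] sq[of "energy q"] zero_le_power2[of "dens q"] zero_le_power2[of "energy q"] unfolding W_def by linarith+
  then have 1: "K * (dens q + energy q) \<le> K * W" and 3: "cv G * \<bar>ln \<epsilon>\<bar> * dens q \<le> cv G * \<bar>ln \<epsilon>\<bar> * W"
    using \<open>0 \<le> K\<close> R by (auto intro!: mult_left_mono)
  have "dens q * ln (dens q) \<le> dens q * dens q" using \<rho> ln_le_minus_one[OF \<rho>] by (intro mult_left_mono) auto
  also have "\<dots> \<le> W" by (simp add: W_def power2_eq_square)
  finally have 2: "gas_const G * (dens q * ln (dens q)) \<le> gas_const G * W" using R by (intro mult_left_mono) auto
  have "- \<bar>ln \<epsilon>\<bar> \<le> ln (temperature G q)" using T \<open>0 < \<epsilon>\<close> ln_le_cancel_iff[of \<epsilon> "temperature G q"] by linarith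
  then have "cv G * dens q * (- \<bar>ln \<epsilon>\<bar>) \<le> cv G * dens q * ln (temperature G q)" using R \<rho> by (intro mult_left_mono) auto
  then have "lyapunov G K q \<le> K * W + gas_const G * W + cv G * \<bar>ln \<epsilon>\<bar> * W"
    using 1 2 3 unfolding lyapunov_def spec_entropy_def by (simp add: algebra_simps)
  then show ?thesis unfolding W_def[symmetric] by (simp add: algebra_simps)
qed

text \<open>Every term of \<open>\<eta> + R = K (\<rho> + E) + R (\<rho> ln \<rho> + 1) - c\<^sub>v \<rho> ln T\<close> is nonnegative except the last one, which is at
  least \<open>- E\<close>. As \<open>K \<ge> 2\<close>, the sum bounds \<open>\<rho>\<close>, \<open>E\<close>, \<open>R (\<rho> ln \<rho> + 1)\<close> and \<open>- c\<^sub>v \<rho> ln T\<close> separately.\<close>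

lemma lyapunov_controls:
  assumes G: "gas_ok G" and \<rho>: "0 < dens q" and T: "0 < temperature G q" and K: "2 \<le> K"
  defines "N \<equiv> (2 + gas_const G / cv G + 1 / gas_const G + 1 / cv G) * (lyapunov G K q + gas_const G) + 1"
  shows "\<bar>dens q\<bar> \<le> N" "\<bar>dens q * ((velx q)\<^sup>2 + (vely q)\<^sup>2)\<bar> \<le> N" "\<bar>pressure G q\<bar> \<le> N"
    "\<bar>dens q * ln (dens q)\<bar> \<le> N" "\<bar>dens q * ln (temperature G q)\<bar> \<le> N"
proof -
  note R = gas_okD[OF G]
  define r T' V2 E c R' where "r = dens q" and "T' = temperature G q" and "V2 = (velx q)\<^sup>2 + (vely q)\<^sup>2" and "E = energy q"
    and "c = cv G" and "R' = gas_const G"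
  note folds = r_def[symmetric] T'_def[symmetric] V2_def[symmetric] E_def[symmetric] c_def[symmetric] R'_def[symmetric]
  have pos: "0 < r" "0 < T'" "0 < c" "0 < R'" "0 \<le> V2" using \<rho> T R by (simp_all add: r_def T'_def c_def R'_def V2_def)
  have p: "pressure G q = R' * (r * T')" and E: "E = c * (r * T') + 1/2 * (r * V2)"
    using pressure_temperature[OF G \<rho>] unfolding folds by simp_all
  define y where "y = lyapunov G K q + R'"
  have y: "y = K * (r + E) + R' * (r * ln r + 1) - c * (r * ln T')"
    unfolding y_def lyapunov_def spec_entropy_def folds by (simp add: algebra_simps)
  have rV: "0 \<le> r * V2" and rT: "0 \<le> c * (r * T')" using pos by simp_all
  have E0: "0 \<le> E" using E rV rT by linarith
  have "2 * (r + E) \<le> K * (r + E)" using K pos E0 by (intro mult_right_mono) auto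
  then have "2 * r + 2 * E \<le> K * (r + E)" by simp
  moreover have l: "0 \<le> R' * (r * ln r + 1)" using mult_ln_ge[OF pos(1)] pos by simp
  moreover have lT: "c * (r * ln T') \<le> E"
  proof -
    have "c * (r * ln T') \<le> c * (r * T')" using pos ln_le_minus_one[OF pos(2)] by (intro mult_left_mono) auto
    then show ?thesis using E rV by linarith
  qed
  moreover have "r \<le> y \<and> E \<le> y \<and> l \<le> y \<and> - X \<le> y"
    if "2 * r + 2 * E \<le> k" "0 \<le> l" "X \<le> E" "y = k + l - X" for k l X
    using that pos E0 by (intro conjI; linarith)
  ultimately have b: "r \<le> y" "E \<le> y" "R' * (r * ln r + 1) \<le> y" "- (c * (r * ln T')) \<le> y"
    using y by blast+
  have y0: "0 \<le> y" using b(2) E0 by linarith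
  have N: "N = 2 * y + R' / c * y + 1 / R' * y + 1 / c * y + 1"
    unfolding N_def folds y_def by (simp add: algebra_simps)
  have n: "0 \<le> R' / c * y" "0 \<le> 1 / R' * y" "0 \<le> 1 / c * y" using y0 pos by simp_all
  show "\<bar>dens q\<bar> \<le> N" unfolding folds N using b(1) n pos y0 by linarith
  show "\<bar>dens q * ((velx q)\<^sup>2 + (vely q)\<^sup>2)\<bar> \<le> N" unfolding folds N using b(2) n E rV rT y0 by linarith
  have "c * (r * T') \<le> y" using b(2) E rV by linarith
  then have "R' / c * (c * (r * T')) \<le> R' / c * y" using pos by (intro mult_left_mono) auto
  then have "R' * (r * T') \<le> R' / c * y" using pos by simp
  moreover have "0 \<le> R' * (r * T')" using pos by simp
  ultimately show "\<bar>pressure G q\<bar> \<le> N" unfolding p N using n y0 by linarith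
  have "1 / R' * (R' * (r * ln r + 1)) \<le> 1 / R' * y" using b(3) pos by (intro mult_left_mono) auto
  then have "r * ln r + 1 \<le> 1 / R' * y" using pos by simp
  then show "\<bar>dens q * ln (dens q)\<bar> \<le> N" unfolding folds N using n y0 mult_ln_ge[OF pos(1)] by linarith
  have "c * (r * ln T') \<le> y" using lT b(2) by linarith
  then have "\<bar>c * (r * ln T')\<bar> \<le> y" using b(4) by linarith
  then have "1 / c * \<bar>c * (r * ln T')\<bar> \<le> 1 / c * y" using pos by (intro mult_left_mono) auto
  then have "\<bar>r * ln T'\<bar> \<le> 1 / c * y" using pos by (simp add: abs_mult)
  then show "\<bar>dens q * ln (temperature G q)\<bar> \<le> N" unfolding folds N using n y0 by linarith
qed

section \<open>The a priori estimates\<close>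

lemma classical_smooth_state:
  assumes G: "gas_ok G" and dom: "planar_domain \<Omega>" and reg: "classical_regularity \<Omega> T w" and adm: "admissible G \<Omega> T w"
    and t: "t \<in> {0<..T}"
  shows "smooth_state G \<Omega> (w t)"
proof -
  note joint = reg[unfolded classical_regularity_def]
  have sl: "continuous_on A (f t)" if "continuous_on (I \<times> A) (\<lambda>(t, x). f t x)" "t \<in> I"
    for f :: "real \<Rightarrow> point \<Rightarrow> state" and I A
    using continuous_on_compose2[OF that(1), of A "\<lambda>z. (t, z)"] that(2) by (simp add: continuous_on_Pair image_subset_iff)
  have t': "t \<in> {0..T}" using t by simp
  have sp: "w t differentiable (at x)" "\<forall>i\<in>Basis. pderiv_ext \<Omega> i (w t) differentiable (at x)" if "x \<in> \<Omega>" for x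
    using joint t that by blast+
  have c1: "continuous_on (closure \<Omega>) (pderiv_ext \<Omega> i (w t))" if "i \<in> Basis" for i
    using joint that by (intro sl[where f="\<lambda>t. pderiv_ext \<Omega> i (w t)", OF _ t]) blast
  have c2: "continuous_on \<Omega> (pderiv_ext \<Omega> j (pderiv_ext \<Omega> i (w t)))" if "i \<in> Basis" "j \<in> Basis" for i j
    using joint that by (intro sl[where f="\<lambda>t. pderiv_ext \<Omega> j (pderiv_ext \<Omega> i (w t))", OF _ t]) blast
  show ?thesis
  proof
    show "gas_ok G" by (rule G)
    show "open \<Omega>" using dom by (simp add: planar_domain_def)
    show "continuous_on (closure \<Omega>) (w t)" using joint by (intro sl[OF _ t']) blast
    show "w t differentiable (at x)" if "x \<in> \<Omega>" for x by (rule sp(1)[OF that])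
    show "continuous_on (closure \<Omega>) (dx \<Omega> (w t))" "continuous_on (closure \<Omega>) (dy \<Omega> (w t))"
      by (rule c1 Basis_point)+
    show "dx \<Omega> (w t) differentiable (at x)" if "x \<in> \<Omega>" for x using sp(2)[OF that] Basis_point(1) by (rule bspec)
    show "dy \<Omega> (w t) differentiable (at x)" if "x \<in> \<Omega>" for x using sp(2)[OF that] Basis_point(2) by (rule bspec)
    show "continuous_on \<Omega> (dx \<Omega> (dx \<Omega> (w t)))" "continuous_on \<Omega> (dy \<Omega> (dx \<Omega> (w t)))"
      "continuous_on \<Omega> (dx \<Omega> (dy \<Omega> (w t)))" "continuous_on \<Omega> (dy \<Omega> (dy \<Omega> (w t)))"
      by (rule c2 Basis_point)+
    show "0 < dens (w t x)" "0 < temperature G (w t x)" if "x \<in> closure \<Omega>" for x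
      using adm t' that unfolding admissible_def by blast+
  qed
qed

lemma boundary_data_bvals_ok:
  assumes "boundary_data_ok G \<Omega> T M \<epsilon> b" "t \<in> {0..T}" "x \<in> frontier \<Omega>"
  shows "bvals_ok G M \<epsilon> (b t x)"
proof -
  have "\<bar>c (b t x)\<bar> \<le> M" if "c \<in> {rho_b, p_b, u_b, v_b, vtau_b}" for c
    using assms that unfolding boundary_data_ok_def by blast
  from this[of rho_b] this[of p_b] this[of u_b] this[of v_b] this[of vtau_b] 
  have "\<bar>rho_b (b t x)\<bar> \<le> M" "\<bar>p_b (b t x)\<bar> \<le> M" "\<bar>u_b (b t x)\<bar> \<le> M" "\<bar>v_b (b t x)\<bar> \<le> M" "\<bar>vtau_b (b t x)\<bar> \<le> M"
    by simp_all
  moreover have "\<epsilon> \<le> rho_b (b t x)" "\<epsilon> \<le> p_b (b t x)" "\<epsilon> \<le> temp_b G (b t x)"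
    using assms unfolding boundary_data_ok_def by blast+
  ultimately show ?thesis by (auto simp: bvals_ok_def abs_le_iff)
qed

lemma lyapunov_integral_bound:
  assumes G: "gas_ok G" and dom: "planar_domain \<Omega>" and "0 < \<epsilon>" and K: "1 + 2 * gas_const G \<le> K"
  obtains B where "0 \<le> B"
    "\<And>T s0 b w t. \<lbrakk>boundary_data_ok G \<Omega> T M \<epsilon> b; admissible_solution G \<Omega> T s0 b w; t \<in> {0..T}\<rbrakk> \<Longrightarrow>
      (\<integral>z. indicator \<Omega> z * lyapunov G K (w t z) \<partial>lborel) \<le> (\<integral>z. indicator \<Omega> z * lyapunov G K (w 0 z) \<partial>lborel) + B * t"
proof -
  obtain C where C: "0 \<le> C" and boundary: "\<And>q B n b1 b2 b3 b4 h. \<lbrakk>0 < dens q; 0 < temperature G q; norm n = 1; bvals_ok G M \<epsilon> B;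
      supersonic_inflow G q B n \<Longrightarrow> normal_vel_b B n < 0 \<and> \<bar>normal_vel_b B n\<bar> > sound_b G B;
      boundary_flux G q B n = (b1, b2, b3, b4);
      dens q * normal_vel q n = b1;
      h = normal_vel q n * (energy q - dens q * ((velx q)\<^sup>2 + (vely q)\<^sup>2)) + velx q * b2 + vely q * b3 - b4\<rbrakk>
     \<Longrightarrow> - C \<le> h / temperature G q - dens q * spec_entropy G q * normal_vel q n + K * (b1 + b4)"
    using boundary_entropy_bound[OF G \<open>0 < \<epsilon>\<close> K, of M] by blast
  show ?thesis
  proof (rule evolution_inequality[OF dom])
    fix A :: real
    assume A: "0 \<le> A" and evol: "\<And>(T::real) C \<eta> \<eta>t Q g1 g2 t. \<lbrakk>0 \<le> C;
      continuous_on ({0..T} \<times> closure \<Omega>) (\<lambda>(t, z). \<eta> t z);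
      \<And>t z. t \<in> {0<..T} \<Longrightarrow> z \<in> \<Omega> \<Longrightarrow> ((\<lambda>s. \<eta> s z) has_real_derivative \<eta>t t z) (at t within {0..T});
      continuous_on ({0<..T} \<times> \<Omega>) (\<lambda>(t, z). \<eta>t t z);
      continuous_on ({0<..T} \<times> closure \<Omega>) (\<lambda>(t, z). Q t z);
      \<And>t. t \<in> {0<..T} \<Longrightarrow> C1_on \<Omega> (\<lambda>z. fst (Q t z)) (g1 t);
      \<And>t. t \<in> {0<..T} \<Longrightarrow> C1_on \<Omega> (\<lambda>z. snd (Q t z)) (g2 t);
      \<And>t z. t \<in> {0<..T} \<Longrightarrow> z \<in> \<Omega> \<Longrightarrow> \<eta>t t z + fst (g1 t z) + snd (g2 t z) \<le> 0;
      \<And>t x n. t \<in> {0<..T} \<Longrightarrow> outward_normal \<Omega> x n \<Longrightarrow> - C \<le> Q t x \<bullet> n;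
      t \<in> {0..T}\<rbrakk>
     \<Longrightarrow> (\<integral>z. indicator \<Omega> z * \<eta> t z \<partial>lborel) \<le> (\<integral>z. indicator \<Omega> z * \<eta> 0 z \<partial>lborel) + A * C * t"
    show thesis
    proof (rule that[of "A * C"])
      show "0 \<le> A * C" using A C by simp
      fix T s0 b w t
      assume data: "boundary_data_ok G \<Omega> T M \<epsilon> b" and sol: "admissible_solution G \<Omega> T s0 b w" and t: "t \<in> {0..T}"
      have reg: "classical_regularity \<Omega> T w" and adm: "admissible G \<Omega> T w" and ns: "navier_stokes G \<Omega> T w"
        and bc: "\<And>t x n. t \<in> {0<..T} \<Longrightarrow> outward_normal \<Omega> x n \<Longrightarrow> boundary_condition G \<Omega> (w t) (b t) x n"
        and sup: "\<And>t x n. t \<in> {0..T} \<Longrightarrow> outward_normal \<Omega> x n \<Longrightarrow> supersonic_inflow G (w t x) (b t x) n \<Longrightarrow>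
          normal_vel_b (b t x) n < 0 \<and> \<bar>normal_vel_b (b t x) n\<bar> > sound_b G (b t x)"
        using sol unfolding admissible_solution_def by blast+
      have pos: "0 < dens (w t x)" "0 < temperature G (w t x)" if "t \<in> {0..T}" "x \<in> closure \<Omega>" for t x
        using adm that unfolding admissible_def by blast+
      have in_cl: "x \<in> closure \<Omega>" if "x \<in> \<Omega>" for x by (rule subsetD[OF closure_subset that])
      have smooth: "smooth_state G \<Omega> (w t)" if "t \<in> {0<..T}" for t
        by (rule classical_smooth_state[OF G dom reg adm that])
      note joint = reg[unfolded classical_regularity_def]
      define wt where "wt t x = vector_derivative (\<lambda>s. w s x) (at t within {0..T})" for t x
      define Q where "Q t x = lyapunov_flux_fun G K (w t x) (dx \<Omega> (w t) x) (dy \<Omega> (w t) x)" for t x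
      have wt: "((\<lambda>s. w s x) has_derivative (\<lambda>h. h *\<^sub>R wt t x)) (at t within {0..T})" if "t \<in> {0<..T}" "x \<in> \<Omega>" for t x
      proof -
        have "(\<lambda>s. w s x) differentiable (at t within {0..T})" using joint that by blast
        then show ?thesis unfolding wt_def vector_derivative_works has_vector_derivative_def .
      qed
      have w_cont: "continuous_on ({0..T} \<times> closure \<Omega>) (\<lambda>p. w (fst p) (snd p))"
        using joint by (simp add: case_prod_beta')
      have grad_cont: "continuous_on ({0<..T} \<times> closure \<Omega>) (\<lambda>p. dx \<Omega> (w (fst p)) (snd p))"
        "continuous_on ({0<..T} \<times> closure \<Omega>) (\<lambda>p. dy \<Omega> (w (fst p)) (snd p))"
        using bspec[OF joint[THEN conjunct2, THEN conjunct2, THEN conjunct1] Basis_point(1)]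
          bspec[OF joint[THEN conjunct2, THEN conjunct2, THEN conjunct1] Basis_point(2)]
        by (simp_all add: case_prod_beta')
      have wt_cont: "continuous_on ({0<..T} \<times> \<Omega>) (\<lambda>p. wt (fst p) (snd p))"
        using joint by (simp add: case_prod_beta' wt_def)
      have balance: "\<exists>g1 g2. C1_on \<Omega> (\<lambda>z. fst (Q t z)) g1 \<and> C1_on \<Omega> (\<lambda>z. snd (Q t z)) g2 \<and>
          (\<forall>z\<in>\<Omega>. lyapunov_rate G K (w t z) (wt t z) + fst (g1 z) + snd (g2 z) \<le> 0)" if t: "t \<in> {0<..T}" for t
        unfolding Q_def
        by (rule smooth_state.interior_balance[OF smooth[OF t]]) (use ns t in \<open>auto simp: navier_stokes_def wt_def\<close>)
      then have "\<forall>t\<in>{0<..T}. \<exists>g1. \<exists>g2. C1_on \<Omega> (\<lambda>z. fst (Q t z)) g1 \<and> C1_on \<Omega> (\<lambda>z. snd (Q t z)) g2 \<and>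
          (\<forall>z\<in>\<Omega>. lyapunov_rate G K (w t z) (wt t z) + fst (g1 z) + snd (g2 z) \<le> 0)" by (rule ballI)
      from this[unfolded bchoice_iff] obtain g1 g2 where
        g: "\<forall>t\<in>{0<..T}. C1_on \<Omega> (\<lambda>z. fst (Q t z)) (g1 t) \<and> C1_on \<Omega> (\<lambda>z. snd (Q t z)) (g2 t) \<and>
          (\<forall>z\<in>\<Omega>. lyapunov_rate G K (w t z) (wt t z) + fst (g1 t z) + snd (g2 t z) \<le> 0)"
        by (elim exE)
      show "(\<integral>z. indicator \<Omega> z * lyapunov G K (w t z) \<partial>lborel) \<le> (\<integral>z. indicator \<Omega> z * lyapunov G K (w 0 z) \<partial>lborel) + A * C * t"
      proof (rule evol[OF C _ _ _ _ _ _ _ _ t, where \<eta>t="\<lambda>t z. lyapunov_rate G K (w t z) (wt t z)" and Q=Q and ?g1.0=g1 and ?g2.0=g2])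
        show "continuous_on ({0..T} \<times> closure \<Omega>) (\<lambda>(t, z). lyapunov G K (w t z))"
          unfolding case_prod_beta' by (rule lyapunov_continuous[OF w_cont G]) (use pos in auto)
        show "((\<lambda>s. lyapunov G K (w s z)) has_real_derivative lyapunov_rate G K (w t z) (wt t z)) (at t within {0..T})"
          if "t \<in> {0<..T}" "z \<in> \<Omega>" for t z
        proof -
          have "t \<in> {0..T}" using that by simp
          from lyapunov_has_derivative[OF wt[OF that] G this pos(1)[OF _ in_cl[OF that(2)]] pos(2)[OF _ in_cl[OF that(2)]]]
          show ?thesis unfolding has_field_derivative_def lyapunov_rate_scale by (simp add: mult.commute[of _ "lyapunov_rate _ _ _ _"])
        qed
        show "continuous_on ({0<..T} \<times> \<Omega>) (\<lambda>(t, z). lyapunov_rate G K (w t z) (wt t z))"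
          unfolding case_prod_beta'
        proof (rule lyapunov_rate_continuous[OF _ G wt_cont])
          show "continuous_on ({0<..T} \<times> \<Omega>) (\<lambda>p. w (fst p) (snd p))"
            by (rule continuous_on_subset[OF w_cont]) (use in_cl in auto)
        qed (use pos in_cl in auto)
        show "continuous_on ({0<..T} \<times> closure \<Omega>) (\<lambda>(t, z). Q t z)"
          unfolding case_prod_beta' Q_def
        proof (rule lyapunov_flux_fun_continuous[OF _ G grad_cont])
          show "continuous_on ({0<..T} \<times> closure \<Omega>) (\<lambda>p. w (fst p) (snd p))"
            by (rule continuous_on_subset[OF w_cont]) auto
        qed (use pos in auto)
        show "C1_on \<Omega> (\<lambda>z. fst (Q t z)) (g1 t)" if "t \<in> {0<..T}" for t using bspec[OF g that] by blast
        show "C1_on \<Omega> (\<lambda>z. snd (Q t z)) (g2 t)" if "t \<in> {0<..T}" for t using bspec[OF g that] by blast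
        show "lyapunov_rate G K (w t z) (wt t z) + fst (g1 t z) + snd (g2 t z) \<le> 0" if "t \<in> {0<..T}" "z \<in> \<Omega>" for t z
          using bspec[OF g that(1)] that(2) by blast
        show "- C \<le> Q t x \<bullet> n" if t: "t \<in> {0<..T}" and n: "outward_normal \<Omega> x n" for t x n
        proof -
          have t': "t \<in> {0..T}" using t by simp
          have x: "x \<in> frontier \<Omega>" "x \<in> closure \<Omega>" and n1: "norm n = 1"
            using n by (auto simp: outward_normal_def frontier_def)
          note pos' = pos[OF t' x(2)]
          obtain b1 b2 b3 b4 where bf: "boundary_flux G (w t x) (b t x) n = (b1, b2, b3, b4)" by (cases "boundary_flux G (w t x) (b t x) n")
          note heat = boundary_condition_heat_flux[OF G pos'(1) bc[OF t n] bf]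
          have "- C \<le> cond G * (fst n * dx \<Omega> (\<lambda>y. temperature G (w t y)) x + snd n * dy \<Omega> (\<lambda>y. temperature G (w t y)) x) / temperature G (w t x)
            - dens (w t x) * spec_entropy G (w t x) * normal_vel (w t x) n + K * (b1 + b4)"
            by (rule boundary[OF pos' n1 boundary_data_bvals_ok[OF data t' x(1)] sup[OF t' n] bf heat(1,2)])
          also have "\<dots> = lyapunov_flux G \<Omega> K (w t) x \<bullet> n"
            unfolding heat(3)[symmetric] lyapunov_flux_def normal_vel_def inner_prod_def
            by (simp add: add_divide_distrib algebra_simps)
          also have "lyapunov_flux G \<Omega> K (w t) x = Q t x"
            unfolding Q_def by (rule smooth_state.lyapunov_flux_eq[OF smooth[OF t] x(2)])
          finally show ?thesis .
        qed
      qed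
    qed
  qed
qed

lemma initial_lyapunov_bound:
  assumes G: "gas_ok G" and \<Omega>: "open \<Omega>" "bounded \<Omega>" and "0 < \<epsilon>" "0 \<le> K"
    and init: "initial_data_ok G \<Omega> M \<epsilon> b s0" and cont: "continuous_on (closure \<Omega>) s0"
  shows "(\<integral>z. indicator \<Omega> z * lyapunov G K (s0 z) \<partial>lborel)
    \<le> (K + gas_const G + cv G * \<bar>ln \<epsilon>\<bar>) * (measure (lebesgue_on \<Omega>) \<Omega> + 2 * M\<^sup>2)"
proof -
  define k where "k = K + gas_const G + cv G * \<bar>ln \<epsilon>\<bar>"
  have k: "0 \<le> k" using gas_okD[OF G] \<open>0 \<le> K\<close> by (simp add: k_def)
  have low: "\<epsilon> \<le> dens (s0 x)" "\<epsilon> \<le> pressure G (s0 x)" "\<epsilon> \<le> temperature G (s0 x)" if "x \<in> closure \<Omega>" for x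
    using init that unfolding initial_data_ok_def by blast+
  have in_cl: "x \<in> closure \<Omega>" if "x \<in> \<Omega>" for x by (rule subsetD[OF closure_subset that])
  have "(1, 0, 0, 0) \<in> (Basis :: state set)" "(0, 0, 0, 1) \<in> (Basis :: state set)"
    by (simp_all add: Basis_prod_def zero_prod_def)
  then have "H1_domain_le \<Omega> (\<lambda>x. s0 x \<bullet> (1, 0, 0, 0)) M" "H1_domain_le \<Omega> (\<lambda>x. s0 x \<bullet> (0, 0, 0, 1)) M"
    using init unfolding initial_data_ok_def by blast+
  then have H1: "H1_domain_le \<Omega> (\<lambda>x. dens (s0 x)) M" "H1_domain_le \<Omega> (\<lambda>x. energy (s0 x)) M"
    by (simp_all add: inner_prod_def state_components)
  note L2 = H1_domain_le_L2[OF H1(1)] H1_domain_le_L2[OF H1(2)]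
  have \<eta>c: "continuous_on (closure \<Omega>) (\<lambda>x. lyapunov G K (s0 x))"
    by (rule lyapunov_continuous[OF cont G]) (use low \<open>0 < \<epsilon>\<close> in force)+
  have one: "integrable (lebesgue_on \<Omega>) (\<lambda>x. 1::real)"
    by (rule lebesgue_on_lborel(1)[OF \<Omega>]) simp
  have "(\<integral>z. indicator \<Omega> z * lyapunov G K (s0 z) \<partial>lborel) = (LINT x|lebesgue_on \<Omega>. lyapunov G K (s0 x))"
    by (rule lebesgue_on_lborel(2)[OF \<Omega> \<eta>c, symmetric])
  also have "\<dots> \<le> (LINT x|lebesgue_on \<Omega>. k * (1 + ((dens (s0 x))\<^sup>2 + (energy (s0 x))\<^sup>2)))"
  proof (rule integral_mono)
    show "integrable (lebesgue_on \<Omega>) (\<lambda>x. lyapunov G K (s0 x))" by (rule lebesgue_on_lborel(1)[OF \<Omega> \<eta>c])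
    show "integrable (lebesgue_on \<Omega>) (\<lambda>x. k * (1 + ((dens (s0 x))\<^sup>2 + (energy (s0 x))\<^sup>2)))"
      by (intro integrable_mult_right Bochner_Integration.integrable_add one L2)
    fix x assume "x \<in> space (lebesgue_on \<Omega>)"
    then have "x \<in> closure \<Omega>" by (intro in_cl) (simp add: space_restrict_space)
    from low[OF this] show "lyapunov G K (s0 x) \<le> k * (1 + ((dens (s0 x))\<^sup>2 + (energy (s0 x))\<^sup>2))"
      unfolding k_def using \<open>0 < \<epsilon>\<close> \<open>0 \<le> K\<close> by (intro lyapunov_upper[OF G]) auto
  qed
  also have "\<dots> = k * ((LINT x|lebesgue_on \<Omega>. 1) + ((LINT x|lebesgue_on \<Omega>. (dens (s0 x))\<^sup>2) + (LINT x|lebesgue_on \<Omega>. (energy (s0 x))\<^sup>2)))"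
    by (simp only: integral_mult_right_zero Bochner_Integration.integral_add[OF one Bochner_Integration.integrable_add[OF L2(1,3)]]
        Bochner_Integration.integral_add[OF L2(1,3)])
  also have "\<dots> \<le> k * (measure (lebesgue_on \<Omega>) \<Omega> + 2 * M\<^sup>2)"
    using L2(2,4) k by (intro mult_left_mono) (auto simp: space_restrict_space)
  finally show ?thesis by (simp add: k_def)
qed

theorem theorem2p2:
  fixes G :: gas and \<Omega> :: "point set" and tmax M \<epsilon> :: real
  assumes "gas_ok G" and "planar_domain \<Omega>" and "0 < tmax" and "0 < \<epsilon>"
  shows "\<exists>C. \<forall>s0 b w.
     boundary_data_ok G \<Omega> tmax M \<epsilon> b \<and> initial_data_ok G \<Omega> M \<epsilon> b s0 \<and>
     admissible_solution G \<Omega> tmax s0 b w \<longrightarrow>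
     Linf_L1_norm_le \<Omega> tmax (\<lambda>t x. dens (w t x)) C \<and>
     Linf_L1_norm_le \<Omega> tmax (\<lambda>t x. dens (w t x) * ((velx (w t x))\<^sup>2 + (vely (w t x))\<^sup>2)) C \<and>
     Linf_L1_norm_le \<Omega> tmax (\<lambda>t x. pressure G (w t x)) C \<and>
     Linf_L1_norm_le \<Omega> tmax (\<lambda>t x. dens (w t x) * ln (dens (w t x))) C \<and>
     Linf_L1_norm_le \<Omega> tmax (\<lambda>t x. dens (w t x) * ln (temperature G (w t x))) C"
proof -
  note G = \<open>gas_ok G\<close>
  have \<Omega>: "open \<Omega>" "bounded \<Omega>" using assms(2) by (auto simp: planar_domain_def)
  define K where "K = 2 + 2 * gas_const G"
  have K: "1 + 2 * gas_const G \<le> K" "2 \<le> K" "0 \<le> K" using gas_okD[OF G] by (simp_all add: K_def)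
  obtain B where B: "0 \<le> B"
    "\<And>T s0 b w t. \<lbrakk>boundary_data_ok G \<Omega> T M \<epsilon> b; admissible_solution G \<Omega> T s0 b w; t \<in> {0..T}\<rbrakk> \<Longrightarrow>
      (\<integral>z. indicator \<Omega> z * lyapunov G K (w t z) \<partial>lborel) \<le> (\<integral>z. indicator \<Omega> z * lyapunov G K (w 0 z) \<partial>lborel) + B * t"
    using lyapunov_integral_bound[OF G assms(2) \<open>0 < \<epsilon>\<close> K(1), of M] by blast
  define m where "m = (\<integral>z. indicator \<Omega> z * (1::real) \<partial>(lborel :: point measure))"
  define J where "J = (K + gas_const G + cv G * \<bar>ln \<epsilon>\<bar>) * (measure (lebesgue_on \<Omega>) \<Omega> + 2 * M\<^sup>2) + B * tmax"
  define c where "c = 2 + gas_const G / cv G + 1 / gas_const G + 1 / cv G"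
  have c: "0 \<le> c" using gas_okD[OF G] by (simp add: c_def)
  define C where "C = c * (J + gas_const G * m) + m"
  have main: "Linf_L1_norm_le \<Omega> tmax (\<lambda>t x. F (w t x)) C"
    if data: "boundary_data_ok G \<Omega> tmax M \<epsilon> b" and init: "initial_data_ok G \<Omega> M \<epsilon> b s0"
      and sol: "admissible_solution G \<Omega> tmax s0 b w"
      and F: "continuous_on ({0..tmax} \<times> closure \<Omega>) (\<lambda>p. F (w (fst p) (snd p)))"
        "\<And>t x. t \<in> {0..tmax} \<Longrightarrow> x \<in> closure \<Omega> \<Longrightarrow> \<bar>F (w t x)\<bar> \<le> c * (lyapunov G K (w t x) + gas_const G) + 1"
    for s0 b w and F :: "state \<Rightarrow> real"
  proof (rule Linf_L1_norm_leI[OF \<Omega>])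
    show "continuous_on ({0..tmax} \<times> closure \<Omega>) (\<lambda>(t, x). F (w t x))" using F(1) by (simp add: case_prod_beta')
    fix t assume t: "t \<in> {0..tmax}"
    have in_cl: "x \<in> closure \<Omega>" if "x \<in> \<Omega>" for x by (rule subsetD[OF closure_subset that])
    have w_cont: "continuous_on (closure \<Omega>) (w t)" if "t \<in> {0..tmax}" for t
    proof -
      have "continuous_on ({0..tmax} \<times> closure \<Omega>) (\<lambda>(t, x). w t x)"
        using sol unfolding admissible_solution_def classical_regularity_def by blast
      from continuous_on_compose2[OF this, of "closure \<Omega>" "\<lambda>z. (t, z)"] that
      show ?thesis by (simp add: continuous_on_Pair image_subset_iff)
    qed
    have pos: "0 < dens (w t x)" "0 < temperature G (w t x)" if "x \<in> closure \<Omega>" for x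
      using sol t that unfolding admissible_solution_def admissible_def by blast+
    have w0: "w 0 x = s0 x" if "x \<in> closure \<Omega>" for x
      using sol that unfolding admissible_solution_def by blast
    have "0 \<in> {0..tmax}" using assms(3) by simp
    then have s0_cont: "continuous_on (closure \<Omega>) s0"
      by (rule continuous_on_eq[OF w_cont w0])
    have \<eta>c: "continuous_on (closure \<Omega>) (\<lambda>x. lyapunov G K (w t x))"
      by (rule lyapunov_continuous[OF w_cont[OF t] G pos])
    have Fc: "continuous_on (closure \<Omega>) (\<lambda>x. F (w t x))"
      using continuous_on_compose2[OF F(1), of "closure \<Omega>" "\<lambda>z. (t, z)"] t by (simp add: continuous_on_Pair image_subset_iff)
    note i\<eta> = lebesgue_on_lborel(3)[OF \<Omega> \<eta>c]
    have one: "integrable lborel (\<lambda>z. indicator \<Omega> z * (1::real))"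
      by (rule lebesgue_on_lborel(3)[OF \<Omega>]) simp
    have "(\<integral>z. indicator \<Omega> z * lyapunov G K (w 0 z) \<partial>lborel) = (\<integral>z. indicator \<Omega> z * lyapunov G K (s0 z) \<partial>lborel)"
      by (rule Bochner_Integration.integral_cong[OF refl]) (auto simp: indicator_def w0 in_cl)
    then have init_le: "(\<integral>z. indicator \<Omega> z * lyapunov G K (w t z) \<partial>lborel) \<le> J"
      using B(2)[OF data sol t] initial_lyapunov_bound[OF G \<Omega> \<open>0 < \<epsilon>\<close> K(3) init s0_cont]
        mult_left_mono[OF _ B(1), of t tmax] t unfolding J_def by simp
    have "(\<integral>z. indicator \<Omega> z * \<bar>F (w t z)\<bar> \<partial>lborel)
      \<le> (\<integral>z. c * (indicator \<Omega> z * lyapunov G K (w t z) + gas_const G * (indicator \<Omega> z * 1)) + indicator \<Omega> z * 1 \<partial>lborel)"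
    proof (rule integral_mono)
      show "integrable lborel (\<lambda>z. indicator \<Omega> z * \<bar>F (w t z)\<bar>)"
        by (rule lebesgue_on_lborel(3)[OF \<Omega>]) (intro continuous_intros Fc)
      show "integrable lborel (\<lambda>z. c * (indicator \<Omega> z * lyapunov G K (w t z) + gas_const G * (indicator \<Omega> z * 1)) + indicator \<Omega> z * 1)"
        by (intro Bochner_Integration.integrable_add integrable_mult_right i\<eta> one)
      show "indicator \<Omega> z * \<bar>F (w t z)\<bar> \<le> c * (indicator \<Omega> z * lyapunov G K (w t z) + gas_const G * (indicator \<Omega> z * 1)) + indicator \<Omega> z * 1" for z
        using F(2)[OF t in_cl, of z] by (simp add: indicator_def)
    qed
    also have "\<dots> = c * ((\<integral>z. indicator \<Omega> z * lyapunov G K (w t z) \<partial>lborel) + gas_const G * m) + m"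
      unfolding m_def
      by (simp only: Bochner_Integration.integral_add[OF integrable_mult_right[OF Bochner_Integration.integrable_add[OF i\<eta> integrable_mult_right[OF one]]] one]
         Bochner_Integration.integral_add[OF i\<eta> integrable_mult_right[OF one]] integral_mult_right_zero)
    also have "\<dots> \<le> C" unfolding C_def using init_le c by (simp add: mult_left_mono)
    finally show "(\<integral>z. indicator \<Omega> z * \<bar>F (w t z)\<bar> \<partial>lborel) \<le> C" .
  qed
  show ?thesis
  proof (intro exI allI impI)
    fix s0 b w
    assume *: "boundary_data_ok G \<Omega> tmax M \<epsilon> b \<and> initial_data_ok G \<Omega> M \<epsilon> b s0 \<and> admissible_solution G \<Omega> tmax s0 b w"
    then have sol: "admissible_solution G \<Omega> tmax s0 b w" by blast
    have pos: "0 < dens (w t x)" "0 < temperature G (w t x)" if "t \<in> {0..tmax}" "x \<in> closure \<Omega>" for t x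
      using sol that unfolding admissible_solution_def admissible_def by blast+
    let ?P = "{0..tmax} \<times> closure \<Omega>" and ?w = "\<lambda>p. w (fst p) (snd p)"
    have w: "continuous_on ?P ?w"
      using sol unfolding admissible_solution_def classical_regularity_def by (simp add: case_prod_beta')
    have nz: "dens (?w p) \<noteq> 0" "temperature G (?w p) \<noteq> 0" if "p \<in> ?P" for p using pos[of "fst p" "snd p"] that by auto
    have nz_all: "\<forall>p\<in>?P. dens (?w p) \<noteq> 0" "\<forall>p\<in>?P. temperature G (?w p) \<noteq> 0" using nz by blast+
    note cont = primitive_continuous[OF w nz(1)] temperature_continuous[OF w nz(1) G]
    note bound = lyapunov_controls[OF G pos K(2), folded c_def]
    have pc: "continuous_on ?P (\<lambda>p. pressure G (?w p))"
      unfolding pressure_def by (intro continuous_intros cont)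
    show "Linf_L1_norm_le \<Omega> tmax (\<lambda>t x. dens (w t x)) C \<and>
      Linf_L1_norm_le \<Omega> tmax (\<lambda>t x. dens (w t x) * ((velx (w t x))\<^sup>2 + (vely (w t x))\<^sup>2)) C \<and>
      Linf_L1_norm_le \<Omega> tmax (\<lambda>t x. pressure G (w t x)) C \<and>
      Linf_L1_norm_le \<Omega> tmax (\<lambda>t x. dens (w t x) * ln (dens (w t x))) C \<and>
      Linf_L1_norm_le \<Omega> tmax (\<lambda>t x. dens (w t x) * ln (temperature G (w t x))) C"
      using *
      by (intro conjI main[of b s0 w "\<lambda>q. dens q"] main[of b s0 w "\<lambda>q. dens q * ((velx q)\<^sup>2 + (vely q)\<^sup>2)"]
          main[of b s0 w "\<lambda>q. pressure G q"] main[of b s0 w "\<lambda>q. dens q * ln (dens q)"]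
          main[of b s0 w "\<lambda>q. dens q * ln (temperature G q)"] bound continuous_intros cont pc)
        (rule nz_all | blast)+
  qed
qed

end
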